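(* Let $K$ be a field with $\mathrm{char}(K)\ne2,3$ and $g$ a binary cubic form over $K$ with discriminant $\Delta\in K^*$. (1) The group $\mathcal{A}_1(g)$ of $\mathrm{SL}(2,K)$-automorphisms of $g$ is trivial unless $\Delta$ is a square in $K$, in which case it is cyclic of order $3$. (2) The group $\mathcal{A}(g)$ of $\mathrm{GL}(2,K)$-automorphisms of $g$, modulo scalars, is isomorphic to a subgroup of $S_3$, namely the centraliser in $S_3$ of the Galois group of $g$ (acting on the three roots of $g$). Specifically: $\mathcal{A}(g)$ is trivial iff $g$ is irreducible over $K$ and $\Delta\notin K^{*2}$; $\mathcal{A}(g)\cong C_3$ iff $g$ is irreducible over $K$ and $\Delta\in K^{*2}$; $\mathcal{A}(g)\cong C_2$ iff $g$ is reducible over $K$ and $\Delta\notin K^{*2}$ (so $g$ has exactly one root over $K$); $\mathcal{A}(g)\cong S_3$ iff $g$ is reducible over $K$ and $\Delta\in K^{*2}$ (so $g$ splits completely over $K$).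
   Context: Discriminant of $aX^3+bX^2Y+cXY^2+dY^3$: $b^2c^2-4ac^3-4b^3d-27a^2d^2+18abcd$. For $M=\begin{pmatrix}r&s\\t&u\end{pmatrix}\in\mathrm{GL}(2,K)$, $g^M(X,Y)=\det(M)^{-1}g(rX+tY,sX+uY)$. $\mathcal{A}(g)=\{M\in\mathrm{GL}(2,K): g^M=g\}$ and $\mathcal{A}_1(g)=\mathcal{A}(g)\cap\mathrm{SL}(2,K)$. Roots of $g$ are the points of $\mathbb{P}^1(\overline{K})$ where $g$ vanishes. *)

theory Defs
  imports
    "HOL-Analysis.Determinants"
    "HOL-Algebra.Algebraic_Closure_Type"
    "HOL-Algebra.Generated_Fields"
    "HOL-Algebra.Elementary_Groups"
    "HOL-Algebra.Sym_Groups"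
    "HOL-Algebra.Bij"
    "HOL-Computational_Algebra.Nth_Powers"
begin

text \<open>
  The polynomial ring \<open>K[X,Y]\<close> is represented as \<open>K[X][Y]\<close>, i.e. by the type \<open>'k poly poly\<close>: the
  inner variable is \<open>X\<close>, the outer one is \<open>Y\<close>. Irreducibility over \<open>K\<close> is the library notion
  \<^const>\<open>irreducible\<close> in this ring.
\<close>

definition cubic_form :: "'k::field \<Rightarrow> 'k \<Rightarrow> 'k \<Rightarrow> 'k \<Rightarrow> 'k poly poly" where
  "cubic_form a b c d =
     monom (monom a 3) 0 + monom (monom b 2) 1 + monom (monom c 1) 2 + monom (monom d 0) 3"

definition linear_form :: "'k::field \<Rightarrow> 'k \<Rightarrow> 'k poly poly" where
  "linear_form p q = monom (monom p 1) 0 + monom (monom q 0) 1"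

definition cubic_disc :: "'k::field \<Rightarrow> 'k \<Rightarrow> 'k \<Rightarrow> 'k \<Rightarrow> 'k" where
  "cubic_disc a b c d =
     b^2 * c^2 - 4 * a * c^3 - 4 * b^3 * d - 27 * a^2 * d^2 + 18 * a * b * c * d"

text \<open>
  \<open>eval2 h x y g\<close> is the value \<open>g(x,y)\<close> in a \<open>K\<close>-algebra with structure map \<open>h\<close>. It serves both for
  values in the algebraic closure and for substitution of polynomials for \<open>X\<close> and \<open>Y\<close>.
\<close>

definition eval2 ::
    "('k::comm_ring_1 \<Rightarrow> 'b::comm_ring_1) \<Rightarrow> 'b \<Rightarrow> 'b \<Rightarrow> 'k poly poly \<Rightarrow> 'b" where
  "eval2 h x y g = poly (map_poly (\<lambda>p. poly (map_poly h p) x) g) y"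

definition const2 :: "'k::field \<Rightarrow> 'k poly poly" where
  "const2 c = [:[:c:]:]"

text \<open>\<open>g\<^sup>M(X,Y) = det(M)\<^sup>-\<^sup>1 g(rX + tY, sX + uY)\<close> for the matrix \<open>M\<close> with rows \<open>(r,s)\<close> and \<open>(t,u)\<close>.\<close>

definition form_act :: "'k::field poly poly \<Rightarrow> 'k^2^2 \<Rightarrow> 'k poly poly" where
  "form_act g M =
     const2 (inverse (det M)) *
     eval2 const2 (linear_form (M $ 1 $ 1) (M $ 2 $ 1)) (linear_form (M $ 1 $ 2) (M $ 2 $ 2)) g"

definition GL2 :: "('k::field^2^2) monoid" where
  "GL2 = \<lparr>carrier = {M. invertible M}, mult = (**), one = mat 1\<rparr>"

definition SL2 :: "('k::field^2^2) set" where
  "SL2 = {M. det M = 1}"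

definition scalars2 :: "('k::field^2^2) set" where
  "scalars2 = {mat c |c. c \<noteq> 0}"

definition auts :: "'k::field poly poly \<Rightarrow> ('k^2^2) set" where
  "auts g = {M \<in> carrier GL2. form_act g M = g}"

definition aut_group :: "'k::field poly poly \<Rightarrow> ('k^2^2) monoid" where
  "aut_group g = GL2\<lparr>carrier := auts g\<rparr>"

definition aut1_group :: "'k::field poly poly \<Rightarrow> ('k^2^2) monoid" where
  "aut1_group g = GL2\<lparr>carrier := auts g \<inter> SL2\<rparr>"

text \<open>
  A point \<open>[x:y]\<close> of the projective line is the set of all its homogeneous coordinate vectors.
\<close>

definition proj_point :: "'a::field \<Rightarrow> 'a \<Rightarrow> ('a \<times> 'a) set" where
  "proj_point x y = {(c * x, c * y) |c. c \<noteq> 0}"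

definition proj_line :: "('a::field \<times> 'a) set set" where
  "proj_line = {proj_point x y |x y. (x, y) \<noteq> (0, 0)}"

definition form_roots ::
    "'k::field poly poly \<Rightarrow> ('k alg_closure \<times> 'k alg_closure) set set" where
  "form_roots g = {P \<in> proj_line. \<forall>(x, y) \<in> P. eval2 to_ac x y g = 0}"

definition rational_roots ::
    "'k::field poly poly \<Rightarrow> ('k alg_closure \<times> 'k alg_closure) set set" where
  "rational_roots g = {P \<in> form_roots g. \<exists>x y. P = proj_point (to_ac x) (to_ac y)}"

text \<open>
  The splitting field of \<open>g\<close> inside the algebraic closure is generated over \<open>K\<close> by the affine
  coordinates \<open>x/y\<close> of the roots \<open>[x:y]\<close> other than \<open>[1:0]\<close>.
\<close>

definition splitting_field :: "'k::field poly poly \<Rightarrow> 'k alg_closure set" where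
  "splitting_field g =
     generate_field ring_of_type_algebra
       (range to_ac \<union> {x / y |x y. y \<noteq> 0 \<and> proj_point x y \<in> form_roots g})"

definition splitting_ring :: "'k::field poly poly \<Rightarrow> 'k alg_closure ring" where
  "splitting_ring g = ring_of_type_algebra\<lparr>carrier := splitting_field g\<rparr>"

text \<open>
  The elements of \<open>galois_auts g\<close> are meaningful on the splitting field only; their values elsewhere
  are arbitrary and are not used.
\<close>

definition galois_auts :: "'k::field poly poly \<Rightarrow> ('k alg_closure \<Rightarrow> 'k alg_closure) set" where
  "galois_auts g =
     {\<sigma> \<in> ring_iso (splitting_ring g) (splitting_ring g). \<forall>c. \<sigma> (to_ac c) = to_ac c}"

text \<open>
  \<open>\<sigma>\<close> sends \<open>[x:y]\<close> to \<open>[\<sigma> x:\<sigma> y]\<close>, where the representative \<open>(x,y)\<close> is taken in the subfield \<open>L\<close> on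
  which \<open>\<sigma>\<close> is defined.
\<close>

definition galois_act :: "'a::field set \<Rightarrow> ('a \<Rightarrow> 'a) \<Rightarrow> ('a \<times> 'a) set \<Rightarrow> ('a \<times> 'a) set" where
  "galois_act L \<sigma> P = {(c * \<sigma> x, c * \<sigma> y) |c x y. c \<noteq> 0 \<and> (x, y) \<in> P \<and> x \<in> L \<and> y \<in> L}"

text \<open>The Galois group of \<open>g\<close> as a group of permutations of the roots of \<open>g\<close>.\<close>

definition galois_group ::
    "'k::field poly poly \<Rightarrow>
     (('k alg_closure \<times> 'k alg_closure) set \<Rightarrow> ('k alg_closure \<times> 'k alg_closure) set) set" where
  "galois_group g =
     (\<lambda>\<sigma>. restrict (galois_act (splitting_field g) \<sigma>) (form_roots g)) ` galois_auts g"

definition centraliser :: "('a, 'b) monoid_scheme \<Rightarrow> 'a set \<Rightarrow> 'a set" where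
  "centraliser G H = {x \<in> carrier G. \<forall>h \<in> H. x \<otimes>\<^bsub>G\<^esub> h = h \<otimes>\<^bsub>G\<^esub> x}"

end

theory Submission
  imports Defs
begin

text \<open>
  Write \<open>g(v) = \<kappa> [Q\<^sub>1,v] [Q\<^sub>2,v] [Q\<^sub>3,v]\<close> over the algebraic closure, where \<open>[v,w]\<close> is the determinant
  of the rows \<open>v\<close> and \<open>w\<close>, so that \<open>\<delta> = \<kappa>\<^sup>2 [Q\<^sub>1,Q\<^sub>2] [Q\<^sub>2,Q\<^sub>3] [Q\<^sub>3,Q\<^sub>1]\<close> is a square root of the
  discriminant. Suitable multiples of the \<open>Q\<^sub>i\<close>, chosen compatibly with the Galois action, add up to
  zero. Hence every permutation of the roots is induced by exactly one matrix over the splitting field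
  which preserves \<open>g\<close>; its determinant is the sign of the permutation. This matrix is rational if and
  only if it is fixed by the Galois group, that is, if the permutation commutes with the Galois group.
  The same fixed field argument shows that \<open>\<Delta>\<close> is a square iff the Galois group consists of even
  permutations, and that a root is rational iff it is fixed by the Galois group. The rest is a
  computation of centralisers in \<open>S\<^sub>3\<close>.

  That the fixed field is \<open>K\<close> is proved without general Galois theory: the splitting field is
  \<open>K(x,\<delta>)\<close> for every root \<open>x\<close>, and the conjugations \<open>\<delta> \<mapsto> - \<delta>\<close> over the fields \<open>K(x)\<close> together with the
  isomorphisms \<open>K(x) \<cong> K(x')\<close> provide enough automorphisms.
\<close>

section \<open>Binary cubic forms\<close>

text \<open>A root may be the point at infinity, so the argument works with plane vectors and
  brackets; the Galois part passes to a polynomial in one variable only when no root is rational,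
  which excludes [1:0].

  Membership in \<open>auts g\<close> is rewritten as
  \<open>gval (vact M v) = to_ac (det M) * gval v\<close> over the algebraic closure, so that it can
  be tested on root vectors. The determinant in the action makes the permutation representation
  faithful: a scalar k multiplies a cubic form by k^3 but has determinant k^2, so the identity is
  the only scalar automorphism.

  Characteristic 2 is excluded mainly to separate \<delta> from - \<delta>, and so even from odd
  orderings of the roots. Characteristic 3 is excluded because the trace of \<delta> from a cubic
  field could be 3 \<delta>. The centralisers that occur have the distinct orders 1, 2, 3 and 6, so
  the equivalences of part (2) are settled by counting.\<close>

lemma cubic_form_pCons:
  "cubic_form a b c d = [:[:0, 0, 0, a:], [:0, 0, b:], [:0, c:], [:d:]:]"
  by (simp add: cubic_form_def monom_altdef numeral_eq_Suc)

lemma linear_form_pCons: "linear_form p q = [:[:0, p:], [:q:]:]"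
  by (simp add: linear_form_def monom_altdef numeral_eq_Suc)

lemma cubic_form_eq_iff [simp]:
  "cubic_form a b c d = cubic_form a' b' c' d' \<longleftrightarrow> a = a' \<and> b = b' \<and> c = c' \<and> d = d'"
  by (auto simp: cubic_form_pCons)

lemma eval2_cubic_form:
  assumes "h 0 = 0"
  shows "eval2 h x y (cubic_form a b c d) =
    h a * x ^ 3 + h b * x ^ 2 * y + h c * x * y ^ 2 + h d * y ^ 3"
  by (simp add: eval2_def cubic_form_pCons map_poly_pCons assms)
    (simp add: algebra_simps power2_eq_square power3_eq_cube)

lemma form_act_cubic_form:
  fixes M :: "'k::field^2^2"
  defines "r \<equiv> M $ 1 $ 1" and "s \<equiv> M $ 1 $ 2" and "t \<equiv> M $ 2 $ 1" and "u \<equiv> M $ 2 $ 2"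
  shows "form_act (cubic_form a b c d) M = cubic_form
    (inverse (det M) * (a * r ^ 3 + b * r\<^sup>2 * s + c * r * s\<^sup>2 + d * s ^ 3))
    (inverse (det M) * (3 * a * r\<^sup>2 * t + b * (r\<^sup>2 * u + 2 * r * t * s) + c * (2 * r * s * u + t * s\<^sup>2) + 3 * d * s\<^sup>2 * u))
    (inverse (det M) * (3 * a * r * t\<^sup>2 + b * (2 * r * t * u + t\<^sup>2 * s) + c * (r * u\<^sup>2 + 2 * t * s * u) + 3 * d * s * u\<^sup>2))
    (inverse (det M) * (a * t ^ 3 + b * t\<^sup>2 * u + c * t * u\<^sup>2 + d * u ^ 3))"
proof -
  have c2: "const2 (0::'k) = 0" by (simp add: const2_def)
  show ?thesis
    unfolding form_act_def eval2_cubic_form[of const2, OF c2] r_def[symmetric] s_def[symmetric] t_def[symmetric] u_def[symmetric]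
    unfolding const2_def linear_form_pCons cubic_form_pCons
    by (simp add: algebra_simps power2_eq_square power3_eq_cube)
qed

lemma linear_form_mult3:
  "linear_form p1 q1 * linear_form p2 q2 * linear_form p3 q3 = cubic_form
     (p1 * p2 * p3) (p1 * p2 * q3 + p1 * q2 * p3 + q1 * p2 * p3)
     (p1 * q2 * q3 + q1 * p2 * q3 + q1 * q2 * p3) (q1 * q2 * q3)"
  by (simp add: linear_form_pCons cubic_form_pCons algebra_simps)

lemma linear_form_not_unit: "\<not> linear_form p q dvd 1"
proof
  assume "linear_form p q dvd 1"
  then obtain h where "1 = linear_form p q * h" by (rule dvdE)
  then have "poly (poly 1 0) 0 = poly (poly (linear_form p q * h) 0) 0" by simp
  then show False by (simp add: linear_form_pCons)
qed

text \<open>Factors from \<open>K[X]\<close> have to be excluded too. Without a nontrivial zero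
  \<open>d\<close> is nonzero, so the leading coefficient in \<open>Y\<close> is a unit, and so are
  those of all factors. A factor of degree 0 in \<open>Y\<close> is then a unit, and one of degree 1
  produces a zero at \<open>X = 1\<close>.\<close>

lemma irreducible_cubic_form_iff:
  fixes a b c d :: "'k::field"
  assumes nz: "cubic_form a b c d \<noteq> 0"
  shows "irreducible (cubic_form a b c d) \<longleftrightarrow>
    (\<forall>x y. a * x ^ 3 + b * x ^ 2 * y + c * x * y ^ 2 + d * y ^ 3 = 0 \<longrightarrow> x = 0 \<and> y = 0)"
    (is "?irr \<longleftrightarrow> ?noroot")
proof
  assume irr: ?irr
  show ?noroot
  proof (intro allI impI, rule ccontr)
    fix x y
    assume root: "a * x ^ 3 + b * x ^ 2 * y + c * x * y ^ 2 + d * y ^ 3 = 0"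
      and "\<not> (x = 0 \<and> y = 0)"
    have "\<exists>p q h. cubic_form a b c d = linear_form p q * h \<and> \<not> h dvd 1"
    proof (cases "y = 0")
      case True
      then have a0: "a = 0" and "x \<noteq> 0" using root \<open>\<not> (x = 0 \<and> y = 0)\<close> by auto
      have "cubic_form a b c d = linear_form 0 1 * [:[:0,0,b:], [:0,c:], [:d:]:]"
        by (simp add: a0 cubic_form_pCons linear_form_pCons)
      moreover have "\<not> [:[:0,0,b:], [:0,c:], [:d:]:] dvd 1"
      proof
        assume "[:[:0,0,b:], [:0,c:], [:d:]:] dvd 1"
        then obtain h where "1 = [:[:0,0,b:], [:0,c:], [:d:]:] * h" by (rule dvdE)
        \<comment> \<open>A form of positive degree vanishes at the origin, hence is not a
          unit.\<close>
        then have "poly (poly 1 0) 0 = poly (poly ([:[:0,0,b:], [:0,c:], [:d:]:] * h) 0) 0" by simp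
        then show False by simp
      qed
      ultimately show ?thesis by blast
    next
      case False
      define z where "z = x / y"
      have "a * z ^ 3 + b * z ^ 2 + c * z + d =
          (a * x ^ 3 + b * x ^ 2 * y + c * x * y ^ 2 + d * y ^ 3) / y ^ 3"
        using False by (simp add: z_def field_simps power2_eq_square power3_eq_cube)
      then have z: "d = - (a * z ^ 3 + b * z ^ 2 + c * z)"
        using root by (simp add: eq_neg_iff_add_eq_0 algebra_simps)
      \<comment> \<open>Coefficients of the quotient by \<open>X - z Y\<close>, from Horner's
        scheme.\<close>
      define e f where "e = b + a * z" and "f = c + e * z"
      have "cubic_form a b c d = linear_form 1 (-z) * [:[:0,0,a:], [:0,e:], [:f:]:]"
        by (simp add: z e_def f_def cubic_form_pCons linear_form_pCons algebra_simps power2_eq_square power3_eq_cube)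
      moreover have "\<not> [:[:0,0,a:], [:0,e:], [:f:]:] dvd 1"
      proof
        assume "[:[:0,0,a:], [:0,e:], [:f:]:] dvd 1"
        then obtain h where "1 = [:[:0,0,a:], [:0,e:], [:f:]:] * h" by (rule dvdE)
        then have "poly (poly 1 0) 0 = poly (poly ([:[:0,0,a:], [:0,e:], [:f:]:] * h) 0) 0" by simp
        then show False by simp
      qed
      ultimately show ?thesis by blast
    qed
    then show False using irr irreducibleD linear_form_not_unit by metis
  qed
next
  assume nr: ?noroot
  have d0: "d \<noteq> 0" using nr[rule_format, of 0 1] by auto
  define g where "g = cubic_form a b c d"
  have degg: "Polynomial.degree g = 3" using d0 by (simp add: g_def cubic_form_pCons)
  have key: "u dvd 1" if uv: "g = u * v" and du: "Polynomial.degree u \<le> 1" for u v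
  proof -
    have nz: "u \<noteq> 0" "v \<noteq> 0" using degg uv by auto
    have "lead_coeff u * lead_coeff v = lead_coeff g" by (simp add: uv lead_coeff_mult)
    also have "\<dots> = [:d:]" using d0 by (simp add: degg) (simp add: g_def cubic_form_pCons numeral_eq_Suc)
    finally have lc: "lead_coeff u * lead_coeff v = [:d:]" .
    have "lead_coeff u dvd 1"
    proof -
      have "lead_coeff u * (lead_coeff v * [:inverse d:]) = 1"
        using d0 by (simp add: mult.assoc[symmetric] lc one_pCons)
      then show ?thesis by (metis dvd_triv_left)
    qed
    show ?thesis
    proof (cases "Polynomial.degree u = 0")
      case True
      then obtain w where "u = [:w:]" by (metis degree_eq_zeroE)
      then show ?thesis using \<open>lead_coeff u dvd 1\<close> by (simp add: is_unit_poly_iff)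
    next
      case False
      then have d1: "Polynomial.degree u = 1" using du by simp
      obtain l e where ul: "u = [:l, e:]" using d1 by (metis degree_eq_zeroE degree_pCons_eq_if nat.simps(3) One_nat_def pCons_cases nat.inject)
      have "e dvd 1" using \<open>lead_coeff u dvd 1\<close> d1 by (simp add: ul)
      then obtain e' where e: "e = [:e':]" "e' \<noteq> 0"
        by (auto simp: is_unit_poly_iff dvd_field_iff)
      \<comment> \<open>The zero of the factor \<open>l + e Y\<close> after setting
        \<open>X = 1\<close>; it makes [1:m] a zero of \<open>g\<close>.\<close>
      define m where "m = - poly l 1 / e'"
      have "poly (poly u [:m:]) 1 = 0" using e by (simp add: ul m_def)
      then have "poly (poly g [:m:]) 1 = 0" by (simp add: uv)
      then have "a * 1 ^ 3 + b * 1 ^ 2 * m + c * 1 * m ^ 2 + d * m ^ 3 = 0"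
        by (simp add: g_def cubic_form_pCons algebra_simps power2_eq_square power3_eq_cube)
      then have "(1::'k) = 0" using nr by blast
      then show ?thesis by simp
    qed
  qed
  show ?irr unfolding g_def[symmetric]
  proof (rule irreducibleI)
    show "g \<noteq> 0" using degg by auto
    show "\<not> g dvd 1" using degg by (auto dest!: divides_degree)
    fix u v assume uv: "g = u * v"
    then have "u \<noteq> 0" "v \<noteq> 0" using degg by auto
    then have "Polynomial.degree u + Polynomial.degree v = 3" using degg uv by (simp add: degree_mult_eq)
    then consider "Polynomial.degree u \<le> 1" | "Polynomial.degree v \<le> 1" by linarith
    then show "u dvd 1 \<or> v dvd 1" using key[of u v] key[of v u] uv by (cases) (auto simp: mult.commute)
  qed
qed

section \<open>The projective line and the splitting field\<close>

definition dt :: "'a::comm_ring \<times> 'a \<Rightarrow> 'a \<times> 'a \<Rightarrow> 'a" where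
  "dt v w = fst v * snd w - snd v * fst w"

abbreviation pp :: "'a::field \<times> 'a \<Rightarrow> ('a \<times> 'a) set" where
  "pp v \<equiv> proj_point (fst v) (snd v)"

definition normal_vec :: "'a::field \<times> 'a \<Rightarrow> bool" where
  "normal_vec v \<longleftrightarrow> snd v = 1 \<or> v = (1, 0)"

lemma dt_swap: "dt v w = - dt w v"
  by (simp add: dt_def algebra_simps)

lemma normal_vec_nonzero: "normal_vec v \<Longrightarrow> v \<noteq> (0, 0)"
  by (auto simp: normal_vec_def)

lemma mem_proj_point: "(x, y) \<in> proj_point x y"
  unfolding proj_point_def by (auto intro!: exI[of _ 1])

lemma proj_point_scale:
  assumes k: "k \<noteq> 0"
  shows "proj_point (k * x) (k * y) = proj_point x y"
proof (intro Set.set_eqI iffI)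
  fix v
  show "v \<in> proj_point x y" if "v \<in> proj_point (k * x) (k * y)"
  proof -
    from that obtain e where "e \<noteq> 0" "v = (e * (k * x), e * (k * y))" by (auto simp: proj_point_def)
    then have "v = ((e * k) * x, (e * k) * y)" "e * k \<noteq> 0" using k by (auto simp: mult.assoc)
    then show ?thesis unfolding proj_point_def by blast
  qed
  show "v \<in> proj_point (k * x) (k * y)" if "v \<in> proj_point x y"
  proof -
    from that obtain e where "e \<noteq> 0" "v = (e * x, e * y)" by (auto simp: proj_point_def)
    then have "v = ((e / k) * (k * x), (e / k) * (k * y))" "e / k \<noteq> 0" using k by auto
    then show ?thesis unfolding proj_point_def by blast
  qed
qed

lemma dt_eq_0_imp_scale:
  fixes v w :: "'a::field \<times> 'a"
  assumes "v \<noteq> (0, 0)" "w \<noteq> (0, 0)" "dt v w = 0"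
  shows "\<exists>k. k \<noteq> 0 \<and> w = (k * fst v, k * snd v)"
proof (cases "fst v = 0")
  case True
  then have "snd v \<noteq> 0" using assms(1) by (cases v) auto
  then have "fst w = 0" using assms(3) True by (simp add: dt_def)
  then have "snd w \<noteq> 0" using assms(2) by (cases w) auto
  show ?thesis
    using True \<open>snd v \<noteq> 0\<close> \<open>fst w = 0\<close> \<open>snd w \<noteq> 0\<close>
    by (intro exI[of _ "snd w / snd v"]) (simp add: prod_eq_iff)
next
  case False
  have "snd w = snd v * fst w / fst v" using assms(3) False by (simp add: dt_def field_simps)
  moreover have "fst w \<noteq> 0" using calculation assms(2) by (cases w) auto
  ultimately show ?thesis
    using False by (intro exI[of _ "fst w / fst v"]) (simp add: prod_eq_iff)
qed

lemma mem_pp_iff: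
  assumes "v \<noteq> (0, 0)"
  shows "w \<in> pp v \<longleftrightarrow> w \<noteq> (0, 0) \<and> dt v w = 0"
proof
  assume "w \<in> pp v"
  then obtain e where "e \<noteq> 0" "w = (e * fst v, e * snd v)" by (auto simp: proj_point_def)
  then show "w \<noteq> (0, 0) \<and> dt v w = 0" using assms by (cases v) (auto simp: dt_def)
next
  assume "w \<noteq> (0, 0) \<and> dt v w = 0"
  then show "w \<in> pp v" using dt_eq_0_imp_scale[OF assms] unfolding proj_point_def by blast
qed

lemma pp_eq_iff:
  assumes "v \<noteq> (0, 0)" "w \<noteq> (0, 0)"
  shows "pp v = pp w \<longleftrightarrow> dt v w = 0"
proof
  assume "pp v = pp w"
  then have "w \<in> pp v" using mem_proj_point[of "fst w" "snd w"] by simp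
  then show "dt v w = 0" using mem_pp_iff assms by blast
next
  assume "dt v w = 0"
  then obtain k where "k \<noteq> 0" "w = (k * fst v, k * snd v)" using dt_eq_0_imp_scale assms by blast
  then show "pp v = pp w" by (simp add: proj_point_scale)
qed

lemma normal_vec_eqI: "normal_vec v \<Longrightarrow> normal_vec w \<Longrightarrow> dt v w = 0 \<Longrightarrow> v = w"
  by (auto simp: normal_vec_def dt_def prod_eq_iff)

lemma dt_self [simp]: "dt v v = 0"
  by (simp add: dt_def mult.commute)

lemma normal_dt_eq_0_iff: "normal_vec v \<Longrightarrow> normal_vec w \<Longrightarrow> dt v w = 0 \<longleftrightarrow> v = w"
  by (metis normal_vec_eqI dt_self)

lemma pp_normal_eq_iff: "normal_vec v \<Longrightarrow> normal_vec w \<Longrightarrow> pp v = pp w \<longleftrightarrow> v = w"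
  by (simp add: pp_eq_iff normal_vec_nonzero normal_dt_eq_0_iff)

lemma proj_line_normal:
  assumes "P \<in> proj_line"
  obtains v where "normal_vec v" "P = pp v"
proof -
  obtain x y where P: "P = proj_point x y" "(x, y) \<noteq> (0, 0)" using assms by (auto simp: proj_line_def)
  show ?thesis
  proof (cases "y = 0")
    case True
    then have "x \<noteq> 0" using P by auto
    then have "P = pp (1, 0)" using P True proj_point_scale[of x 1 0] by simp
    then show ?thesis using that by (force simp: normal_vec_def)
  next
    case False
    then have "P = pp (x / y, 1)" using P proj_point_scale[of y "x / y" 1] by simp
    then show ?thesis using that by (force simp: normal_vec_def)
  qed
qed

lemma pp_in_proj_line: "v \<noteq> (0, 0) \<Longrightarrow> pp v \<in> proj_line"
  by (cases v) (auto simp: proj_line_def)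

section \<open>Subfields of a field type and automorphisms of the splitting field\<close>

lemma subfield_type_iff:
  fixes F :: "'a::field set"
  shows "subfield F ring_of_type_algebra \<longleftrightarrow>
    1 \<in> F \<and> (\<forall>x\<in>F. - x \<in> F) \<and> (\<forall>x\<in>F. inverse x \<in> F) \<and>
    (\<forall>x\<in>F. \<forall>y\<in>F. x + y \<in> F) \<and> (\<forall>x\<in>F. \<forall>y\<in>F. x * y \<in> F)" (is "_ \<longleftrightarrow> ?R")
proof -
  let ?T = "ring_of_type_algebra :: 'a ring"
  interpret T: field ?T by (rule field_from_type_algebra)
  have ops: "\<one>\<^bsub>?T\<^esub> = 1" "\<zero>\<^bsub>?T\<^esub> = 0" "\<And>x y. x \<oplus>\<^bsub>?T\<^esub> y = x + y"
    "\<And>x y. x \<otimes>\<^bsub>?T\<^esub> y = x * y" "carrier ?T = UNIV"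
    by (simp_all add: ring_of_type_algebra_def)
  have neg: "\<ominus>\<^bsub>?T\<^esub> x = - x" for x
    by (rule T.minus_equality) (simp_all add: ops)
  have inv: "inv\<^bsub>?T\<^esub> x = inverse x" if "x \<noteq> 0" for x
    using that by (intro T.comm_inv_char) (simp_all add: ops)
  show ?thesis
  proof
    assume F: "subfield F ?T"
    note R = subfieldE(1)[OF F]
    \<comment> \<open>Since \<open>inverse 0 = 0\<close>, closure under inverses holds for all
      elements and the closure rules derived from it carry no side condition.\<close>
    have "inverse x \<in> F" if "x \<in> F" for x
    proof (cases "x = 0")
      case False
      then show ?thesis using T.subfield_m_inv(1)[OF F, of x] that inv by (simp add: ops)
    qed (use that in simp)
    then show ?R using subringE(3,5,6,7)[OF R] by (simp add: ops neg)
  next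
    assume R: ?R
    then have "subring F ?T" by (intro T.subringI) (auto simp: ops neg)
    then show "subfield F ?T" using R by (intro T.subfieldI') (auto simp: ops inv)
  qed
qed

lemma
  fixes F :: "'a::field set"
  assumes "subfield F ring_of_type_algebra"
  shows subfield_1: "1 \<in> F"
    and subfield_uminus: "\<And>x. x \<in> F \<Longrightarrow> - x \<in> F"
    and subfield_inverse: "\<And>x. x \<in> F \<Longrightarrow> inverse x \<in> F"
    and subfield_add: "\<And>x y. x \<in> F \<Longrightarrow> y \<in> F \<Longrightarrow> x + y \<in> F"
    and subfield_mult: "\<And>x y. x \<in> F \<Longrightarrow> y \<in> F \<Longrightarrow> x * y \<in> F"
  using assms by (simp_all add: subfield_type_iff)

lemma subfield_diff:
  fixes F :: "'a::field set"
  assumes "subfield F ring_of_type_algebra" "x \<in> F" "y \<in> F"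
  shows "x - y \<in> F"
  using subfield_add[OF assms(1) assms(2) subfield_uminus[OF assms(1,3)]] by simp

lemma subfield_0:
  fixes F :: "'a::field set"
  assumes "subfield F ring_of_type_algebra"
  shows "0 \<in> F"
  using subfield_diff[OF assms subfield_1[OF assms] subfield_1[OF assms]] by simp

lemma subfield_divide:
  fixes F :: "'a::field set"
  assumes "subfield F ring_of_type_algebra" "x \<in> F" "y \<in> F"
  shows "x / y \<in> F"
  using subfield_mult[OF assms(1) assms(2) subfield_inverse[OF assms(1,3)]] by (simp add: divide_inverse)

lemma subfield_power:
  fixes F :: "'a::field set"
  assumes "subfield F ring_of_type_algebra" "x \<in> F"
  shows "x ^ n \<in> F"
  by (induction n) (simp_all add: assms subfield_1[OF assms(1)] subfield_mult[OF assms(1)])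

lemma subfield_dt:
  fixes F :: "'a::field set"
  assumes "subfield F ring_of_type_algebra" "v \<in> F \<times> F" "w \<in> F \<times> F"
  shows "dt v w \<in> F"
  using assms(2,3) unfolding dt_def
  by (intro subfield_diff[OF assms(1)] subfield_mult[OF assms(1)]) auto

lemma subfield_range_to_ac: "subfield (range to_ac) ring_of_type_algebra"
  unfolding subfield_type_iff
  by (auto simp flip: to_ac_1 to_ac_add to_ac_mult to_ac_minus to_ac_inverse)

lemmas subfield_closed = subfield_0 subfield_1 subfield_uminus subfield_inverse subfield_add
  subfield_mult subfield_diff subfield_divide subfield_power subfield_dt

lemma splitting_field_subfield: "subfield (splitting_field g) ring_of_type_algebra"
  unfolding splitting_field_def
  by (rule field.generate_field_is_subfield[OF field_from_type_algebra])
    (simp add: ring_of_type_algebra_def)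

lemma to_ac_in_splitting_field: "to_ac x \<in> splitting_field g"
  unfolding splitting_field_def by (rule generate_field.incl) simp

lemma splitting_field_least:
  assumes "subfield F ring_of_type_algebra" "range to_ac \<subseteq> F"
    and "\<And>x y. y \<noteq> 0 \<Longrightarrow> proj_point x y \<in> form_roots g \<Longrightarrow> x / y \<in> F"
  shows "splitting_field g \<subseteq> F"
  unfolding splitting_field_def
  by (rule field.generate_field_min_subfield1[OF field_from_type_algebra _ assms(1)])
    (use assms in \<open>auto simp: ring_of_type_algebra_def\<close>)

lemma galois_auts_iff:
  "\<sigma> \<in> galois_auts g \<longleftrightarrow> bij_betw \<sigma> (splitting_field g) (splitting_field g) \<and>
    (\<forall>x\<in>splitting_field g. \<forall>y\<in>splitting_field g. \<sigma> (x + y) = \<sigma> x + \<sigma> y \<and> \<sigma> (x * y) = \<sigma> x * \<sigma> y) \<and>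
    (\<forall>c. \<sigma> (to_ac c) = to_ac c)"
proof -
  \<comment> \<open>\<open>ring_hom\<close> asks for this separately, but it is contained in fixing
    the constants.\<close>
  have "\<sigma> 1 = 1" if "\<forall>c. \<sigma> (to_ac c) = to_ac c" using that to_ac_1 by metis
  then show ?thesis
    unfolding galois_auts_def ring_iso_def ring_hom_def splitting_ring_def
    by (auto simp: ring_of_type_algebra_def bij_betw_def)
qed

locale galois_aut =
  fixes g :: "'k::field poly poly" and \<sigma>
  assumes aut: "\<sigma> \<in> galois_auts g"
begin

lemma bij: "bij_betw \<sigma> (splitting_field g) (splitting_field g)"
  and add: "\<And>x y. x \<in> splitting_field g \<Longrightarrow> y \<in> splitting_field g \<Longrightarrow> \<sigma> (x + y) = \<sigma> x + \<sigma> y"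
  and mult: "\<And>x y. x \<in> splitting_field g \<Longrightarrow> y \<in> splitting_field g \<Longrightarrow> \<sigma> (x * y) = \<sigma> x * \<sigma> y"
  and const [simp]: "\<sigma> (to_ac c) = to_ac c"
  using aut by (simp_all add: galois_auts_iff)

lemma zero [simp]: "\<sigma> 0 = 0" and one [simp]: "\<sigma> 1 = 1"
  using const[of 0] const[of 1] by simp_all

lemma closed: "x \<in> splitting_field g \<Longrightarrow> \<sigma> x \<in> splitting_field g"
  using bij by (auto simp: bij_betw_def)

lemmas SF = subfield_closed[OF splitting_field_subfield]

lemma uminus: assumes "x \<in> splitting_field g" shows "\<sigma> (- x) = - \<sigma> x"
proof -
  have "\<sigma> (x + - x) = \<sigma> x + \<sigma> (- x)" using assms SF by (intro add) auto
  then show ?thesis by (simp add: add_eq_0_iff)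
qed

lemma diff: "x \<in> splitting_field g \<Longrightarrow> y \<in> splitting_field g \<Longrightarrow> \<sigma> (x - y) = \<sigma> x - \<sigma> y"
  using add[of x "- y"] by (simp add: uminus SF)

lemma inverse: assumes "x \<in> splitting_field g" shows "\<sigma> (inverse x) = inverse (\<sigma> x)"
proof (cases "x = 0")
  case False
  then have "\<sigma> x * \<sigma> (inverse x) = 1" using assms SF by (subst mult[symmetric]) auto
  then show ?thesis by (metis inverse_unique)
qed simp

lemma power: "x \<in> splitting_field g \<Longrightarrow> \<sigma> (x ^ n) = \<sigma> x ^ n"
  by (induction n) (simp_all add: mult SF)

lemma eq_iff: "x \<in> splitting_field g \<Longrightarrow> y \<in> splitting_field g \<Longrightarrow> \<sigma> x = \<sigma> y \<longleftrightarrow> x = y"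
  using bij by (auto simp: bij_betw_def inj_on_def)

lemma dt: "v \<in> splitting_field g \<times> splitting_field g \<Longrightarrow> w \<in> splitting_field g \<times> splitting_field g \<Longrightarrow>
    \<sigma> (dt v w) = dt (map_prod \<sigma> \<sigma> v) (map_prod \<sigma> \<sigma> w)"
  by (cases v; cases w) (auto simp: dt_def diff mult SF)

text \<open>Two representatives of a point with coordinates in the splitting field differ by a
  factor \<open>f\<close> that lies in the splitting field as well, being a quotient of coordinates.
  So \<sigma> can be applied to \<open>f\<close>, and the choice of representative disappears in the
  scalar.\<close>

lemma galois_act_pp:
  assumes "v \<in> splitting_field g \<times> splitting_field g" "v \<noteq> (0, 0)"
  shows "galois_act (splitting_field g) \<sigma> (pp v) = pp (map_prod \<sigma> \<sigma> v)"
proof (intro Set.set_eqI iffI)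
  obtain x y where v: "v = (x, y)" "x \<in> splitting_field g" "y \<in> splitting_field g" using assms by auto
  fix w
  show "w \<in> galois_act (splitting_field g) \<sigma> (pp v)" if w: "w \<in> pp (map_prod \<sigma> \<sigma> v)"
  proof -
    obtain e where "e \<noteq> 0" "w = (e * \<sigma> x, e * \<sigma> y)" using w v by (auto simp: proj_point_def)
    then show ?thesis using v mem_proj_point[of x y] unfolding galois_act_def by auto
  qed
  assume "w \<in> galois_act (splitting_field g) \<sigma> (pp v)"
  then obtain e x' y' where w: "e \<noteq> 0" "w = (e * \<sigma> x', e * \<sigma> y')" "(x', y') \<in> pp v"
    "x' \<in> splitting_field g" "y' \<in> splitting_field g" by (auto simp: galois_act_def)
  then obtain f where f: "f \<noteq> 0" "x' = f * x" "y' = f * y" using v by (auto simp: proj_point_def)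
  have "f \<in> splitting_field g"
  proof (cases "x = 0")
    case True
    then have "f = y' / y" using f assms v by auto
    then show ?thesis using SF w v by simp
  next
    case False
    then have "f = x' / x" using f by auto
    then show ?thesis using SF w v by simp
  qed
  then have "w = ((e * \<sigma> f) * \<sigma> x, (e * \<sigma> f) * \<sigma> y)" "e * \<sigma> f \<noteq> 0"
    using w f v eq_iff[of f 0] SF by (auto simp: mult)
  then show "w \<in> pp (map_prod \<sigma> \<sigma> v)" using v by (auto simp: proj_point_def)
qed

end

section \<open>The roots of the form\<close>

lemma alg_closed_quadratic_factors:
  fixes a b c :: "'a::alg_closed_field"
  assumes "a \<noteq> 0"
  obtains x1 x2 where "b = - a * (x1 + x2)" "c = a * (x1 * x2)"
proof -
  have "Polynomial.degree [:c, b, a:] > 0" using assms by simp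
  then obtain x where "poly [:c, b, a:] x = 0" using alg_closed_imp_poly_has_root by blast
  then have x: "c + x * b + x * x * a = 0" by (simp add: algebra_simps)
  show ?thesis
  proof (rule that[of x "- b / a - x"])
    show "b = - a * (x + (- b / a - x))" using assms by simp
    have "c = - x * b - x * x * a" using x by (simp add: algebra_simps eq_neg_iff_add_eq_0)
    also have "\<dots> = a * (x * (- b / a - x))" using assms by (simp add: field_simps)
    finally show "c = a * (x * (- b / a - x))" .
  qed
qed

lemma alg_closed_cubic_factors:
  fixes a b c d :: "'a::alg_closed_field"
  assumes "a \<noteq> 0"
  obtains x1 x2 x3 where "b = - a * (x1 + x2 + x3)" "c = a * (x1 * x2 + x2 * x3 + x3 * x1)"
    "d = - a * (x1 * x2 * x3)"
proof -
  have "Polynomial.degree [:d, c, b, a:] > 0" using assms by simp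
  then obtain x where "poly [:d, c, b, a:] x = 0" using alg_closed_imp_poly_has_root by blast
  then have x: "d = - (x * c + x * x * b + x * x * x * a)"
    by (simp add: algebra_simps eq_neg_iff_add_eq_0)
  obtain x1 x2 where q: "b + a * x = - a * (x1 + x2)" "c + (b + a * x) * x = a * (x1 * x2)"
    using alg_closed_quadratic_factors[OF assms] by metis
  have b: "b = - a * (x1 + x2 + x)" using q(1) by (simp add: algebra_simps eq_neg_iff_add_eq_0)
  have c: "c = a * (x1 * x2 + x2 * x + x * x1)" using q by (simp add: algebra_simps eq_diff_eq[symmetric] b)
  show ?thesis by (rule that[OF b c]) (simp add: x b c algebra_simps)
qed

text \<open>The arguments are the coefficients of
  \<open>k * (x1 Y - y1 X) * (x2 Y - y2 X) * (x3 Y - y3 X)\<close>. Being homogeneous in each root,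
  the identity also covers a root at infinity.\<close>

lemma cubic_disc_factor:
  "cubic_disc (- k * (y1 * y2 * y3)) (k * (x1 * y2 * y3 + y1 * x2 * y3 + y1 * y2 * x3))
     (- k * (x1 * x2 * y3 + x1 * y2 * x3 + y1 * x2 * x3)) (k * (x1 * x2 * x3)) =
   (k\<^sup>2 * (x1 * y2 - y1 * x2) * (x2 * y3 - y2 * x3) * (x3 * y1 - y3 * x1))\<^sup>2"
  unfolding cubic_disc_def by Groebner_Basis.algebra

lemma to_ac_cubic_disc:
  "to_ac (cubic_disc a b c d) = cubic_disc (to_ac a) (to_ac b) (to_ac c) (to_ac d)"
  by (simp add: cubic_disc_def)

locale cubic =
  fixes a b c d :: "'k::field"
  assumes two: "(2::'k) \<noteq> 0" and three: "(3::'k) \<noteq> 0" and disc: "cubic_disc a b c d \<noteq> 0"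
begin

abbreviation g :: "'k poly poly" where "g \<equiv> cubic_form a b c d"

definition gval :: "'k alg_closure \<times> 'k alg_closure \<Rightarrow> 'k alg_closure" where
  "gval v = to_ac a * fst v ^ 3 + to_ac b * fst v ^ 2 * snd v + to_ac c * fst v * snd v ^ 2
    + to_ac d * snd v ^ 3"

lemma eval2_g: "eval2 to_ac x y g = gval (x, y)"
  by (simp add: eval2_cubic_form gval_def)

lemma gval_scale: "gval (k * x, k * y) = k ^ 3 * gval (x, y)"
  by (simp add: gval_def algebra_simps power2_eq_square power3_eq_cube)

lemma two_ac: "(2::'k alg_closure) \<noteq> 0"
  using two to_ac_numeral[of "num.Bit0 num.One", where 'a = 'k] to_ac_eq_0_iff by metis

lemma three_ac: "(3::'k alg_closure) \<noteq> 0"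
  using three to_ac_numeral[of "num.Bit1 num.One", where 'a = 'k] to_ac_eq_0_iff by metis

lemma form_roots_iff:
  assumes "v \<noteq> (0, 0)"
  shows "pp v \<in> form_roots g \<longleftrightarrow> gval v = 0"
proof
  assume "pp v \<in> form_roots g"
  then show "gval v = 0" using mem_proj_point[of "fst v" "snd v"]
    by (auto simp: form_roots_def eval2_g)
next
  assume "gval v = 0"
  then show "pp v \<in> form_roots g" using pp_in_proj_line[OF assms] gval_scale[of _ "fst v" "snd v"]
    by (auto simp: form_roots_def eval2_g proj_point_def)
qed

end

text \<open>
  A root is represented by its normal vector \<open>(x, 1)\<close> or \<open>(1, 0)\<close>; this choice commutes with field
  automorphisms.
\<close>

locale cubic_roots = cubic a b c d for a b c d :: "'k::field" +
  fixes \<kappa> :: 'k and Q1 Q2 Q3 :: "'k alg_closure \<times> 'k alg_closure"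
  assumes normal: "normal_vec Q1" "normal_vec Q2" "normal_vec Q3"
    and coeffs: "to_ac a = - to_ac \<kappa> * (snd Q1 * snd Q2 * snd Q3)"
      "to_ac b = to_ac \<kappa> * (fst Q1 * snd Q2 * snd Q3 + snd Q1 * fst Q2 * snd Q3 + snd Q1 * snd Q2 * fst Q3)"
      "to_ac c = - to_ac \<kappa> * (fst Q1 * fst Q2 * snd Q3 + fst Q1 * snd Q2 * fst Q3 + snd Q1 * fst Q2 * fst Q3)"
      "to_ac d = to_ac \<kappa> * (fst Q1 * fst Q2 * fst Q3)"

text \<open>An affine root \<open>(x, 1)\<close> contributes the factor \<open>x Y - X\<close>, so
  three of them give \<kappa> = - a. If \<open>a = 0\<close>, one root is [1:0] with factor
  \<open>Y\<close>, the discriminant becomes \<open>b^2 * (c^2 - 4 * b * d)\<close>, which forces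
  \<open>b\<close> to be nonzero, and \<kappa> = b.\<close>

lemma (in cubic) cubic_roots_exist: "\<exists>\<kappa> Q1 Q2 Q3. cubic_roots a b c d \<kappa> Q1 Q2 Q3"
proof (cases "a = 0")
  case True
  then have "b \<noteq> 0" using disc by (auto simp: cubic_disc_def)
  then have "to_ac b \<noteq> 0" by simp
  then obtain x1 x2 where f: "to_ac c = - to_ac b * (x1 + x2)" "to_ac d = to_ac b * (x1 * x2)"
    using alg_closed_quadratic_factors by metis
  have "cubic_roots a b c d b (1, 0) (x1, 1) (x2, 1)"
    by unfold_locales (simp_all add: normal_vec_def True f algebra_simps)
  then show ?thesis by blast
next
  case False
  then have "to_ac a \<noteq> 0" by simp
  then obtain x1 x2 x3 where f: "to_ac b = - to_ac a * (x1 + x2 + x3)"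
    "to_ac c = to_ac a * (x1 * x2 + x2 * x3 + x3 * x1)" "to_ac d = - to_ac a * (x1 * x2 * x3)"
    by (rule alg_closed_cubic_factors[of "to_ac a" "to_ac b" "to_ac c" "to_ac d"])
  have "cubic_roots a b c d (- a) (x1, 1) (x2, 1) (x3, 1)"
    by unfold_locales (simp_all add: normal_vec_def f algebra_simps)
  then show ?thesis by blast
qed

context cubic_roots
begin

text \<open>The locale assumptions are symmetric in the roots. Interpreting the locale at a permuted
  triple carries facts proved about \<open>Q1\<close> over to the other roots.\<close>

lemma rotate: "cubic_roots a b c d \<kappa> Q2 Q3 Q1"
  by unfold_locales (simp_all add: normal coeffs algebra_simps)

lemma swap: "cubic_roots a b c d \<kappa> Q1 Q3 Q2"
  by unfold_locales (simp_all add: normal coeffs algebra_simps)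

lemma gval_factor: "gval v = to_ac \<kappa> * dt Q1 v * dt Q2 v * dt Q3 v"
  by (simp add: gval_def coeffs dt_def algebra_simps power2_eq_square power3_eq_cube)

definition \<delta> :: "'k alg_closure" where
  "\<delta> = (to_ac \<kappa>)\<^sup>2 * dt Q1 Q2 * dt Q2 Q3 * dt Q3 Q1"

lemma delta_square: "\<delta>\<^sup>2 = to_ac (cubic_disc a b c d)"
  unfolding to_ac_cubic_disc coeffs cubic_disc_factor \<delta>_def dt_def ..

lemma kappa_nz: "\<kappa> \<noteq> 0" and dt_nz: "dt Q1 Q2 \<noteq> 0" "dt Q2 Q3 \<noteq> 0" "dt Q3 Q1 \<noteq> 0"
proof -
  have "\<delta>\<^sup>2 \<noteq> 0" using disc by (simp add: delta_square)
  then show "\<kappa> \<noteq> 0" "dt Q1 Q2 \<noteq> 0" "dt Q2 Q3 \<noteq> 0" "dt Q3 Q1 \<noteq> 0" by (auto simp: \<delta>_def)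
qed

lemma distinct: "Q1 \<noteq> Q2" "Q2 \<noteq> Q3" "Q3 \<noteq> Q1"
  using dt_nz by auto

lemma gval_normal_iff: "normal_vec v \<Longrightarrow> gval v = 0 \<longleftrightarrow> v \<in> {Q1, Q2, Q3}"
  using kappa_nz normal_dt_eq_0_iff[OF normal(1), of v] normal_dt_eq_0_iff[OF normal(2), of v]
    normal_dt_eq_0_iff[OF normal(3), of v] by (auto simp: gval_factor)

lemma form_roots_eq: "form_roots g = {pp Q1, pp Q2, pp Q3}"
proof -
  have "P \<in> {pp Q1, pp Q2, pp Q3}" if "P \<in> form_roots g" for P
  proof -
    have "P \<in> proj_line" using that by (simp add: form_roots_def)
    then obtain v where v: "normal_vec v" "P = pp v" by (rule proj_line_normal)
    then have "gval v = 0" using that form_roots_iff[OF normal_vec_nonzero] by blast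
    then show ?thesis using gval_normal_iff v by auto
  qed
  moreover have "pp Q \<in> form_roots g" if "Q \<in> {Q1, Q2, Q3}" for Q
    using that normal gval_normal_iff[of Q] form_roots_iff[OF normal_vec_nonzero, of Q] by auto
  ultimately show ?thesis by blast
qed

lemma pp_distinct: "pp Q1 \<noteq> pp Q2" "pp Q2 \<noteq> pp Q3" "pp Q3 \<noteq> pp Q1"
  using distinct normal by (simp_all add: pp_normal_eq_iff)

lemma card_form_roots: "card (form_roots g) = 3"
  unfolding form_roots_eq using pp_distinct by (simp add: card_insert_if)

lemma rational_roots_iff:
  assumes "Q \<in> {Q1, Q2, Q3}"
  shows "pp Q \<in> rational_roots g \<longleftrightarrow> Q \<in> range to_ac \<times> range to_ac"
proof
  have nQ: "normal_vec Q" using assms normal by auto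
  assume "pp Q \<in> rational_roots g"
  then obtain x y where xy: "pp Q = pp (to_ac x, to_ac y)" by (auto simp: rational_roots_def)
  have "(to_ac x, to_ac y) \<in> pp Q" using mem_proj_point xy by fastforce
  then have nz: "(to_ac x, to_ac y) \<noteq> (0, 0)" and dt0: "dt Q (to_ac x, to_ac y) = 0"
    using mem_pp_iff[OF normal_vec_nonzero[OF nQ]] by blast+
  show "Q \<in> range to_ac \<times> range to_ac"
  proof (cases "snd Q = 1")
    case True
    then have "y \<noteq> 0" using nz dt0 by (auto simp: dt_def)
    then have "fst Q = to_ac (x / y)" using dt0 True by (simp add: dt_def field_simps)
    then have "Q = (to_ac (x / y), to_ac 1)" using True by (simp add: prod_eq_iff)
    then show ?thesis by blast
  next
    case False
    then have "Q = (to_ac 1, to_ac 0)" using nQ by (simp add: normal_vec_def)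
    then show ?thesis by blast
  qed
next
  assume "Q \<in> range to_ac \<times> range to_ac"
  then show "pp Q \<in> rational_roots g"
    using assms form_roots_eq unfolding rational_roots_def by force
qed

lemma irreducible_iff: "irreducible g \<longleftrightarrow> rational_roots g = {}"
proof -
  have g0: "g \<noteq> 0" using disc by (auto simp: cubic_form_pCons cubic_disc_def)
  have root: "a * x ^ 3 + b * x ^ 2 * y + c * x * y ^ 2 + d * y ^ 3 = 0 \<longleftrightarrow> gval (to_ac x, to_ac y) = 0" for x y
    unfolding gval_def by (simp flip: to_ac_power to_ac_mult to_ac_add)
  have nz: "(to_ac x, to_ac y) \<noteq> (0, 0) \<longleftrightarrow> \<not> (x = 0 \<and> y = 0)" for x y by auto
  show ?thesis
  proof
    assume irr: "irreducible g"
    show "rational_roots g = {}"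
    proof (rule ccontr)
      assume "rational_roots g \<noteq> {}"
      then obtain P where P: "P \<in> rational_roots g" by blast
      then obtain Q where Q: "P = pp Q" "Q \<in> {Q1, Q2, Q3}" using form_roots_eq by (auto simp: rational_roots_def)
      then obtain x y where xy: "Q = (to_ac x, to_ac y)" using P rational_roots_iff by blast
      moreover have nQ: "normal_vec Q" using Q normal by auto
      moreover have "gval Q = 0" using gval_normal_iff[OF nQ] Q by blast
      ultimately have "x = 0 \<and> y = 0" using irr root unfolding irreducible_cubic_form_iff[OF g0] by blast
      then show False using xy normal_vec_nonzero[OF nQ] by simp
    qed
  next
    assume no: "rational_roots g = {}"
    show "irreducible g" unfolding irreducible_cubic_form_iff[OF g0] root
    proof (intro allI impI, rule ccontr)
      fix x y assume 0: "gval (to_ac x, to_ac y) = 0" and "\<not> (x = 0 \<and> y = 0)"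
      then have "pp (to_ac x, to_ac y) \<in> form_roots g" using form_roots_iff nz by blast
      then have "pp (to_ac x, to_ac y) \<in> rational_roots g" unfolding rational_roots_def by auto
      then show False using no by blast
    qed
  qed
qed

abbreviation SF where "SF \<equiv> splitting_field g"

lemmas SF_closed = subfield_closed[OF splitting_field_subfield]

lemma roots_in_SF: "Q \<in> {Q1, Q2, Q3} \<Longrightarrow> Q \<in> SF \<times> SF"
proof -
  assume Q: "Q \<in> {Q1, Q2, Q3}"
  then have nQ: "normal_vec Q" using normal by auto
  show ?thesis
  proof (cases "snd Q = 1")
    case True
    have "pp Q \<in> form_roots g" using Q form_roots_eq by auto
    then have "fst Q / snd Q \<in> SF" unfolding splitting_field_def
      using True by (intro generate_field.incl UnI2 CollectI exI[of _ "fst Q"] exI[of _ "snd Q"]) simp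
    then show ?thesis using True by (cases Q) (auto simp: SF_closed)
  next
    case False
    then show ?thesis using nQ by (simp add: normal_vec_def SF_closed)
  qed
qed

lemma SF_least:
  assumes F: "subfield F ring_of_type_algebra" "range to_ac \<subseteq> F"
    and Q: "Q1 \<in> F \<times> F" "Q2 \<in> F \<times> F" "Q3 \<in> F \<times> F"
  shows "SF \<subseteq> F"
proof (rule splitting_field_least[OF F])
  fix x y :: "'k alg_closure"
  assume y: "y \<noteq> 0" and "proj_point x y \<in> form_roots g"
  then have "pp (x, y) \<in> pp ` {Q1, Q2, Q3}" using form_roots_eq by simp
  then obtain Q where Qx: "pp (x, y) = pp Q" and "Q \<in> {Q1, Q2, Q3}" by (rule imageE)
  from this(2) have "Q \<in> F \<times> F" "normal_vec Q" using Q normal by auto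
  have "dt Q (x, y) = 0" using Qx[symmetric] pp_eq_iff[of Q "(x, y)"] y normal_vec_nonzero[OF \<open>normal_vec Q\<close>] by simp
  then have "snd Q = 1" "fst Q * y = x" using \<open>normal_vec Q\<close> y by (auto simp: normal_vec_def dt_def)
  then have "x / y = fst Q" using y by auto
  moreover have "fst Q \<in> F" using \<open>Q \<in> F \<times> F\<close> by auto
  ultimately show "x / y \<in> F" by simp
qed

end

section \<open>Simple and quadratic extensions\<close>

text \<open>By division with remainder, a nonzero combination of \<open>p\<close> and
  \<open>h\<close> of least degree divides both. As a divisor of the irreducible \<open>h\<close> it
  is a unit, since otherwise it would be associated to \<open>h\<close> and \<open>h\<close> would
  divide \<open>p\<close>.\<close>

lemma irreducible_poly_bezout:
  fixes h p :: "'k::field poly"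
  assumes irr: "irreducible h" and nd: "\<not> h dvd p"
  shows "\<exists>u v. u * p + v * h = 1"
proof -
  define S where "S = {e. e \<noteq> 0 \<and> (\<exists>u v. e = u * p + v * h)}"
  have "h = 0 * p + 1 * h" by simp
  then have "h \<in> S" using irr unfolding S_def irreducible_def by blast
  then obtain e where e: "e \<in> S" "\<And>f. f \<in> S \<Longrightarrow> Polynomial.degree e \<le> Polynomial.degree f"
    using ex_has_least_nat[of "\<lambda>e. e \<in> S" h Polynomial.degree] by blast
  obtain u v where uv: "e = u * p + v * h" "e \<noteq> 0" using e(1) by (auto simp: S_def)
  have dvd: "e dvd f" if f: "f = u' * p + v' * h" for f u' v'
  proof (rule ccontr)
    assume "\<not> e dvd f"
    then have nz: "f mod e \<noteq> 0" by (simp add: dvd_eq_mod_eq_0)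
    have "f mod e = f - f div e * e" by (simp add: minus_div_mult_eq_mod)
    also have "\<dots> = (u' - f div e * u) * p + (v' - f div e * v) * h"
      unfolding uv(1) by (subst f) (simp add: algebra_simps)
    finally have "f mod e \<in> S" using nz unfolding S_def by blast
    moreover have "Polynomial.degree (f mod e) < Polynomial.degree e"
      using degree_mod_less[OF uv(2), of f] nz by simp
    ultimately show False using e(2) by fastforce
  qed
  have "e dvd p" using dvd[of p 1 0] by simp
  have "e dvd h" using dvd[of h 0 1] by simp
  then obtain q where q: "h = e * q" by (rule dvdE)
  have "\<not> q dvd 1"
  proof
    assume "q dvd 1"
    then obtain r where "1 = q * r" by (rule dvdE)
    then have "e = h * r" by (simp add: q mult.assoc)
    then have "h dvd p" using \<open>e dvd p\<close> by (metis dvd_trans dvd_triv_left)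
    then show False using nd by simp
  qed
  then have "e dvd 1" using irr q irreducibleD by blast
  then obtain w where "1 = e * w" by (rule dvdE)
  then have "(w * u) * p + (w * v) * h = 1" by (simp add: uv(1) algebra_simps)
  then show ?thesis by blast
qed

lemma irreducible_cubic_poly:
  fixes h :: "'k::field poly"
  assumes deg: "Polynomial.degree h = 3" and nr: "\<And>x. poly h x \<noteq> 0"
  shows "irreducible h"
proof (rule irreducibleI)
  show "h \<noteq> 0" using deg by auto
  show "\<not> h dvd 1" using deg by (auto dest!: divides_degree)
  have key: "u dvd 1" if uv: "h = u * v" and du: "Polynomial.degree u \<le> 1" for u v
  proof (cases "Polynomial.degree u = 0")
    case True
    then obtain w where "u = [:w:]" by (metis degree_eq_zeroE)
    moreover have "u \<noteq> 0" using uv deg by auto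
    ultimately show ?thesis by (simp add: is_unit_poly_iff dvd_field_iff)
  next
    case False
    obtain l w where "u = pCons l w" by (rule pCons_cases)
    with False du have "w \<noteq> 0" "Polynomial.degree w = 0" by (auto split: if_splits)
    then obtain e where e: "w = [:e:]" "e \<noteq> 0" by (metis degree_eq_zeroE pCons_0_0)
    then have "poly u (- l / e) = 0" using \<open>u = pCons l w\<close> by simp
    then have "poly h (- l / e) = 0" by (simp add: uv)
    then show ?thesis using nr by blast
  qed
  fix u v assume uv: "h = u * v"
  then have "u \<noteq> 0" "v \<noteq> 0" using deg by auto
  then have "Polynomial.degree u + Polynomial.degree v = 3" using deg uv by (simp add: degree_mult_eq)
  then consider "Polynomial.degree u \<le> 1" | "Polynomial.degree v \<le> 1" by linarith
  then show "u dvd 1 \<or> v dvd 1" using key[of u v] key[of v u] uv by cases (auto simp: mult.commute)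
qed

definition acpoly :: "'k::field poly \<Rightarrow> 'k alg_closure \<Rightarrow> 'k alg_closure" where
  "acpoly p x = poly (map_poly to_ac p) x"

lemma acpoly_0 [simp]: "acpoly 0 x = 0"
  and acpoly_pCons [simp]: "acpoly (pCons c p) x = to_ac c + x * acpoly p x"
  by (simp_all add: acpoly_def map_poly_pCons)

lemma acpoly_1 [simp]: "acpoly 1 x = 1"
  by (simp add: one_pCons)

lemma acpoly_add [simp]: "acpoly (p + q) x = acpoly p x + acpoly q x"
proof (induction p arbitrary: q)
  case (pCons c p)
  then show ?case by (cases q) (simp add: algebra_simps)
qed simp

lemma acpoly_smult [simp]: "acpoly (smult k p) x = to_ac k * acpoly p x"
  by (induction p) (simp_all add: algebra_simps)

lemma acpoly_uminus [simp]: "acpoly (- p) x = - acpoly p x"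
  by (induction p) simp_all

lemma acpoly_diff [simp]: "acpoly (p - q) x = acpoly p x - acpoly q x"
  using acpoly_add[of p "- q" x] by simp

lemma acpoly_mult [simp]: "acpoly (p * q) x = acpoly p x * acpoly q x"
  by (induction p) (simp_all add: algebra_simps)

lemma acpoly_dvd: "h dvd p \<Longrightarrow> acpoly h x = 0 \<Longrightarrow> acpoly p x = 0"
  by (auto elim!: dvdE)

lemma irreducible_dvd_acpoly:
  assumes "irreducible h" "acpoly h x = 0" "acpoly p x = 0"
  shows "h dvd p"
proof (rule ccontr)
  assume "\<not> h dvd p"
  then obtain u v where "u * p + v * h = 1" using irreducible_poly_bezout assms(1) by blast
  then have "acpoly (u * p + v * h) x = 1" by simp
  then show False using assms by simp
qed

text \<open>The image of evaluation at \<open>x\<close> is the ring K[x]. It is a field because a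
  Bezout coefficient of \<open>p\<close> modulo \<open>h\<close> evaluates to the inverse of
  p(x).\<close>

lemma subfield_range_acpoly:
  assumes irr: "irreducible h" and x: "acpoly h x = 0"
  shows "subfield (range (\<lambda>p. acpoly p x)) ring_of_type_algebra"
  unfolding subfield_type_iff
proof (intro conjI ballI)
  show "1 \<in> range (\<lambda>p. acpoly p x)" by (rule range_eqI[of _ _ 1]) simp
next
  fix y assume "y \<in> range (\<lambda>p. acpoly p x)"
  then obtain p where p: "y = acpoly p x" by auto
  show "- y \<in> range (\<lambda>p. acpoly p x)" by (rule range_eqI[of _ _ "- p"]) (simp add: p)
  show "inverse y \<in> range (\<lambda>p. acpoly p x)"
  proof (cases "h dvd p")
    case True
    then have "y = 0" using p x acpoly_dvd by blast
    then show ?thesis by (intro range_eqI[of _ _ 0]) simp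
  next
    case False
    then obtain u v where "u * p + v * h = 1" using irreducible_poly_bezout irr by blast
    then have "acpoly (u * p + v * h) x = 1" by simp
    then have "y * acpoly u x = 1" using x by (simp add: p mult.commute)
    then have "inverse y = acpoly u x" by (rule inverse_unique)
    then show ?thesis by blast
  qed
next
  fix y z assume "y \<in> range (\<lambda>p. acpoly p x)" "z \<in> range (\<lambda>p. acpoly p x)"
  then obtain p q where "y = acpoly p x" "z = acpoly q x" by auto
  then show "y + z \<in> range (\<lambda>p. acpoly p x)" "y * z \<in> range (\<lambda>p. acpoly p x)"
    using range_eqI[of "y + z" "\<lambda>p. acpoly p x" "p + q"] range_eqI[of "y * z" "\<lambda>p. acpoly p x" "p * q"]
    by simp_all
qed

lemma to_ac_in_range_acpoly: "to_ac e \<in> range (\<lambda>p. acpoly p x)"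
  by (rule range_eqI[of _ _ "[:e:]"]) simp

lemma self_in_range_acpoly: "x \<in> range (\<lambda>p. acpoly p x)"
  by (rule range_eqI[of _ _ "[:0, 1:]"]) simp

text \<open>\<open>p - y\<close> has more zeros than its degree allows, so it vanishes and
  \<open>y\<close> is the constant coefficient of \<open>p\<close>. This is how an element fixed by
  enough automorphisms is recognised as rational.\<close>

lemma acpoly_const_value:
  assumes "Polynomial.degree p < card A" "finite A" "\<And>x. x \<in> A \<Longrightarrow> acpoly p x = y"
  shows "y \<in> range to_ac"
proof -
  define q where "q = map_poly to_ac p - [:y:]"
  have "q = 0"
  proof (rule ccontr)
    assume "q \<noteq> 0"
    have "A \<subseteq> {x. poly q x = 0}" using assms(3) by (auto simp: q_def acpoly_def)
    then have "card A \<le> card {x. poly q x = 0}" using \<open>q \<noteq> 0\<close> poly_roots_finite card_mono by blast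
    also have "\<dots> \<le> Polynomial.degree q" using \<open>q \<noteq> 0\<close> by (rule card_poly_roots_bound)
    also have "\<dots> \<le> Polynomial.degree p" unfolding q_def
      by (rule degree_diff_le) (simp_all add: degree_map_poly)
    finally show False using assms(1) by simp
  qed
  then have "map_poly to_ac p = [:y:]" by (simp add: q_def)
  then have "to_ac (poly.coeff p 0) = y" using coeff_map_poly[of to_ac p 0] by simp
  then show ?thesis by blast
qed

lemma subfield_adjoin_sqrt:
  fixes F :: "'a::field set"
  assumes F: "subfield F ring_of_type_algebra" and s: "s\<^sup>2 \<in> F" "s \<notin> F"
  shows "subfield {x + y * s |x y. x \<in> F \<and> y \<in> F} ring_of_type_algebra" (is "subfield ?E _")
  unfolding subfield_type_iff
proof (intro conjI ballI)
  note Fc = subfield_closed[OF F]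
  have I: "x + y * s \<in> ?E" if "x \<in> F" "y \<in> F" for x y using that by blast
  show "1 \<in> ?E" using I[of 1 0] Fc by simp
  fix z assume "z \<in> ?E"
  then obtain x y where z: "z = x + y * s" "x \<in> F" "y \<in> F" by blast
  show "- z \<in> ?E" using I[of "- x" "- y"] Fc z by simp
  show "inverse z \<in> ?E"
  proof (cases "z = 0")
    case True
    then show ?thesis using I[of 0 0] Fc by simp
  next
    case False
    \<comment> \<open>The norm of \<open>z\<close>. The conjugate of a nonzero \<open>z\<close> is
      nonzero because \<open>s\<close> is not in \<open>F\<close>, so \<open>z\<close> is inverted
      as conjugate over norm.\<close>
    define n where "n = x\<^sup>2 - y\<^sup>2 * s\<^sup>2"
    have n: "n = z * (x - y * s)" by (simp add: n_def z algebra_simps power2_eq_square)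
    have "x - y * s \<noteq> 0"
    proof
      assume 0: "x - y * s = 0"
      have "y \<noteq> 0" using 0 False z by auto
      then have "s = x / y" using 0 by (simp add: field_simps)
      then show False using Fc z s by simp
    qed
    then have n0: "n \<noteq> 0" using n False by simp
    have "inverse z = (x - y * s) / n" using \<open>x - y * s \<noteq> 0\<close> by (simp add: n inverse_eq_divide)
    then have "inverse z = x / n + (- y / n) * s" by (simp add: diff_divide_distrib)
    moreover have "n \<in> F" unfolding n_def using Fc z s by simp
    ultimately show ?thesis using I[of "x / n" "- y / n"] Fc z by simp
  qed
  fix z' assume "z' \<in> ?E"
  then obtain x' y' where z': "z' = x' + y' * s" "x' \<in> F" "y' \<in> F" by blast
  show "z + z' \<in> ?E" using I[of "x + x'" "y + y'"] Fc z z' by (simp add: algebra_simps)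
  have "z * z' = (x * x' + y * y' * s\<^sup>2) + (x * y' + y * x') * s"
    by (simp add: z z' algebra_simps power2_eq_square)
  then show "z * z' \<in> ?E" using I[of "x * x' + y * y' * s\<^sup>2" "x * y' + y * x'"] Fc z z' s by simp
qed

lemma is_square_to_ac_iff:
  assumes "s\<^sup>2 = to_ac e"
  shows "is_square e \<longleftrightarrow> s \<in> range to_ac"
proof
  assume "is_square e"
  then obtain t where "e = t\<^sup>2" by (auto simp: is_nth_power_def)
  then have "s\<^sup>2 = (to_ac t)\<^sup>2" using assms by simp
  then have "s = to_ac t \<or> s = to_ac (- t)" by (simp add: power2_eq_iff)
  then show "s \<in> range to_ac" by blast
next
  assume "s \<in> range to_ac"
  then obtain t where "s = to_ac t" by blast
  then have "to_ac (t\<^sup>2) = to_ac e" using assms by simp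
  then have "t\<^sup>2 = e" unfolding to_ac_eq_iff .
  then show "is_square e" by (auto simp: is_nth_power_def)
qed

section \<open>The splitting field generated by one root and \<delta>\<close>

context cubic_roots
begin

lemma rot_delta: "cubic_roots.\<delta> \<kappa> Q2 Q3 Q1 = \<delta>"
  unfolding cubic_roots.\<delta>_def[OF rotate] \<delta>_def by (simp add: algebra_simps)

lemma swap_delta: "cubic_roots.\<delta> \<kappa> Q1 Q3 Q2 = - \<delta>"
  unfolding cubic_roots.\<delta>_def[OF swap] \<delta>_def
  by (simp add: dt_swap[of Q1 Q3] dt_swap[of Q3 Q2] dt_swap[of Q2 Q1] algebra_simps)

lemma delta_nz: "\<delta> \<noteq> 0"
  using kappa_nz dt_nz by (simp add: \<delta>_def)

lemma is_square_disc_iff: "is_square (cubic_disc a b c d) \<longleftrightarrow> \<delta> \<in> range to_ac"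
  by (rule is_square_to_ac_iff[OF delta_square])

lemma delta_in_SF: "\<delta> \<in> SF"
  unfolding \<delta>_def using roots_in_SF
  by (intro SF_closed to_ac_in_splitting_field) auto

text \<open>
  The sum of the other two roots is known from the coefficients, and their difference is, up to
  elements already known, \<open>\<delta>\<close>.
\<close>

lemma roots_from_delta:
  assumes F: "subfield F ring_of_type_algebra" "range to_ac \<subseteq> F"
    and Q1: "Q1 \<in> F \<times> F" and d: "\<delta> \<in> F"
  shows "Q2 \<in> F \<times> F \<and> Q3 \<in> F \<times> F"
proof -
  note Fc = subfield_closed[OF F(1)]
  have K: "to_ac e \<in> F" for e using F(2) by blast
  have k0: "to_ac \<kappa> \<noteq> 0" using kappa_nz by simp
  have two: "(2::'k alg_closure) \<in> F" using K[of 2] by simp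
  have half: "x \<in> F \<and> y \<in> F" if "x + y \<in> F" "x - y \<in> F" for x y
  proof -
    have "x = ((x + y) + (x - y)) / 2" "y = ((x + y) - (x - y)) / 2" using two_ac by simp_all
    then show ?thesis using Fc that two by metis
  qed
  obtain x1 y1 x2 y2 x3 y3 where Q: "Q1 = (x1, y1)" "Q2 = (x2, y2)" "Q3 = (x3, y3)"
    by (metis surj_pair)
  have x1: "x1 \<in> F" using Q1 Q by auto
  have 01: "0 \<in> F" "1 \<in> F" using Fc by auto
  note co = coeffs[unfolded Q, simplified]
  \<comment> \<open>At most one of the distinct roots is at infinity. If it is \<open>Q2\<close> or
    \<open>Q3\<close>, one unknown coordinate remains and the coefficient \<open>c\<close>
    determines it.\<close>
  consider "y1 = 1" "y2 = 1" "y3 = 1" | "y1 = 1" "y2 = 1" "x3 = 1" "y3 = 0"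
    | "y1 = 1" "x2 = 1" "y2 = 0" "y3 = 1" | "x1 = 1" "y1 = 0" "y2 = 1" "y3 = 1"
    using normal distinct unfolding Q normal_vec_def by auto
  then show ?thesis
  proof cases
    case 1
    have s: "x2 + x3 = to_ac b / to_ac \<kappa> - x1" using co(2) k0 1 by (simp add: field_simps)
    then have sF: "x2 + x3 \<in> F" using Fc K x1 by simp
    have e: "- to_ac c / to_ac \<kappa> = x1 * x2 + x1 * x3 + x2 * x3" using co(3) k0 1 by simp
    have "x2 * x3 = - to_ac c / to_ac \<kappa> - x1 * (x2 + x3)" unfolding e by (simp add: algebra_simps)
    then have pF: "x2 * x3 \<in> F" using Fc K x1 sF by simp
    \<comment> \<open>This is (x1 - x2)(x1 - x3), symmetric in the other two roots and hence in
      \<open>F\<close>. Dividing \<delta> by it isolates \<open>x2 - x3\<close>.\<close>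
    define n where "n = x1\<^sup>2 - x1 * (x2 + x3) + x2 * x3"
    have nF: "n \<in> F" unfolding n_def using Fc x1 sF pF by simp
    have n: "n = - (dt Q1 Q2 * dt Q3 Q1)" by (simp add: n_def dt_def Q 1 algebra_simps power2_eq_square)
    then have n0: "n \<noteq> 0" using dt_nz by simp
    have "\<delta> = - ((to_ac \<kappa>)\<^sup>2 * n) * (x2 - x3)" unfolding \<delta>_def n by (simp add: Q dt_def 1)
    then have "x2 - x3 = \<delta> / (- ((to_ac \<kappa>)\<^sup>2 * n))" using n0 k0 by simp
    then have "x2 - x3 \<in> F" using Fc K nF d by simp
    then show ?thesis using half[OF sF] 1 Q 01 by simp
  next
    case 2
    have "to_ac c / to_ac \<kappa> = - (x1 + x2)" using co(3) k0 2 by simp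
    then have "x2 = - to_ac c / to_ac \<kappa> - x1" by simp
    then show ?thesis using Fc K x1 Q 2 01 by simp
  next
    case 3
    have "to_ac c / to_ac \<kappa> = - (x1 + x3)" using co(3) k0 3 by simp
    then have "x3 = - to_ac c / to_ac \<kappa> - x1" by simp
    then show ?thesis using Fc K x1 Q 3 01 by simp
  next
    case 4
    have "x2 + x3 = - to_ac c / to_ac \<kappa>" using co(3) k0 4 by simp
    then have sF: "x2 + x3 \<in> F" using Fc K by simp
    have "\<delta> = - (to_ac \<kappa>)\<^sup>2 * (x2 - x3)" unfolding \<delta>_def by (simp add: Q dt_def 4)
    then have "x2 - x3 = \<delta> / (- (to_ac \<kappa>)\<^sup>2)" using k0 by simp
    then have "x2 - x3 \<in> F" using Fc K d by simp
    then show ?thesis using half[OF sF] 4 Q 01 by simp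
  qed
qed

lemma SF_subset_of_root_delta:
  assumes F: "subfield F ring_of_type_algebra" "range to_ac \<subseteq> F"
    and Q1: "Q1 \<in> F \<times> F" and d: "\<delta> \<in> F"
  shows "SF \<subseteq> F"
  using roots_from_delta[OF assms] SF_least[OF F Q1] by blast

text \<open>Here \<delta> generates \<open>SF\<close> over \<open>F\<close> and its square lies in
  \<open>K\<close>, so every element of \<open>SF\<close> is uniquely
  \<open>x + y * \<delta>\<close> over \<open>F\<close>. The last clause says that the conjugation
  fixes nothing outside \<open>F\<close>: a fixed element has
  \<open>2 * (y * \<delta>) = 0\<close>.\<close>

lemma conjugation_exists:
  assumes F: "subfield F ring_of_type_algebra" "range to_ac \<subseteq> F" "F \<subseteq> SF"
    and Q1: "Q1 \<in> F \<times> F" and d: "\<delta> \<notin> F"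
  shows "\<exists>\<sigma>\<in>galois_auts g. (\<forall>x\<in>F. \<sigma> x = x) \<and> \<sigma> \<delta> = - \<delta> \<and> (\<forall>x\<in>SF. \<sigma> x = x \<longrightarrow> x \<in> F)"
proof -
  note Fc = subfield_closed[OF F(1)]
  define E where "E = {x + y * \<delta> |x y. x \<in> F \<and> y \<in> F}"
  have d2: "\<delta>\<^sup>2 \<in> F" unfolding delta_square using F(2) by blast
  have E: "subfield E ring_of_type_algebra" unfolding E_def by (rule subfield_adjoin_sqrt[OF F(1) d2 d])
  have EI: "x + y * \<delta> \<in> E" if "x \<in> F" "y \<in> F" for x y using that E_def by blast
  have FE: "x \<in> E" if "x \<in> F" for x using EI[of x 0] that Fc by simp
  have dE: "\<delta> \<in> E" using EI[of 0 1] Fc by simp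
  have "SF \<subseteq> E" using SF_subset_of_root_delta[OF E _ _ dE] FE F(2) Q1 by blast
  moreover have "E \<subseteq> SF"
  proof
    fix z assume "z \<in> E"
    then obtain x y where "z = x + y * \<delta>" "x \<in> SF" "y \<in> SF" using E_def F(3) by blast
    then show "z \<in> SF" by (simp add: SF_closed delta_in_SF)
  qed
  ultimately have SFE: "SF = E" by blast
  have uniq: "x = x' \<and> y = y'" if "x + y * \<delta> = x' + y' * \<delta>" "x \<in> F" "y \<in> F" "x' \<in> F" "y' \<in> F" for x y x' y'
  proof -
    have eq: "(y - y') * \<delta> = x' - x" using that(1) by (simp add: algebra_simps)
    have "y = y'"
    proof (rule ccontr)
      assume "y \<noteq> y'"
      then have "\<delta> = (x' - x) / (y - y')" using eq by (simp add: field_simps)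
      then show False using d Fc that by simp
    qed
    then show ?thesis using that by simp
  qed
  \<comment> \<open>Unspecified outside \<open>SF\<close>, which is harmless since
    \<open>galois_auts\<close> constrains only values on \<open>SF\<close>.\<close>
  define \<sigma> where "\<sigma> z = (THE w. \<exists>x\<in>F. \<exists>y\<in>F. z = x + y * \<delta> \<and> w = x - y * \<delta>)" for z
  have s: "\<sigma> (x + y * \<delta>) = x - y * \<delta>" if "x \<in> F" "y \<in> F" for x y
    unfolding \<sigma>_def using that uniq by (intro the_equality) blast+
  have sF: "\<sigma> x = x" if "x \<in> F" for x using s[of x 0] that Fc by simp
  have sd: "\<sigma> \<delta> = - \<delta>" using s[of 0 1] Fc by simp
  have sE: "\<sigma> z \<in> E" if z: "z \<in> E" for z
  proof -
    obtain x y where z: "z = x + y * \<delta>" "x \<in> F" "y \<in> F" using z E_def by blast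
    show ?thesis using s z EI[of x "- y"] Fc by simp
  qed
  have ss: "\<sigma> (\<sigma> z) = z" if z: "z \<in> E" for z
  proof -
    obtain x y where z: "z = x + y * \<delta>" "x \<in> F" "y \<in> F" using z E_def by blast
    then show ?thesis using s[of x y] s[of x "- y"] Fc by simp
  qed
  have bij: "bij_betw \<sigma> E E" by (rule bij_betw_byWitness[where f' = \<sigma>]) (use ss sE in auto)
  have hom: "\<sigma> (z + z') = \<sigma> z + \<sigma> z' \<and> \<sigma> (z * z') = \<sigma> z * \<sigma> z'" if zz: "z \<in> E" "z' \<in> E" for z z'
  proof -
    obtain x y where z: "z = x + y * \<delta>" "x \<in> F" "y \<in> F" using zz E_def by blast
    obtain x' y' where z': "z' = x' + y' * \<delta>" "x' \<in> F" "y' \<in> F" using zz E_def by blast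
    have eq: "z + z' = (x + x') + (y + y') * \<delta>"
      "z * z' = (x * x' + y * y' * \<delta>\<^sup>2) + (x * y' + y * x') * \<delta>"
      by (simp_all add: z z' algebra_simps power2_eq_square)
    have S: "\<sigma> (z + z') = (x + x') - (y + y') * \<delta>"
      "\<sigma> (z * z') = (x * x' + y * y' * \<delta>\<^sup>2) - (x * y' + y * x') * \<delta>"
      unfolding eq by (rule s; use Fc z z' d2 in simp)+
    have T: "\<sigma> z = x - y * \<delta>" "\<sigma> z' = x' - y' * \<delta>" using s z z' by simp_all
    show ?thesis unfolding S T by (simp add: algebra_simps power2_eq_square)
  qed
  have "\<sigma> (to_ac e) = to_ac e" for e using sF F(2) by blast
  then have "\<sigma> \<in> galois_auts g" unfolding galois_auts_iff SFE using bij hom by simp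
  moreover have "x \<in> F" if x: "x \<in> SF" "\<sigma> x = x" for x
  proof -
    obtain u v where z: "x = u + v * \<delta>" "u \<in> F" "v \<in> F" using x SFE E_def by blast
    then have "2 * (v * \<delta>) = 0" using s[of u v] x by simp
    then have "v = 0" using two_ac delta_nz by simp
    then show ?thesis using z by simp
  qed
  ultimately show ?thesis using sF sd by blast
qed

text \<open>Since \<sigma> fixes 0 and 1, it keeps vectors normal. A chosen root vector therefore
  goes exactly to a chosen root vector, without a scalar factor.\<close>

lemma galois_maps_roots:
  assumes "\<sigma> \<in> galois_auts g" "Q \<in> {Q1, Q2, Q3}"
  shows "map_prod \<sigma> \<sigma> Q \<in> {Q1, Q2, Q3}"
proof -
  interpret galois_aut g \<sigma> by standard (rule assms)
  have Q: "fst Q \<in> SF" "snd Q \<in> SF" "normal_vec Q" using roots_in_SF[OF assms(2)] assms(2) normal by auto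
  have "gval Q = 0" using gval_normal_iff[OF Q(3)] assms(2) by simp
  then have "\<sigma> (gval Q) = 0" by simp
  also have "\<sigma> (gval Q) = gval (map_prod \<sigma> \<sigma> Q)"
    unfolding gval_def using Q by (simp add: add mult power SF_closed to_ac_in_splitting_field)
  finally have "gval (map_prod \<sigma> \<sigma> Q) = 0" .
  moreover have "normal_vec (map_prod \<sigma> \<sigma> Q)" using Q(3) by (auto simp: normal_vec_def)
  ultimately show ?thesis using gval_normal_iff by simp
qed

end

section \<open>The fixed field of the Galois group\<close>

text \<open>If the other two roots were fixed as well, \<delta> would be fixed, contradicting that
  \<delta> and - \<delta> differ. So they are exchanged.\<close>

lemma (in cubic_roots) galois_moves_other_roots:
  assumes s: "\<sigma> \<in> galois_auts g" and "map_prod \<sigma> \<sigma> Q1 = Q1" and "\<sigma> \<delta> = - \<delta>"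
  shows "map_prod \<sigma> \<sigma> Q2 = Q3" "map_prod \<sigma> \<sigma> Q3 = Q2"
proof -
  interpret galois_aut g \<sigma> by standard (rule s)
  have Q: "Q1 \<in> SF \<times> SF" "Q2 \<in> SF \<times> SF" "Q3 \<in> SF \<times> SF" using roots_in_SF by auto
  have inj: "v = w" if "map_prod \<sigma> \<sigma> v = map_prod \<sigma> \<sigma> w" "v \<in> SF \<times> SF" "w \<in> SF \<times> SF" for v w
    using that eq_iff by (cases v; cases w) auto
  have "map_prod \<sigma> \<sigma> Q2 \<noteq> Q2 \<or> map_prod \<sigma> \<sigma> Q3 \<noteq> Q3"
  proof (rule ccontr)
    assume "\<not> ?thesis"
    then have "\<sigma> \<delta> = \<delta>" unfolding \<delta>_def
      using Q assms(2) by (simp add: mult power dt SF_closed to_ac_in_splitting_field)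
    then show False using assms(3) delta_nz two_ac by (simp add: eq_neg_iff_add_eq_0 flip: mult_2)
  qed
  moreover have "map_prod \<sigma> \<sigma> Q2 \<in> {Q1, Q2, Q3}" "map_prod \<sigma> \<sigma> Q3 \<in> {Q1, Q2, Q3}"
    using galois_maps_roots[OF s] by auto
  moreover have "map_prod \<sigma> \<sigma> Q2 \<noteq> Q1" "map_prod \<sigma> \<sigma> Q3 \<noteq> Q1" "map_prod \<sigma> \<sigma> Q2 \<noteq> map_prod \<sigma> \<sigma> Q3"
    using inj[of Q2 Q1] inj[of Q3 Q1] inj[of Q2 Q3] Q assms(2) distinct by auto
  ultimately show "map_prod \<sigma> \<sigma> Q2 = Q3" "map_prod \<sigma> \<sigma> Q3 = Q2" by auto
qed

locale irreducible_cubic = cubic_roots a b c d \<kappa> Q1 Q2 Q3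
  for a b c d :: "'k::field" and \<kappa> Q1 Q2 Q3 +
  assumes no_rational: "rational_roots g = {}"
begin

lemma rotate': "irreducible_cubic a b c d \<kappa> Q2 Q3 Q1"
  and swap': "irreducible_cubic a b c d \<kappa> Q1 Q3 Q2"
  using rotate swap no_rational by (simp_all add: irreducible_cubic_def irreducible_cubic_axioms_def)

text \<open>[1:0] is itself a rational point. Without rational roots all roots are thus affine, and
  \<open>h\<close> below is a cubic polynomial with these roots.\<close>

lemma affine: "snd Q1 = 1" "snd Q2 = 1" "snd Q3 = 1"
proof -
  have "snd Q = 1" if "Q \<in> {Q1, Q2, Q3}" for Q
  proof (rule ccontr)
    assume "snd Q \<noteq> 1"
    then have "Q = (to_ac 1, to_ac 0)" using that normal by (auto simp: normal_vec_def)
    then have "pp Q \<in> rational_roots g" using rational_roots_iff[OF that] by blast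
    then show False using no_rational by blast
  qed
  then show "snd Q1 = 1" "snd Q2 = 1" "snd Q3 = 1" by auto
qed

definition h :: "'k poly" where "h = [:d, c, b, a:]"

lemma acpoly_h: "acpoly h x = gval (x, 1)"
  by (simp add: h_def gval_def algebra_simps power2_eq_square power3_eq_cube)

lemma acpoly_h_root: "Q \<in> {Q1, Q2, Q3} \<Longrightarrow> acpoly h (fst Q) = 0"
proof -
  assume Q: "Q \<in> {Q1, Q2, Q3}"
  then have "normal_vec Q" using normal by auto
  moreover have "(fst Q, 1) = Q" using Q affine by (cases Q) auto
  ultimately show ?thesis using gval_normal_iff[of Q] Q by (simp add: acpoly_h)
qed

lemma degree_h: "Polynomial.degree h = 3"
proof -
  have "to_ac a \<noteq> 0" using coeffs(1) affine kappa_nz by simp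
  then show ?thesis by (simp add: h_def)
qed

lemma irreducible_h: "irreducible h"
proof (rule irreducible_cubic_poly[OF degree_h])
  fix x
  show "poly h x \<noteq> 0"
  proof
    assume "poly h x = 0"
    then have "to_ac (poly h x) = 0" by simp
    then have "gval (to_ac x, 1) = 0" by (simp add: h_def gval_def algebra_simps power2_eq_square power3_eq_cube)
    then have Q: "(to_ac x, to_ac 1) \<in> {Q1, Q2, Q3}" using gval_normal_iff[of "(to_ac x, 1)"] by (simp add: normal_vec_def)
    then have "pp (to_ac x, to_ac 1) \<in> rational_roots g" using rational_roots_iff[OF Q] by blast
    then show False using no_rational by blast
  qed
qed

abbreviation F1 where "F1 \<equiv> range (\<lambda>p. acpoly p (fst Q1))"

lemma F1_subfield: "subfield F1 ring_of_type_algebra"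
  by (rule subfield_range_acpoly[OF irreducible_h]) (simp add: acpoly_h_root)

lemma to_ac_F1: "range to_ac \<subseteq> F1"
  using to_ac_in_range_acpoly by blast

lemma Q1_F1: "Q1 \<in> F1 \<times> F1"
  using self_in_range_acpoly[of "fst Q1"] affine(1) subfield_1[OF F1_subfield] by (cases Q1) auto

lemma acpoly_in_SF: "x \<in> SF \<Longrightarrow> acpoly p x \<in> SF"
  by (induction p) (simp_all add: SF_closed to_ac_in_splitting_field)

lemma F1_SF: "F1 \<subseteq> SF"
  using acpoly_in_SF roots_in_SF[of Q1] by (cases Q1) auto

lemma F1_reduced:
  assumes "x \<in> F1"
  obtains p where "x = acpoly p (fst Q1)" "Polynomial.degree p < 3"
proof -
  obtain p where p: "x = acpoly p (fst Q1)" using assms by blast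
  have h0: "h \<noteq> 0" using degree_h by auto
  have "acpoly p (fst Q1) = acpoly (p div h * h + p mod h) (fst Q1)" by simp
  also have "\<dots> = acpoly (p mod h) (fst Q1)"
    unfolding acpoly_add acpoly_mult using acpoly_h_root[of Q1] by simp
  finally have "x = acpoly (p mod h) (fst Q1)" using p by simp
  moreover have "Polynomial.degree (p mod h) < 3" using degree_mod_less[OF h0, of p] degree_h by auto
  ultimately show ?thesis by (rule that)
qed

text \<open>All three roots have the same minimal polynomial \<open>h\<close> up to a constant. This
  is the isomorphism between K(x1) and the field of any other root, stated as a transfer of
  relations.\<close>

lemma acpoly_root_transfer:
  assumes "acpoly p (fst Q1) = 0" "Q \<in> {Q1, Q2, Q3}"
  shows "acpoly p (fst Q) = 0"
  using irreducible_dvd_acpoly[OF irreducible_h _ assms(1)] acpoly_h_root acpoly_dvd assms(2) by blast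

lemma const_value_rational:
  assumes "Polynomial.degree p < 3" "acpoly p (fst Q1) = x" "acpoly p (fst Q2) = x" "acpoly p (fst Q3) = x"
  shows "x \<in> range to_ac"
proof (rule acpoly_const_value[of p "{fst Q1, fst Q2, fst Q3}"])
  have "fst Q1 \<noteq> fst Q2" "fst Q2 \<noteq> fst Q3" "fst Q3 \<noteq> fst Q1"
    using distinct affine by (auto simp: prod_eq_iff)
  then show "Polynomial.degree p < card {fst Q1, fst Q2, fst Q3}" using assms by (simp add: card_insert_if)
qed (use assms in auto)

text \<open>If \<open>\<delta> = p(x\<^sub>1)\<close> were not rational, then \<open>p(x\<^sub>i) = \<plusminus> \<delta>\<close> for all \<open>i\<close>, so that the rational trace
  \<open>p(x\<^sub>1) + p(x\<^sub>2) + p(x\<^sub>3)\<close> would be \<open>\<plusminus> \<delta>\<close> or \<open>\<plusminus> 3 \<delta>\<close>.\<close>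

lemma delta_F1_imp_rational:
  assumes "\<delta> \<in> F1"
  shows "\<delta> \<in> range to_ac"
proof -
  obtain p where p: "\<delta> = acpoly p (fst Q1)" "Polynomial.degree p < 3" using assms by (rule F1_reduced)
  define D where "D = cubic_disc a b c d"
  have "acpoly (p * p - [:D:]) (fst Q1) = 0"
    using delta_square p by (simp add: D_def power2_eq_square)
  then have "acpoly (p * p - [:D:]) (fst Q) = 0" if "Q \<in> {Q1, Q2, Q3}" for Q
    using acpoly_root_transfer that by blast
  then have "(acpoly p (fst Q))\<^sup>2 = \<delta>\<^sup>2" if "Q \<in> {Q1, Q2, Q3}" for Q
    using that delta_square by (simp add: D_def power2_eq_square)
  then have pm: "acpoly p (fst Q2) = \<delta> \<or> acpoly p (fst Q2) = - \<delta>" "acpoly p (fst Q3) = \<delta> \<or> acpoly p (fst Q3) = - \<delta>"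
    by (simp_all add: power2_eq_iff)
  obtain p0 p1 p2 where p3: "p = [:p0, p1, p2:]"
  proof -
    have "p = [:poly.coeff p 0, poly.coeff p 1, poly.coeff p 2:]"
    proof (rule poly_eqI)
      fix n :: nat
      have "n = 0 \<or> n = 1 \<or> n = 2 \<or> n > 2" by linarith
      then show "poly.coeff p n = poly.coeff [:poly.coeff p 0, poly.coeff p 1, poly.coeff p 2:] n"
        using p(2) coeff_eq_0[of p n] by (auto simp: coeff_pCons numeral_eq_Suc split: nat.splits)
    qed
    then show ?thesis by (rule that)
  qed
  define x1 x2 x3 where "x1 = fst Q1" and "x2 = fst Q2" and "x3 = fst Q3"
  have k0: "to_ac \<kappa> \<noteq> 0" using kappa_nz by simp
  have e1: "x1 + x2 + x3 = to_ac (b / \<kappa>)" using coeffs(2) affine k0 by (simp add: x1_def x2_def x3_def)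
  have e2: "x1 * x2 + x1 * x3 + x2 * x3 = to_ac (- c / \<kappa>)" using coeffs(3) affine k0 by (simp add: x1_def x2_def x3_def)
  \<comment> \<open>The trace in elementary symmetric functions; the sum of the squares of the roots
    is \<open>e1^2 - 2 * e2\<close>.\<close>
  have "acpoly p x1 + acpoly p x2 + acpoly p x3 =
      3 * to_ac p0 + to_ac p1 * (x1 + x2 + x3)
      + to_ac p2 * ((x1 + x2 + x3)\<^sup>2 - 2 * (x1 * x2 + x1 * x3 + x2 * x3))"
    by (simp add: p3 algebra_simps power2_eq_square)
  also have "\<dots> = to_ac (3 * p0 + p1 * (b / \<kappa>) + p2 * ((b / \<kappa>)\<^sup>2 - 2 * (- c / \<kappa>)))"
    unfolding e1 e2 by simp
  finally obtain t where t: "\<delta> + acpoly p x2 + acpoly p x3 = to_ac t" using p(1) x1_def by metis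
  have "\<delta> \<in> {to_ac t, to_ac (- t), to_ac (t / 3)}"
  proof -
    \<comment> \<open>Two plus signs give 3 \<delta>, mixed signs give \<delta>, two minus signs
      give - \<delta>. The first case divides by 3.\<close>
    consider "3 * \<delta> = to_ac t" | "\<delta> = to_ac t" | "- \<delta> = to_ac t"
      using pm t unfolding x2_def[symmetric] x3_def[symmetric] by auto
    then show ?thesis
    proof cases
      case 1
      then have "\<delta> = to_ac (t / 3)" using three_ac by (simp add: field_simps)
      then show ?thesis by simp
    next
      case 3
      then have "\<delta> = to_ac (- t)" by (metis minus_minus to_ac_minus)
      then show ?thesis by simp
    qed simp
  qed
  then show ?thesis by blast
qed

text \<open>Invariance under the conjugation over K(x1) puts \<open>x\<close> into K(x1), so
  \<open>x = p(x1)\<close> with \<open>p\<close> of degree below 3. The conjugations over K(x2) and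
  K(x3) carry \<open>x1\<close> to \<open>x3\<close> and to \<open>x2\<close>, so \<open>p\<close>
  takes one value at all three roots and \<open>x\<close> is rational.\<close>

lemma fixed_field_nonsquare:
  assumes d: "\<delta> \<notin> range to_ac" and x: "x \<in> SF" "\<And>\<sigma>. \<sigma> \<in> galois_auts g \<Longrightarrow> \<sigma> x = x"
  shows "x \<in> range to_ac"
proof -
  interpret B: irreducible_cubic a b c d \<kappa> Q2 Q3 Q1 by (rule rotate')
  interpret C: irreducible_cubic a b c d \<kappa> Q3 Q1 Q2 by (rule B.rotate')
  have dB: "B.\<delta> = \<delta>" and dC: "C.\<delta> = \<delta>" using rot_delta B.rot_delta by simp_all
  obtain \<sigma>1 where s1: "\<sigma>1 \<in> galois_auts g" "\<And>x. x \<in> SF \<Longrightarrow> \<sigma>1 x = x \<Longrightarrow> x \<in> F1"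
    using conjugation_exists[OF F1_subfield to_ac_F1 F1_SF Q1_F1] delta_F1_imp_rational d by blast
  obtain \<sigma>2 where s2: "\<sigma>2 \<in> galois_auts g" "\<And>x. x \<in> B.F1 \<Longrightarrow> \<sigma>2 x = x" "\<sigma>2 \<delta> = - \<delta>"
    using B.conjugation_exists[OF B.F1_subfield B.to_ac_F1 B.F1_SF B.Q1_F1] B.delta_F1_imp_rational d
    unfolding dB by blast
  obtain \<sigma>3 where s3: "\<sigma>3 \<in> galois_auts g" "\<And>x. x \<in> C.F1 \<Longrightarrow> \<sigma>3 x = x" "\<sigma>3 \<delta> = - \<delta>"
    using C.conjugation_exists[OF C.F1_subfield C.to_ac_F1 C.F1_SF C.Q1_F1] C.delta_F1_imp_rational d
    unfolding dC by blast
  have "map_prod \<sigma>2 \<sigma>2 Q2 = Q2" using s2(2) B.Q1_F1 by (cases Q2) auto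
  then have m2: "map_prod \<sigma>2 \<sigma>2 Q1 = Q3" using B.galois_moves_other_roots(2)[OF s2(1)] s2(3) dB by simp
  have "map_prod \<sigma>3 \<sigma>3 Q3 = Q3" using s3(2) C.Q1_F1 by (cases Q3) auto
  then have m3: "map_prod \<sigma>3 \<sigma>3 Q1 = Q2" using C.galois_moves_other_roots(1)[OF s3(1)] s3(3) dC by simp
  obtain p where p: "x = acpoly p (fst Q1)" "Polynomial.degree p < 3"
    using s1(2)[OF x(1) x(2)[OF s1(1)]] by (rule F1_reduced)
  have ac: "\<sigma> (acpoly q y) = acpoly q (\<sigma> y)" if "\<sigma> \<in> galois_auts g" "y \<in> SF" for \<sigma> q y
  proof -
    interpret galois_aut g \<sigma> by standard (rule that)
    show ?thesis using that(2)
      by (induction q) (simp_all add: add mult SF_closed to_ac_in_splitting_field acpoly_in_SF)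
  qed
  have "fst Q1 \<in> SF" using roots_in_SF[of Q1] by auto
  then have "acpoly p (\<sigma>2 (fst Q1)) = x" "acpoly p (\<sigma>3 (fst Q1)) = x"
    using ac[OF s2(1)] ac[OF s3(1)] x(2)[OF s2(1)] x(2)[OF s3(1)] p(1) by simp_all
  moreover have "\<sigma>2 (fst Q1) = fst Q3" "\<sigma>3 (fst Q1) = fst Q2" using m2 m3 by (metis fst_map_prod)+
  ultimately show ?thesis using const_value_rational[OF p(2)] p(1) by simp
qed

text \<open>A rational \<delta> makes K(x1) and K(x2) both equal to the splitting field, so the
  isomorphism between them that takes \<open>x1\<close> to \<open>x2\<close> is an
  automorphism.\<close>

lemma cyclic_automorphism:
  assumes d: "\<delta> \<in> range to_ac"
  shows "SF = F1" "\<exists>\<sigma>\<in>galois_auts g. \<forall>p. \<sigma> (acpoly p (fst Q1)) = acpoly p (fst Q2)"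
proof -
  interpret B: irreducible_cubic a b c d \<kappa> Q2 Q3 Q1 by (rule rotate')
  have dB: "B.\<delta> = \<delta>" using rot_delta by simp
  show SF1: "SF = F1"
    using SF_subset_of_root_delta[OF F1_subfield to_ac_F1 Q1_F1] F1_SF to_ac_F1 d by blast
  have "B.\<delta> \<in> B.F1" using subsetD[OF B.to_ac_F1 d] dB by simp
  then have SF2: "SF = B.F1"
    using B.SF_subset_of_root_delta[OF B.F1_subfield B.to_ac_F1 B.Q1_F1] B.F1_SF by (intro equalityI)
  \<comment> \<open>The polynomial representing an element is not unique; as relations transfer
    between the roots, its value at \<open>x2\<close> does not depend on the choice.\<close>
  define \<sigma> where "\<sigma> x = acpoly (SOME p. x = acpoly p (fst Q1)) (fst Q2)" for x
  have eq: "acpoly p (fst Q1) = acpoly q (fst Q1) \<longleftrightarrow> acpoly p (fst Q2) = acpoly q (fst Q2)" for p q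
    using acpoly_root_transfer[of "p - q" Q2] B.acpoly_root_transfer[of "p - q" Q1] by auto
  have s: "\<sigma> (acpoly p (fst Q1)) = acpoly p (fst Q2)" for p
  proof -
    have "acpoly p (fst Q1) = acpoly (SOME q. acpoly p (fst Q1) = acpoly q (fst Q1)) (fst Q1)"
      by (rule someI[of "\<lambda>q. acpoly p (fst Q1) = acpoly q (fst Q1)" p]) simp
    then show ?thesis unfolding \<sigma>_def using eq by metis
  qed
  have "inj_on \<sigma> F1" by (rule inj_onI) (auto simp: s eq)
  moreover have "\<sigma> ` F1 = B.F1" by (simp add: image_image s)
  ultimately have "bij_betw \<sigma> SF SF" unfolding bij_betw_def using SF1 SF2 by simp
  moreover have "\<sigma> (x + y) = \<sigma> x + \<sigma> y \<and> \<sigma> (x * y) = \<sigma> x * \<sigma> y" if xy: "x \<in> SF" "y \<in> SF" for x y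
  proof -
    obtain p q where pq: "x = acpoly p (fst Q1)" "y = acpoly q (fst Q1)" using xy SF1 by auto
    then show ?thesis using s[of "p + q"] s[of "p * q"] s[of p] s[of q] by simp
  qed
  moreover have "\<sigma> (to_ac e) = to_ac e" for e using s[of "[:e:]"] by simp
  ultimately have "\<sigma> \<in> galois_auts g" unfolding galois_auts_iff by simp
  then show "\<exists>\<sigma>\<in>galois_auts g. \<forall>p. \<sigma> (acpoly p (fst Q1)) = acpoly p (fst Q2)" using s by blast
qed

lemma fixed_field_square:
  assumes d: "\<delta> \<in> range to_ac" and x: "x \<in> SF" "\<And>\<sigma>. \<sigma> \<in> galois_auts g \<Longrightarrow> \<sigma> x = x"
  shows "x \<in> range to_ac"
proof -
  \<comment> \<open>With \<open>Q2\<close> and \<open>Q3\<close> exchanged, the same construction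
    yields the automorphism taking \<open>x1\<close> to \<open>x3\<close>. The exchange only changes
    the sign of \<delta>, which stays rational.\<close>
  interpret B: irreducible_cubic a b c d \<kappa> Q1 Q3 Q2 by (rule swap')
  have dB: "B.\<delta> \<in> range to_ac" using d subfield_uminus[OF subfield_range_to_ac] by (simp add: swap_delta)
  obtain p where p: "x = acpoly p (fst Q1)" "Polynomial.degree p < 3"
    using x(1) cyclic_automorphism(1)[OF d] F1_reduced by blast
  have "acpoly p (fst Q2) = x" using cyclic_automorphism(2)[OF d] x(2) p(1) by metis
  moreover have "acpoly p (fst Q3) = x" using B.cyclic_automorphism(2)[OF dB] x(2) p(1) by metis
  ultimately show ?thesis using const_value_rational[OF p(2)] p(1) by simp
qed

end

context cubic_roots
begin

text \<open>With a rational root the splitting field is K(\<delta>), so either it is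
  \<open>K\<close> or the conjugation over \<open>F = K\<close> settles the claim.\<close>

lemma fixed_field_rational_root:
  assumes Q1: "Q1 \<in> range to_ac \<times> range to_ac"
    and x: "x \<in> SF" "\<And>\<sigma>. \<sigma> \<in> galois_auts g \<Longrightarrow> \<sigma> x = x"
  shows "x \<in> range to_ac"
proof (cases "\<delta> \<in> range to_ac")
  case True
  then show ?thesis using SF_subset_of_root_delta[OF subfield_range_to_ac _ Q1] x(1) by blast
next
  case False
  have "range to_ac \<subseteq> SF" using to_ac_in_splitting_field by blast
  then show ?thesis using conjugation_exists[OF subfield_range_to_ac _ _ Q1 False] x by blast
qed

theorem fixed_field:
  assumes x: "x \<in> SF" "\<And>\<sigma>. \<sigma> \<in> galois_auts g \<Longrightarrow> \<sigma> x = x"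
  shows "x \<in> range to_ac"
proof (cases "rational_roots g = {}")
  case True
  then interpret irreducible_cubic a b c d \<kappa> Q1 Q2 Q3 by unfold_locales
  show ?thesis using fixed_field_square fixed_field_nonsquare x by blast
next
  case False
  then obtain P where P: "P \<in> rational_roots g" by blast
  then have "P \<in> pp ` {Q1, Q2, Q3}" using form_roots_eq by (auto simp: rational_roots_def)
  then obtain Q where PQ: "P = pp Q" and Q: "Q \<in> {Q1, Q2, Q3}" by (rule imageE)
  have R: "Q \<in> range to_ac \<times> range to_ac" using rational_roots_iff[OF Q] P PQ by blast
  interpret B: cubic_roots a b c d \<kappa> Q2 Q3 Q1 by (rule rotate)
  interpret C: cubic_roots a b c d \<kappa> Q3 Q1 Q2 by (rule B.rotate)
  consider "Q = Q1" | "Q = Q2" | "Q = Q3" using Q by blast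
  then show ?thesis
  proof cases
    case 1
    then show ?thesis using R x by (intro fixed_field_rational_root) simp_all
  next
    case 2
    then show ?thesis using R x by (intro B.fixed_field_rational_root) simp_all
  next
    case 3
    then show ?thesis using R x by (intro C.fixed_field_rational_root) simp_all
  qed
qed

end

section \<open>The action of the automorphisms on the roots\<close>

text \<open>The row vector \<open>v\<close> times \<open>M\<close>: applied to (X, Y) it is the
  substitution made in \<open>form_act\<close>. Rows act from the right, so products are
  reversed.\<close>

definition vact :: "'k::field^2^2 \<Rightarrow> 'k alg_closure \<times> 'k alg_closure \<Rightarrow> 'k alg_closure \<times> 'k alg_closure" where
  "vact M v = (fst v * to_ac (M $ 1 $ 1) + snd v * to_ac (M $ 2 $ 1),
               fst v * to_ac (M $ 1 $ 2) + snd v * to_ac (M $ 2 $ 2))"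

lemma dt_vact: "dt (vact M v) (vact M w) = to_ac (det M) * dt v w"
  by (simp add: dt_def vact_def det_2 algebra_simps)

lemma vact_mult: "vact (M ** N) v = vact N (vact M v)"
  by (simp add: vact_def matrix_matrix_mult_def sum_2 algebra_simps)

lemma vact_mat: "vact (mat k) v = (to_ac k * fst v, to_ac k * snd v)"
  by (simp add: vact_def mat_def mult.commute)

lemma vact_mat_1 [simp]: "vact (mat 1) v = v"
  by (simp add: vact_mat)

lemma det_mat_2: "det (mat k :: 'k::field^2^2) = k\<^sup>2"
  by (simp add: det_2 mat_def power2_eq_square)

lemma vact_0 [simp]: "vact M (0, 0) = (0, 0)"
  by (simp add: vact_def)

lemma vact_eqI:
  assumes "\<And>v. vact M v = vact N v"
  shows "M = N"
proof -
  have "M $ i $ j = N $ i $ j" for i j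
    using assms[of "(1, 0)"] assms[of "(0, 1)"] exhaust_2[of i] exhaust_2[of j] by (auto simp: vact_def)
  then show ?thesis by (simp add: vec_eq_iff)
qed

lemma carrier_GL2: "M \<in> carrier GL2 \<longleftrightarrow> invertible M"
  and mult_GL2: "M \<otimes>\<^bsub>GL2\<^esub> N = M ** N"
  and one_GL2: "\<one>\<^bsub>GL2\<^esub> = mat 1"
  by (simp_all add: GL2_def)

lemma group_GL2: "group (GL2 :: ('k::field^2^2) monoid)"
proof (rule groupI)
  fix M :: "'k^2^2" assume "M \<in> carrier GL2"
  then obtain N where "M ** N = mat 1" "N ** M = mat 1" by (auto simp: carrier_GL2 invertible_def)
  then show "\<exists>N\<in>carrier GL2. N \<otimes>\<^bsub>GL2\<^esub> M = \<one>\<^bsub>GL2\<^esub>"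
    by (intro bexI[of _ N]) (auto simp: carrier_GL2 mult_GL2 one_GL2 invertible_def)
next
  show "\<one>\<^bsub>GL2\<^esub> \<in> carrier (GL2 :: ('k^2^2) monoid)"
    by (auto simp: carrier_GL2 one_GL2 invertible_def intro!: exI[of _ "mat 1"])
qed (simp_all add: carrier_GL2 mult_GL2 one_GL2 invertible_mult matrix_mul_assoc)

context cubic
begin

text \<open>Four points suffice: (1, 0) and (0, 1) remove the outer coefficients, (1, 1) and (1, -1)
  then give \<open>2 * q = 0\<close>.\<close>

lemma form_zero_imp_coeffs_zero:
  fixes p q r s :: "'k alg_closure"
  assumes "\<And>x y. p * x ^ 3 + q * x ^ 2 * y + r * x * y ^ 2 + s * y ^ 3 = 0"
  shows "p = 0 \<and> q = 0 \<and> r = 0 \<and> s = 0"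
proof -
  have p: "p = 0" using assms[of 1 0] by simp
  have s: "s = 0" using assms[of 0 1] by simp
  have qr: "q + r = 0" "r - q = 0" using assms[of 1 1] assms[of 1 "-1"] p s by simp_all
  then have "r = q" by simp
  then have "2 * q = 0" using qr(1) unfolding mult_2 by simp
  then have "q = 0" using two_ac by simp
  then show ?thesis using p s qr by simp
qed

lemma gval_nonzero: "\<exists>v. gval v \<noteq> 0"
proof (rule ccontr)
  assume "\<not> ?thesis"
  then have "to_ac a * x ^ 3 + to_ac b * x ^ 2 * y + to_ac c * x * y ^ 2 + to_ac d * y ^ 3 = 0" for x y
    using gval_def[of "(x, y)"] by simp
  then have "a = 0 \<and> b = 0 \<and> c = 0 \<and> d = 0"
    using form_zero_imp_coeffs_zero[of "to_ac a" "to_ac b" "to_ac c" "to_ac d"] by simp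
  then show False using disc by (simp add: cubic_disc_def)
qed

lemma auts_iff: "M \<in> auts g \<longleftrightarrow> det M \<noteq> 0 \<and> (\<forall>v. gval (vact M v) = to_ac (det M) * gval v)"
proof (cases "det M = 0")
  case True
  then show ?thesis by (simp add: auts_def carrier_GL2 invertible_det_nz)
next
  case False
  define r s t u where "r = M $ 1 $ 1" and "s = M $ 1 $ 2" and "t = M $ 2 $ 1" and "u = M $ 2 $ 2"
  define A where "A = a * r ^ 3 + b * r\<^sup>2 * s + c * r * s\<^sup>2 + d * s ^ 3"
  define B where "B = 3 * a * r\<^sup>2 * t + b * (r\<^sup>2 * u + 2 * r * t * s) + c * (2 * r * s * u + t * s\<^sup>2) + 3 * d * s\<^sup>2 * u"
  define C where "C = 3 * a * r * t\<^sup>2 + b * (2 * r * t * u + t\<^sup>2 * s) + c * (r * u\<^sup>2 + 2 * t * s * u) + 3 * d * s * u\<^sup>2"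
  define D where "D = a * t ^ 3 + b * t\<^sup>2 * u + c * t * u\<^sup>2 + d * u ^ 3"
  have fa: "form_act g M = cubic_form (inverse (det M) * A) (inverse (det M) * B) (inverse (det M) * C) (inverse (det M) * D)"
    unfolding form_act_cubic_form A_def B_def C_def D_def r_def s_def t_def u_def ..
  have inv: "inverse (det M) * y = x \<longleftrightarrow> y = det M * x" for x y using False by (auto simp: field_simps)
  have gv: "gval (vact M (x, y)) = to_ac A * x ^ 3 + to_ac B * x\<^sup>2 * y + to_ac C * x * y\<^sup>2 + to_ac D * y ^ 3" for x y
    unfolding gval_def vact_def A_def B_def C_def D_def r_def[symmetric] s_def[symmetric] t_def[symmetric] u_def[symmetric]
    by (simp add: algebra_simps power2_eq_square power3_eq_cube)
  have eq: "gval (vact M (x, y)) - to_ac (det M) * gval (x, y) =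
     to_ac (A - det M * a) * x ^ 3 + to_ac (B - det M * b) * x\<^sup>2 * y
     + to_ac (C - det M * c) * x * y\<^sup>2 + to_ac (D - det M * d) * y ^ 3" for x y
    unfolding gv by (simp add: gval_def algebra_simps)
  have "(\<forall>v. gval (vact M v) = to_ac (det M) * gval v) \<longleftrightarrow>
      A = det M * a \<and> B = det M * b \<and> C = det M * c \<and> D = det M * d" (is "?L \<longleftrightarrow> ?R")
  proof
    assume ?L
    then have "to_ac (A - det M * a) * x ^ 3 + to_ac (B - det M * b) * x\<^sup>2 * y
     + to_ac (C - det M * c) * x * y\<^sup>2 + to_ac (D - det M * d) * y ^ 3 = 0" for x y
      unfolding eq[symmetric] by simp
    from form_zero_imp_coeffs_zero[OF this] show ?R by (simp only: to_ac_eq_0_iff right_minus_eq)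
  next
    assume R: ?R
    have "gval (vact M (x, y)) - to_ac (det M) * gval (x, y) = 0" for x y
      unfolding eq using R by simp
    then show ?L by simp
  qed
  then show ?thesis using False by (simp add: auts_def carrier_GL2 invertible_det_nz fa inv)
qed

lemma auts_det: "M \<in> auts g \<Longrightarrow> det M \<noteq> 0"
  and auts_gval: "M \<in> auts g \<Longrightarrow> gval (vact M v) = to_ac (det M) * gval v"
  unfolding auts_iff by blast+

text \<open>Comparing the values at a point where \<open>g\<close> does not vanish gives k^3 = k^2
  with k nonzero.\<close>

lemma mat_in_auts_iff: "mat k \<in> auts g \<longleftrightarrow> k = 1"
proof
  assume k: "mat k \<in> auts g"
  have k0: "k \<noteq> 0" using auts_det[OF k] by (simp only: det_mat_2) auto
  have *: "gval (vact (mat k) v) = to_ac (k\<^sup>2) * gval v" for v using auts_gval[OF k] by (simp only: det_mat_2)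
  obtain v where v: "gval v \<noteq> 0" using gval_nonzero by blast
  have "to_ac k ^ 3 * gval v = to_ac k ^ 2 * gval v"
    using *[of v] gval_scale[of "to_ac k" "fst v" "snd v"] by (simp add: vact_mat)
  then have "to_ac k = 1" using v k0 by (simp add: power2_eq_square power3_eq_cube)
  then show "k = 1" by (metis to_ac_1 to_ac_eq_iff)
qed (simp add: auts_iff det_mat_2)

lemma auts_scalars: "auts g \<inter> scalars2 = {mat 1}"
  using mat_in_auts_iff by (auto simp: scalars2_def)

lemma subgroup_auts: "subgroup (auts g) GL2"
proof -
  interpret GL2: group "GL2 :: ('k^2^2) monoid" by (rule group_GL2)
  have inv: "invertible M" if "M \<in> auts g" for M using that by (simp add: auts_def carrier_GL2)
  show ?thesis
  proof (rule GL2.subgroupI)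
    show "auts g \<subseteq> carrier GL2" by (auto simp: auts_def)
    show "auts g \<noteq> {}" using mat_in_auts_iff by blast
    fix M assume M: "M \<in> auts g"
    define N where "N = inv\<^bsub>GL2\<^esub> M"
    have N: "M ** N = mat 1" "N ** M = mat 1" "invertible N"
      using GL2.r_inv[of M] GL2.l_inv[of M] GL2.inv_closed[of M] inv[OF M] by (simp_all add: N_def carrier_GL2 mult_GL2 one_GL2)
    have dets: "det N * det M = 1" using N(2) det_mul[of N M] by simp
    have "gval (vact N v) = to_ac (det N) * gval v" for v
    proof -
      have "gval v = to_ac (det M) * gval (vact N v)"
        using auts_gval[OF M, of "vact N v"] vact_mult[of N M v] N(2) by simp
      then have "to_ac (det N) * gval v = to_ac (det N * det M) * gval (vact N v)" by simp
      then show ?thesis unfolding dets by simp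
    qed
    then show "inv\<^bsub>GL2\<^esub> M \<in> auts g" using N(3) by (simp add: auts_iff invertible_det_nz flip: N_def)
    fix M' assume M': "M' \<in> auts g"
    show "M \<otimes>\<^bsub>GL2\<^esub> M' \<in> auts g"
      unfolding auts_iff mult_GL2 det_mul vact_mult
      using auts_det[OF M] auts_det[OF M'] by (simp add: auts_gval[OF M] auts_gval[OF M'])
  qed
qed

lemma group_aut_group: "group (aut_group g)"
  unfolding aut_group_def by (rule group.subgroup_imp_group[OF group_GL2 subgroup_auts])

text \<open>Since row vectors multiply matrices from the right, images of points would give an
  antihomomorphism; preimages restore the order of products. Restriction to the roots makes the map
  extensional, as \<open>Bij\<close> requires.\<close>

definition \<Phi> :: "'k^2^2 \<Rightarrow> ('k alg_closure \<times> 'k alg_closure) set \<Rightarrow> ('k alg_closure \<times> 'k alg_closure) set" where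
  "\<Phi> M = (\<lambda>P\<in>form_roots g. {v. vact M v \<in> P})"

lemma vact_inverse:
  assumes "M \<in> auts g"
  obtains N where "N \<in> auts g" "\<And>v. vact M (vact N v) = v" "\<And>v. vact N (vact M v) = v"
proof -
  interpret GL2: group "GL2 :: ('k^2^2) monoid" by (rule group_GL2)
  have "M \<in> carrier GL2" using assms by (simp add: auts_def)
  then have "M ** inv\<^bsub>GL2\<^esub> M = mat 1" "inv\<^bsub>GL2\<^esub> M ** M = mat 1"
    using GL2.r_inv[of M] GL2.l_inv[of M] by (simp_all add: mult_GL2 one_GL2)
  then show ?thesis
    using that[of "inv\<^bsub>GL2\<^esub> M"] subgroup.m_inv_closed[OF subgroup_auts assms]
      vact_mult[of M "inv\<^bsub>GL2\<^esub> M"] vact_mult[of "inv\<^bsub>GL2\<^esub> M" M] by simp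
qed

lemma vact_eq_0_iff:
  assumes "M \<in> auts g"
  shows "vact M v = (0, 0) \<longleftrightarrow> v = (0, 0)"
  using vact_inverse[OF assms] vact_0 by metis

lemma preimage_pp:
  assumes M: "M \<in> auts g" and w: "w \<noteq> (0, 0)"
  shows "{v. vact M v \<in> pp (vact M w)} = pp w"
proof -
  have "vact M w \<noteq> (0, 0)" using vact_eq_0_iff[OF M] w by simp
  moreover have "to_ac (det M) \<noteq> 0" using M by (simp add: auts_iff)
  ultimately show ?thesis
    using mem_pp_iff[of "vact M w"] mem_pp_iff[OF w] by (auto simp: vact_eq_0_iff[OF M] dt_vact)
qed

lemma \<Phi>_pp:
  assumes M: "M \<in> auts g" and w: "w \<noteq> (0, 0)" "gval w = 0"
  shows "\<Phi> M (pp (vact M w)) = pp w" "pp (vact M w) \<in> form_roots g" "pp w \<in> form_roots g"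
proof -
  have "gval (vact M w) = 0" using auts_gval[OF M] w by simp
  then show r: "pp (vact M w) \<in> form_roots g" using form_roots_iff vact_eq_0_iff[OF M] w by simp
  show "pp w \<in> form_roots g" using form_roots_iff w by simp
  show "\<Phi> M (pp (vact M w)) = pp w" unfolding \<Phi>_def using r preimage_pp[OF M w(1)] by simp
qed

lemma root_as_image:
  assumes M: "M \<in> auts g" and P: "P \<in> form_roots g"
  obtains w where "w \<noteq> (0, 0)" "gval w = 0" "P = pp (vact M w)"
proof -
  obtain N where N: "N \<in> auts g" "\<And>v. vact M (vact N v) = v" using vact_inverse[OF M] by blast
  have "P \<in> proj_line" using P by (simp add: form_roots_def)
  then obtain v where v: "normal_vec v" "P = pp v" by (rule proj_line_normal)
  have "gval v = 0" using P v form_roots_iff[OF normal_vec_nonzero] by blast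
  then have "gval (vact N v) = 0" using auts_gval[OF N(1)] by simp
  moreover have "vact N v \<noteq> (0, 0)" using vact_eq_0_iff[OF N(1)] normal_vec_nonzero[OF v(1)] by simp
  ultimately show ?thesis using that N(2) v(2) by metis
qed

lemma \<Phi>_in_form_roots:
  assumes "M \<in> auts g" "P \<in> form_roots g"
  shows "\<Phi> M P \<in> form_roots g"
  using root_as_image[OF assms] \<Phi>_pp[OF assms(1)] by metis

lemma \<Phi>_mult:
  assumes "M \<in> auts g" "N \<in> auts g" "P \<in> form_roots g"
  shows "\<Phi> (M ** N) P = \<Phi> M (\<Phi> N P)"
  using \<Phi>_in_form_roots[OF assms(2,3)] assms(3) by (simp add: \<Phi>_def vact_mult)

lemma \<Phi>_one: "P \<in> form_roots g \<Longrightarrow> \<Phi> (mat 1) P = P"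
  by (simp add: \<Phi>_def)

lemma \<Phi>_Bij:
  assumes M: "M \<in> auts g"
  shows "\<Phi> M \<in> Bij (form_roots g)"
proof -
  obtain N where N: "N \<in> auts g" "\<And>v. vact M (vact N v) = v" "\<And>v. vact N (vact M v) = v"
    using vact_inverse[OF M] by blast
  have "M ** N = mat 1" "N ** M = mat 1"
    by (rule vact_eqI; simp add: vact_mult N)+
  then have "\<Phi> M (\<Phi> N P) = P" "\<Phi> N (\<Phi> M P) = P" if "P \<in> form_roots g" for P
    using that \<Phi>_mult[OF M N(1)] \<Phi>_mult[OF N(1) M] \<Phi>_one by metis+
  then have "bij_betw (\<Phi> M) (form_roots g) (form_roots g)"
    using \<Phi>_in_form_roots M N(1) by (intro bij_betw_byWitness[where f' = "\<Phi> N"]) auto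
  then show ?thesis by (simp add: Bij_def \<Phi>_def)
qed

end

section \<open>Determinant, sign and faithfulness of the action on the roots\<close>

definition scal :: "'a::comm_ring \<Rightarrow> 'a \<times> 'a \<Rightarrow> 'a \<times> 'a" where
  "scal k v = (k * fst v, k * snd v)"

lemma dt_scal [simp]: "dt (scal k v) w = k * dt v w" "dt v (scal k w) = k * dt v w"
  by (simp_all add: dt_def scal_def algebra_simps)

context cubic_roots
begin

definition D :: "'k alg_closure" where "D = dt Q1 Q2 * dt Q2 Q3 * dt Q3 Q1"

lemma delta_D: "\<delta> = (to_ac \<kappa>)\<^sup>2 * D"
  by (simp add: \<delta>_def D_def mult.assoc)

lemma D_nz: "D \<noteq> 0"
  using dt_nz by (simp add: D_def)

lemma enum_set_cases:
  assumes "{A, B, C} = {Q1, Q2, Q3}"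
  shows "(A, B, C) \<in> {(Q1, Q2, Q3), (Q2, Q3, Q1), (Q3, Q1, Q2), (Q1, Q3, Q2), (Q2, Q1, Q3), (Q3, Q2, Q1)}"
proof -
  have "card {A, B, C} = 3" using assms distinct by (simp add: card_insert_if)
  then have "A \<noteq> B" "B \<noteq> C" "C \<noteq> A" by (auto simp: card_insert_if split: if_splits)
  moreover have "A \<in> {Q1, Q2, Q3}" "B \<in> {Q1, Q2, Q3}" "C \<in> {Q1, Q2, Q3}" using assms by blast+
  ultimately show ?thesis by auto
qed

lemma enum_perm:
  assumes "{R1, R2, R3} = {Q1, Q2, Q3}"
  shows "cubic_roots a b c d \<kappa> R1 R2 R3"
proof -
  interpret B: cubic_roots a b c d \<kappa> Q2 Q3 Q1 by (rule rotate)
  interpret C: cubic_roots a b c d \<kappa> Q3 Q1 Q2 by (rule B.rotate)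
  show ?thesis
    using enum_set_cases[OF assms] cubic_roots_axioms B.cubic_roots_axioms C.cubic_roots_axioms swap B.swap C.swap by auto
qed

text \<open>The cyclic product of brackets is alternating in its arguments. Since \<open>D\<close>
  and \<open>- D\<close> differ, its value tells even orderings of the roots from odd ones.\<close>

lemma enum_D:
  assumes "{R1, R2, R3} = {Q1, Q2, Q3}"
  shows "dt R1 R2 * dt R2 R3 * dt R3 R1 = D \<longleftrightarrow> (R1, R2, R3) \<in> {(Q1, Q2, Q3), (Q2, Q3, Q1), (Q3, Q1, Q2)}"
    and "(dt R1 R2 * dt R2 R3 * dt R3 R1)\<^sup>2 = D\<^sup>2"
proof -
  consider "(R1, R2, R3) \<in> {(Q1, Q2, Q3), (Q2, Q3, Q1), (Q3, Q1, Q2)}"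
    | "(R1, R2, R3) \<in> {(Q1, Q3, Q2), (Q2, Q1, Q3), (Q3, Q2, Q1)}" using enum_set_cases[OF assms] by auto
  then have "(dt R1 R2 * dt R2 R3 * dt R3 R1 = D \<longleftrightarrow> (R1, R2, R3) \<in> {(Q1, Q2, Q3), (Q2, Q3, Q1), (Q3, Q1, Q2)}) \<and>
    (dt R1 R2 * dt R2 R3 * dt R3 R1)\<^sup>2 = D\<^sup>2"
  proof cases
    case 1
    then have "dt R1 R2 * dt R2 R3 * dt R3 R1 = D" by (auto simp: D_def algebra_simps)
    then show ?thesis using 1 by simp
  next
    case 2
    then have "dt R1 R2 * dt R2 R3 * dt R3 R1 = - D"
      using dt_swap[of Q1 Q3] dt_swap[of Q3 Q2] dt_swap[of Q2 Q1] by (auto simp: D_def algebra_simps)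
    moreover have "- D \<noteq> D"
    proof
      assume "- D = D"
      then have "2 * D = 0" unfolding mult_2 by (metis add.right_inverse)
      then show False using D_nz two_ac by simp
    qed
    moreover have "(R1, R2, R3) \<notin> {(Q1, Q2, Q3), (Q2, Q3, Q1), (Q3, Q1, Q2)}" using 2 distinct by auto
    ultimately show ?thesis by simp
  qed
  then show "dt R1 R2 * dt R2 R3 * dt R3 R1 = D \<longleftrightarrow> (R1, R2, R3) \<in> {(Q1, Q2, Q3), (Q2, Q3, Q1), (Q3, Q1, Q2)}"
    "(dt R1 R2 * dt R2 R3 * dt R3 R1)\<^sup>2 = D\<^sup>2" by blast+
qed

lemma root_vector_cases:
  assumes "P \<in> form_roots g"
  obtains Q where "Q \<in> {Q1, Q2, Q3}" "P = pp Q" "Q \<noteq> (0, 0)" "gval Q = 0"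
proof -
  have "P \<in> pp ` {Q1, Q2, Q3}" using assms form_roots_eq by simp
  then obtain Q where "P = pp Q" and Q: "Q \<in> {Q1, Q2, Q3}" by (rule imageE)
  moreover have n: "normal_vec Q" using Q normal by auto
  moreover have "gval Q = 0" using gval_normal_iff[OF n] Q by simp
  ultimately show ?thesis using that normal_vec_nonzero by blast
qed

lemma root_vector:
  assumes "Q \<in> {Q1, Q2, Q3}"
  shows "normal_vec Q" "Q \<noteq> (0, 0)" "gval Q = 0" "pp Q \<in> form_roots g"
proof -
  show n: "normal_vec Q" using assms normal by auto
  then show "Q \<noteq> (0, 0)" by (rule normal_vec_nonzero)
  show "gval Q = 0" using gval_normal_iff[OF n] assms by simp
  show "pp Q \<in> form_roots g" using assms form_roots_eq by auto
qed

lemma pp_eq_iff_roots: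
  assumes "Q \<in> {Q1, Q2, Q3}" "R \<in> {Q1, Q2, Q3}"
  shows "pp Q = pp R \<longleftrightarrow> Q = R"
  using assms root_vector(1) pp_normal_eq_iff by blast

lemma \<Phi>_root_image:
  assumes M: "M \<in> auts g" and Q: "Q \<in> {Q1, Q2, Q3}"
  obtains R l where "R \<in> {Q1, Q2, Q3}" "vact M Q = scal l R" "\<Phi> M (pp R) = pp Q"
proof -
  have r: "pp (vact M Q) \<in> form_roots g" "\<Phi> M (pp (vact M Q)) = pp Q"
    using \<Phi>_pp[OF M] root_vector[OF Q] by auto
  obtain R where R: "R \<in> {Q1, Q2, Q3}" "pp (vact M Q) = pp R" using root_vector_cases[OF r(1)] by metis
  have "vact M Q \<in> pp R" using mem_proj_point[of "fst (vact M Q)" "snd (vact M Q)"] R(2) by simp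
  then obtain l where "vact M Q = scal l R" unfolding proj_point_def scal_def by blast
  then show ?thesis using that R r(2) by metis
qed

text \<open>
  Writing \<open>Q\<^sub>i M = \<lambda>\<^sub>i R\<^sub>i\<close>, comparison of \<open>g(vM) = det(M) g(v)\<close> with the factorisation gives
  \<open>\<lambda>\<^sub>1 \<lambda>\<^sub>2 \<lambda>\<^sub>3 = det(M)\<^sup>2\<close>, while \<open>\<lambda>\<^sub>i \<lambda>\<^sub>j [R\<^sub>i, R\<^sub>j] = det(M) [Q\<^sub>i, Q\<^sub>j]\<close>.
\<close>

lemma det_times_D:
  assumes M: "M \<in> auts g" and R: "{R1, R2, R3} = {Q1, Q2, Q3}"
    and l: "vact M Q1 = scal l1 R1" "vact M Q2 = scal l2 R2" "vact M Q3 = scal l3 R3"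
  shows "to_ac (det M) * (dt R1 R2 * dt R2 R3 * dt R3 R1) = D"
proof -
  interpret R: cubic_roots a b c d \<kappa> R1 R2 R3 by (rule enum_perm[OF R])
  define m where "m = to_ac (det M)"
  have m0: "m \<noteq> 0" using auts_det[OF M] by (simp add: m_def)
  obtain v where v: "gval v \<noteq> 0" using gval_nonzero by blast
  have e: "l1 * dt R1 (vact M v) = m * dt Q1 v" "l2 * dt R2 (vact M v) = m * dt Q2 v"
     "l3 * dt R3 (vact M v) = m * dt Q3 v"
    using dt_vact[of M _ v] l unfolding m_def by (metis dt_scal(1))+
  have "l1 * l2 * l3 * gval (vact M v) =
      to_ac \<kappa> * (l1 * dt R1 (vact M v)) * (l2 * dt R2 (vact M v)) * (l3 * dt R3 (vact M v))"
    unfolding R.gval_factor by (simp add: algebra_simps)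
  also have "\<dots> = m ^ 3 * gval v" unfolding e gval_factor by (simp add: algebra_simps power3_eq_cube)
  finally have "(l1 * l2 * l3) * (m * gval v) = m ^ 3 * gval v" using auts_gval[OF M] by (simp add: m_def)
  then have ll: "l1 * l2 * l3 = m\<^sup>2" using v m0 by (simp add: power2_eq_square power3_eq_cube mult.assoc)
  have f: "l1 * l2 * dt R1 R2 = m * dt Q1 Q2" "l2 * l3 * dt R2 R3 = m * dt Q2 Q3" "l3 * l1 * dt R3 R1 = m * dt Q3 Q1"
    using dt_vact[of M Q1 Q2] dt_vact[of M Q2 Q3] dt_vact[of M Q3 Q1] l unfolding m_def
    by (simp_all add: mult.assoc mult.left_commute)
  \<comment> \<open>Multiplying the three bracket relations brings in the square of
    \<open>l1 * l2 * l3\<close>, that is m^4, against m^3 on the right; one factor m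
    survives.\<close>
  have "(l1 * l2 * l3)\<^sup>2 * (dt R1 R2 * dt R2 R3 * dt R3 R1) =
     (l1 * l2 * dt R1 R2) * (l2 * l3 * dt R2 R3) * (l3 * l1 * dt R3 R1)"
    by (simp add: power2_eq_square algebra_simps)
  also have "\<dots> = m ^ 3 * D" unfolding f by (simp add: D_def power3_eq_cube algebra_simps)
  finally show ?thesis unfolding ll m_def[symmetric] using m0 by (simp add: power2_eq_square power3_eq_cube mult.assoc)
qed

lemma \<Phi>_enum:
  assumes M: "M \<in> auts g"
  obtains R1 R2 R3 where "{R1, R2, R3} = {Q1, Q2, Q3}" "\<Phi> M (pp R1) = pp Q1" "\<Phi> M (pp R2) = pp Q2"
    "\<Phi> M (pp R3) = pp Q3" "to_ac (det M) * (dt R1 R2 * dt R2 R3 * dt R3 R1) = D"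
proof -
  obtain R1 l1 where 1: "R1 \<in> {Q1, Q2, Q3}" "vact M Q1 = scal l1 R1" "\<Phi> M (pp R1) = pp Q1"
    using \<Phi>_root_image[OF M, of Q1] by auto
  obtain R2 l2 where 2: "R2 \<in> {Q1, Q2, Q3}" "vact M Q2 = scal l2 R2" "\<Phi> M (pp R2) = pp Q2"
    using \<Phi>_root_image[OF M, of Q2] by auto
  obtain R3 l3 where 3: "R3 \<in> {Q1, Q2, Q3}" "vact M Q3 = scal l3 R3" "\<Phi> M (pp R3) = pp Q3"
    using \<Phi>_root_image[OF M, of Q3] by auto
  have "R1 \<noteq> R2" "R2 \<noteq> R3" "R3 \<noteq> R1" using 1(3) 2(3) 3(3) pp_distinct by auto
  then have R: "{R1, R2, R3} = {Q1, Q2, Q3}" using 1(1) 2(1) 3(1) distinct by auto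
  show ?thesis by (rule that[OF R 1(3) 2(3) 3(3) det_times_D[OF M R 1(2) 2(2) 3(2)]])
qed

text \<open>If all roots are fixed, the multipliers satisfy
  \<open>l1 * l2 = l2 * l3 = l3 * l1 = det M\<close>, hence are equal, and
  \<open>det_times_D\<close> gives \<open>det M = 1\<close>. So \<open>M\<close> is a scalar of
  square 1, and invariance of \<open>g\<close> makes its cube 1 too.\<close>

lemma \<Phi>_inj:
  assumes M: "M \<in> auts g" and id: "\<And>P. P \<in> form_roots g \<Longrightarrow> \<Phi> M P = P"
  shows "M = mat 1"
proof -
  have "\<exists>l. vact M Q = scal l Q" if Q: "Q \<in> {Q1, Q2, Q3}" for Q
  proof -
    obtain R l where R: "R \<in> {Q1, Q2, Q3}" "vact M Q = scal l R" "\<Phi> M (pp R) = pp Q"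
      using \<Phi>_root_image[OF M Q] by blast
    then have "pp R = pp Q" using id root_vector(4) by metis
    then show ?thesis using R Q pp_eq_iff_roots by metis
  qed
  then obtain l1 l2 l3 where l: "vact M Q1 = scal l1 Q1" "vact M Q2 = scal l2 Q2" "vact M Q3 = scal l3 Q3"
    by (metis insertCI)
  define m where "m = to_ac (det M)"
  have m0: "m \<noteq> 0" using auts_det[OF M] by (simp add: m_def)
  have "l1 * l2 * dt Q1 Q2 = m * dt Q1 Q2" "l2 * l3 * dt Q2 Q3 = m * dt Q2 Q3" "l3 * l1 * dt Q3 Q1 = m * dt Q3 Q1"
    using dt_vact[of M Q1 Q2] dt_vact[of M Q2 Q3] dt_vact[of M Q3 Q1] l unfolding m_def
    by (simp_all add: mult.assoc mult.left_commute)
  then have f: "l1 * l2 = m" "l2 * l3 = m" "l3 * l1 = m" using dt_nz by auto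
  have "m * D = D" using det_times_D[OF M refl l] by (simp add: m_def D_def)
  then have m1: "m = 1" using D_nz by simp
  have "l1 = l3" using f m0 by (metis mult.commute mult_cancel_left mult_zero_left)
  moreover have "l2 = l1" using f m0 by (metis mult.commute mult_cancel_left mult_zero_left)
  ultimately have l1: "l1 * l1 = 1" "l2 = l1" "l3 = l1" using f m1 by auto
  have sc: "vact M v = scal l1 v" for v
  proof -
    have "dt Q1 (vact M v) * l1 = dt (scal l1 Q1) (vact M v)" by simp
    also have "\<dots> = m * dt Q1 v" using dt_vact[of M Q1 v] l by (simp add: m_def)
    finally have 1: "dt Q1 (vact M v) = l1 * dt Q1 v" using l1 m1 by (metis mult.commute mult.left_commute mult_1)
    have "dt Q2 (vact M v) * l1 = dt (scal l1 Q2) (vact M v)" by simp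
    also have "\<dots> = m * dt Q2 v" using dt_vact[of M Q2 v] l l1 by (simp add: m_def)
    finally have 2: "dt Q2 (vact M v) = l1 * dt Q2 v" using l1 m1 by (metis mult.commute mult.left_commute mult_1)
    \<comment> \<open>A vector is recovered from its brackets with the independent vectors
      \<open>Q1\<close> and \<open>Q2\<close>, so it is enough to know those brackets.\<close>
    have cramer: "dt Q1 Q2 * fst w = dt Q1 w * fst Q2 - dt Q2 w * fst Q1"
      "dt Q1 Q2 * snd w = dt Q1 w * snd Q2 - dt Q2 w * snd Q1" for w
      by (simp_all add: dt_def algebra_simps)
    have "dt Q1 Q2 * fst (vact M v) = l1 * (dt Q1 Q2 * fst v)" "dt Q1 Q2 * snd (vact M v) = l1 * (dt Q1 Q2 * snd v)"
      unfolding cramer 1 2 by (simp_all add: algebra_simps)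
    then show ?thesis using dt_nz(1) by (simp add: scal_def prod_eq_iff)
  qed
  obtain v where v: "gval v \<noteq> 0" using gval_nonzero by blast
  have "l1 ^ 3 * gval v = gval v" using auts_gval[OF M, of v] m1 gval_scale[of l1 "fst v" "snd v"]
    unfolding sc scal_def m_def by simp
  then have "l1 = 1" using v l1(1) by (simp add: power3_eq_cube)
  then have "vact M v = vact (mat 1) v" for v by (simp add: sc scal_def)
  then show ?thesis by (rule vact_eqI)
qed

end

text \<open>The analogue of \<open>vact\<close> for a matrix with rows \<open>r1\<close> and
  \<open>r2\<close> whose entries need not lie in \<open>K\<close>. The matrix inducing a
  permutation is first found over the splitting field and only later shown to be rational.\<close>

definition rowmult :: "'a::comm_ring \<times> 'a \<Rightarrow> 'a \<times> 'a \<Rightarrow> 'a \<times> 'a \<Rightarrow> 'a \<times> 'a" where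
  "rowmult v r1 r2 = (fst v * fst r1 + snd v * fst r2, fst v * snd r1 + snd v * snd r2)"

lemma rowmult_unique:
  fixes u1 u2 :: "'a::field \<times> 'a"
  assumes "dt u1 u2 \<noteq> 0" "rowmult u1 r1 r2 = rowmult u1 s1 s2" "rowmult u2 r1 r2 = rowmult u2 s1 s2"
  shows "r1 = s1 \<and> r2 = s2"
proof -
  have lin: "x = x' \<and> y = y'"
    if "fst u1 * x + snd u1 * y = fst u1 * x' + snd u1 * y'" "fst u2 * x + snd u2 * y = fst u2 * x' + snd u2 * y'" for x x' y y'
  proof -
    have "dt u1 u2 * x = snd u2 * (fst u1 * x + snd u1 * y) - snd u1 * (fst u2 * x + snd u2 * y)"
      "dt u1 u2 * y = fst u1 * (fst u2 * x + snd u2 * y) - fst u2 * (fst u1 * x + snd u1 * y)"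
      by (simp_all add: dt_def algebra_simps)
    then have "dt u1 u2 * x = dt u1 u2 * x'" "dt u1 u2 * y = dt u1 u2 * y'"
      unfolding that by (simp_all add: dt_def algebra_simps)
    then show ?thesis using assms(1) by simp
  qed
  have "fst r1 = fst s1 \<and> fst r2 = fst s2" "snd r1 = snd s1 \<and> snd r2 = snd s2"
    by (rule lin; use assms(2,3) in \<open>simp add: rowmult_def\<close>)+
  then show ?thesis by (simp add: prod_eq_iff)
qed

lemma rowmult_exists:
  fixes u1 u2 :: "'a::field \<times> 'a"
  assumes F: "subfield F ring_of_type_algebra" and nz: "dt u1 u2 \<noteq> 0"
    and mem: "u1 \<in> F \<times> F" "u2 \<in> F \<times> F" "v1 \<in> F \<times> F" "v2 \<in> F \<times> F"
  obtains r1 r2 where "r1 \<in> F \<times> F" "r2 \<in> F \<times> F" "rowmult u1 r1 r2 = v1" "rowmult u2 r1 r2 = v2"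
proof -
  note Fc = subfield_closed[OF F]
  define r1 where "r1 = ((snd u2 * fst v1 - snd u1 * fst v2) / dt u1 u2, (snd u2 * snd v1 - snd u1 * snd v2) / dt u1 u2)"
  define r2 where "r2 = ((fst u1 * fst v2 - fst u2 * fst v1) / dt u1 u2, (fst u1 * snd v2 - fst u2 * snd v1) / dt u1 u2)"
  have m: "fst u1 \<in> F" "snd u1 \<in> F" "fst u2 \<in> F" "snd u2 \<in> F" "fst v1 \<in> F" "snd v1 \<in> F" "fst v2 \<in> F" "snd v2 \<in> F"
    using mem by auto
  have "dt u1 u2 \<in> F" using Fc mem by simp
  then have "r1 \<in> F \<times> F" "r2 \<in> F \<times> F" using m Fc by (simp_all add: r1_def r2_def)
  moreover have "rowmult u1 r1 r2 = v1" "rowmult u2 r1 r2 = v2"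
  proof -
    have "dt u1 u2 * fst (rowmult u1 r1 r2) = dt u1 u2 * fst v1" "dt u1 u2 * snd (rowmult u1 r1 r2) = dt u1 u2 * snd v1"
      "dt u1 u2 * fst (rowmult u2 r1 r2) = dt u1 u2 * fst v2" "dt u1 u2 * snd (rowmult u2 r1 r2) = dt u1 u2 * snd v2"
      using nz by (simp_all add: rowmult_def r1_def r2_def distrib_left) (simp_all add: dt_def algebra_simps)
    then show "rowmult u1 r1 r2 = v1" "rowmult u2 r1 r2 = v2" using nz by (simp_all add: prod_eq_iff)
  qed
  ultimately show ?thesis by (rule that)
qed

text \<open>
  The coefficients are those of the linear relation between three plane vectors, multiplied by
  \<open>[A,B] [B,C] [C,A]\<close> in order to make \<open>pv A B C\<close> symmetric in \<open>B\<close> and \<open>C\<close>. A permutation of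
  the three vectors \<open>pv\<close>, whose sum is zero, is therefore induced by a linear map.
\<close>

definition pv :: "'a::comm_ring_1 \<times> 'a \<Rightarrow> 'a \<times> 'a \<Rightarrow> 'a \<times> 'a \<Rightarrow> 'a \<times> 'a" where
  "pv A B C = scal (dt A B * dt A C * (dt B C)\<^sup>2) A"

lemma pv_swap: "pv A C B = pv A B C"
  using dt_swap[of C B] by (simp add: pv_def algebra_simps)

lemma pv_sum:
  "fst (pv A B C) + fst (pv B C A) + fst (pv C A B) = 0"
  "snd (pv A B C) + snd (pv B C A) + snd (pv C A B) = 0"
  by (simp_all add: pv_def scal_def dt_def algebra_simps power2_eq_square)

text \<open>Nonzero for distinct roots, so two of the three vectors form a basis. It also reads off
  the determinant of a linear map that carries one such triple to another.\<close>

lemma dt_pv: "dt (pv A B C) (pv B C A) = (dt A B * dt B C * dt C A) ^ 3"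
  using dt_swap[of A C] dt_swap[of B A]
  by (simp add: pv_def power3_eq_cube power2_eq_square algebra_simps)

lemma rowmult_pv_third:
  assumes "rowmult (pv A B C) r1 r2 = pv A' B' C'" "rowmult (pv B C A) r1 r2 = pv B' C' A'"
  shows "rowmult (pv C A B) r1 r2 = pv C' A' B'"
proof -
  have e: "fst (pv C A B) = - fst (pv A B C) - fst (pv B C A)" "snd (pv C A B) = - snd (pv A B C) - snd (pv B C A)"
    using pv_sum[of A B C] by (simp_all add: algebra_simps eq_neg_iff_add_eq_0)
  have e': "fst (pv C' A' B') = - fst (pv A' B' C') - fst (pv B' C' A')" "snd (pv C' A' B') = - snd (pv A' B' C') - snd (pv B' C' A')"
    using pv_sum[of A' B' C'] by (simp_all add: algebra_simps eq_neg_iff_add_eq_0)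
  show ?thesis unfolding prod_eq_iff e' assms[symmetric] by (simp add: rowmult_def e algebra_simps)
qed

context galois_aut
begin

lemma scal: "k \<in> splitting_field g \<Longrightarrow> v \<in> splitting_field g \<times> splitting_field g \<Longrightarrow>
    map_prod \<sigma> \<sigma> (scal k v) = scal (\<sigma> k) (map_prod \<sigma> \<sigma> v)"
  by (cases v) (auto simp: scal_def mult)

lemma rowmult: "v \<in> splitting_field g \<times> splitting_field g \<Longrightarrow> r1 \<in> splitting_field g \<times> splitting_field g \<Longrightarrow>
    r2 \<in> splitting_field g \<times> splitting_field g \<Longrightarrow>
    map_prod \<sigma> \<sigma> (rowmult v r1 r2) = rowmult (map_prod \<sigma> \<sigma> v) (map_prod \<sigma> \<sigma> r1) (map_prod \<sigma> \<sigma> r2)"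
  by (cases v; cases r1; cases r2) (auto simp: rowmult_def mult add SF)

lemma pv:
  assumes "A \<in> splitting_field g \<times> splitting_field g" "B \<in> splitting_field g \<times> splitting_field g"
    "C \<in> splitting_field g \<times> splitting_field g"
  shows "map_prod \<sigma> \<sigma> (pv A B C) = pv (map_prod \<sigma> \<sigma> A) (map_prod \<sigma> \<sigma> B) (map_prod \<sigma> \<sigma> C)"
  unfolding pv_def using assms by (simp add: scal mult power dt SF)

end

lemma pv_closed:
  fixes A B C :: "'a::field \<times> 'a"
  assumes "subfield F ring_of_type_algebra" "A \<in> F \<times> F" "B \<in> F \<times> F" "C \<in> F \<times> F"
  shows "pv A B C \<in> F \<times> F"
  using assms subfield_closed[OF assms(1)] by (cases A) (auto simp: pv_def scal_def)

lemma mult_BijGroup: "f \<in> Bij S \<Longrightarrow> f' \<in> Bij S \<Longrightarrow> f \<otimes>\<^bsub>BijGroup S\<^esub> f' = compose S f f'"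
  by (simp add: BijGroup_def)

lemma carrier_BijGroup: "carrier (BijGroup S) = Bij S"
  by (simp add: BijGroup_def)

section \<open>The Galois group as a group of permutations of the roots\<close>

context cubic_roots
begin

lemma galois_inj:
  assumes "\<sigma> \<in> galois_auts g" "v \<in> SF \<times> SF" "w \<in> SF \<times> SF" "map_prod \<sigma> \<sigma> v = map_prod \<sigma> \<sigma> w"
  shows "v = w"
proof -
  interpret galois_aut g \<sigma> by standard (rule assms)
  show ?thesis using assms eq_iff by (cases v; cases w) auto
qed

lemma galois_enum:
  assumes s: "\<sigma> \<in> galois_auts g"
  shows "{map_prod \<sigma> \<sigma> Q1, map_prod \<sigma> \<sigma> Q2, map_prod \<sigma> \<sigma> Q3} = {Q1, Q2, Q3}"
proof -
  have "inj_on (map_prod \<sigma> \<sigma>) {Q1, Q2, Q3}"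
  proof (rule inj_onI)
    fix v w assume v: "v \<in> {Q1, Q2, Q3}" and w: "w \<in> {Q1, Q2, Q3}" and "map_prod \<sigma> \<sigma> v = map_prod \<sigma> \<sigma> w"
    then show "v = w" by (intro galois_inj[OF s roots_in_SF[OF v] roots_in_SF[OF w]])
  qed
  moreover have "map_prod \<sigma> \<sigma> ` {Q1, Q2, Q3} \<subseteq> {Q1, Q2, Q3}"
    using galois_maps_roots[OF s] by (intro image_subsetI)
  ultimately have "map_prod \<sigma> \<sigma> ` {Q1, Q2, Q3} = {Q1, Q2, Q3}" by (intro endo_inj_surj) auto
  then show ?thesis by simp
qed

abbreviation \<gamma> where "\<gamma> \<sigma> \<equiv> restrict (galois_act SF \<sigma>) (form_roots g)"

lemma \<gamma>_pp:
  assumes "\<sigma> \<in> galois_auts g" "v \<in> SF \<times> SF" "v \<noteq> (0, 0)" "gval v = 0"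
  shows "\<gamma> \<sigma> (pp v) = pp (map_prod \<sigma> \<sigma> v)"
proof -
  interpret galois_aut g \<sigma> by standard (rule assms)
  show ?thesis using form_roots_iff[OF assms(3)] galois_act_pp assms by simp
qed

lemma \<gamma>_root:
  assumes "\<sigma> \<in> galois_auts g" "Q \<in> {Q1, Q2, Q3}"
  shows "\<gamma> \<sigma> (pp Q) = pp (map_prod \<sigma> \<sigma> Q)"
  using \<gamma>_pp[OF assms(1)] roots_in_SF[OF assms(2)] root_vector[OF assms(2)] by blast

lemma \<gamma>_Bij:
  assumes s: "\<sigma> \<in> galois_auts g"
  shows "\<gamma> \<sigma> \<in> Bij (form_roots g)"
proof -
  have "\<gamma> \<sigma> ` form_roots g = {pp (map_prod \<sigma> \<sigma> Q1), pp (map_prod \<sigma> \<sigma> Q2), pp (map_prod \<sigma> \<sigma> Q3)}"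
    using \<gamma>_root[OF s] unfolding form_roots_eq by (simp del: restrict_apply)
  also have "\<dots> = (\<lambda>v. pp v) ` {map_prod \<sigma> \<sigma> Q1, map_prod \<sigma> \<sigma> Q2, map_prod \<sigma> \<sigma> Q3}" by simp
  also have "\<dots> = form_roots g" unfolding galois_enum[OF s] form_roots_eq by simp
  finally have im: "\<gamma> \<sigma> ` form_roots g = form_roots g" .
  have "finite (form_roots g)" unfolding form_roots_eq by simp
  then have "inj_on (\<gamma> \<sigma>) (form_roots g)" using im by (metis eq_card_imp_inj_on)
  then show ?thesis using im by (simp add: Bij_def bij_betw_def)
qed

lemma galois_comp:
  assumes s: "\<sigma> \<in> galois_auts g" and t: "\<tau> \<in> galois_auts g"
  shows "\<sigma> \<circ> \<tau> \<in> galois_auts g"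
proof -
  interpret S: galois_aut g \<sigma> by standard (rule s)
  interpret T: galois_aut g \<tau> by standard (rule t)
  show ?thesis unfolding galois_auts_iff
    using bij_betw_trans[OF T.bij S.bij] by (simp add: T.add T.mult T.closed S.add S.mult)
qed

lemma galois_inverse:
  assumes s: "\<sigma> \<in> galois_auts g"
  obtains \<tau> where "\<tau> \<in> galois_auts g" "\<And>x. x \<in> SF \<Longrightarrow> \<tau> (\<sigma> x) = x"
proof -
  interpret S: galois_aut g \<sigma> by standard (rule s)
  define \<tau> where "\<tau> = inv_into SF \<sigma>"
  have b: "bij_betw \<tau> SF SF" unfolding \<tau>_def by (rule bij_betw_inv_into[OF S.bij])
  have tc: "\<tau> x \<in> SF" if "x \<in> SF" for x using b that by (auto simp: bij_betw_def)
  have ts: "\<tau> (\<sigma> x) = x" if "x \<in> SF" for x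
    unfolding \<tau>_def using S.bij that by (simp add: bij_betw_def)
  have st: "\<sigma> (\<tau> x) = x" if "x \<in> SF" for x
    unfolding \<tau>_def using S.bij that by (simp add: bij_betw_def f_inv_into_f)
  have "\<tau> (x + y) = \<tau> x + \<tau> y" "\<tau> (x * y) = \<tau> x * \<tau> y" if xy: "x \<in> SF" "y \<in> SF" for x y
  proof -
    have "\<sigma> (\<tau> x + \<tau> y) = x + y" using xy tc st by (simp add: S.add)
    then show "\<tau> (x + y) = \<tau> x + \<tau> y" using ts[of "\<tau> x + \<tau> y"] xy tc by (simp add: SF_closed)
    have "\<sigma> (\<tau> x * \<tau> y) = x * y" using xy tc st by (simp add: S.mult)
    then show "\<tau> (x * y) = \<tau> x * \<tau> y" using ts[of "\<tau> x * \<tau> y"] xy tc by (simp add: SF_closed)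
  qed
  moreover have "\<tau> (to_ac e) = to_ac e" for e using ts[of "to_ac e"] by (simp add: to_ac_in_splitting_field)
  ultimately have "\<tau> \<in> galois_auts g" unfolding galois_auts_iff using b by simp
  then show ?thesis using ts by (rule that)
qed

lemma Bij_ext:
  assumes "f \<in> Bij (form_roots g)" "f' \<in> Bij (form_roots g)" "\<And>Q. Q \<in> {Q1, Q2, Q3} \<Longrightarrow> f (pp Q) = f' (pp Q)"
  shows "f = f'"
proof (rule extensionalityI)
  show "f \<in> extensional (form_roots g)" "f' \<in> extensional (form_roots g)"
    using assms by (simp_all add: Bij_imp_extensional)
  show "f P = f' P" if "P \<in> form_roots g" for P using root_vector_cases[OF that] assms(3) by metis
qed

lemma galois_group_Bij: "galois_group g \<subseteq> Bij (form_roots g)"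
  unfolding galois_group_def using \<gamma>_Bij by blast

lemma subgroup_galois_group: "subgroup (galois_group g) (BijGroup (form_roots g))"
proof -
  interpret B: group "BijGroup (form_roots g)" by (rule group_BijGroup)
  have mult: "\<gamma> \<sigma> \<otimes>\<^bsub>BijGroup (form_roots g)\<^esub> \<gamma> \<tau> = \<gamma> (\<sigma> \<circ> \<tau>)"
    if st: "\<sigma> \<in> galois_auts g" "\<tau> \<in> galois_auts g" for \<sigma> \<tau>
  proof (rule Bij_ext)
    show "\<gamma> \<sigma> \<otimes>\<^bsub>BijGroup (form_roots g)\<^esub> \<gamma> \<tau> \<in> Bij (form_roots g)"
      using \<gamma>_Bij st by (simp add: mult_BijGroup compose_Bij)
    show "\<gamma> (\<sigma> \<circ> \<tau>) \<in> Bij (form_roots g)" using \<gamma>_Bij galois_comp st by blast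
    fix Q assume Q: "Q \<in> {Q1, Q2, Q3}"
    have "(\<gamma> \<sigma> \<otimes>\<^bsub>BijGroup (form_roots g)\<^esub> \<gamma> \<tau>) (pp Q) = \<gamma> \<sigma> (\<gamma> \<tau> (pp Q))"
      using \<gamma>_Bij st root_vector(4)[OF Q] by (simp only: mult_BijGroup compose_eq)
    also have "\<dots> = pp (map_prod \<sigma> \<sigma> (map_prod \<tau> \<tau> Q))"
      using \<gamma>_root[OF st(2) Q] \<gamma>_root[OF st(1) galois_maps_roots[OF st(2) Q]] by (simp only:)
    also have "map_prod \<sigma> \<sigma> (map_prod \<tau> \<tau> Q) = map_prod (\<sigma> \<circ> \<tau>) (\<sigma> \<circ> \<tau>) Q" by (cases Q) simp
    also have "pp \<dots> = \<gamma> (\<sigma> \<circ> \<tau>) (pp Q)"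
      using \<gamma>_root[OF galois_comp[OF st] Q] by (simp only:)
    finally show "(\<gamma> \<sigma> \<otimes>\<^bsub>BijGroup (form_roots g)\<^esub> \<gamma> \<tau>) (pp Q) = \<gamma> (\<sigma> \<circ> \<tau>) (pp Q)" .
  qed
  have id: "id \<in> galois_auts g" by (simp add: galois_auts_iff)
  show ?thesis
  proof (rule B.subgroupI)
    show "galois_group g \<subseteq> carrier (BijGroup (form_roots g))"
      using galois_group_Bij by (simp add: carrier_BijGroup)
    show "galois_group g \<noteq> {}" unfolding galois_group_def using id by blast
    fix f assume "f \<in> galois_group g"
    then obtain \<sigma> where s: "\<sigma> \<in> galois_auts g" "f = \<gamma> \<sigma>" unfolding galois_group_def by blast
    obtain \<tau> where t: "\<tau> \<in> galois_auts g" "\<And>x. x \<in> SF \<Longrightarrow> \<tau> (\<sigma> x) = x" using galois_inverse[OF s(1)] by blast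
    have "\<gamma> \<tau> \<otimes>\<^bsub>BijGroup (form_roots g)\<^esub> \<gamma> \<sigma> = \<one>\<^bsub>BijGroup (form_roots g)\<^esub>"
      unfolding mult[OF t(1) s(1)]
    proof (rule Bij_ext)
      show "\<gamma> (\<tau> \<circ> \<sigma>) \<in> Bij (form_roots g)" using \<gamma>_Bij galois_comp s t by blast
      show "\<one>\<^bsub>BijGroup (form_roots g)\<^esub> \<in> Bij (form_roots g)" using B.one_closed by (simp add: carrier_BijGroup)
      fix Q assume Q: "Q \<in> {Q1, Q2, Q3}"
      have "map_prod (\<tau> \<circ> \<sigma>) (\<tau> \<circ> \<sigma>) Q = Q" using roots_in_SF[OF Q] t(2) by (cases Q) auto
      then have "\<gamma> (\<tau> \<circ> \<sigma>) (pp Q) = pp Q" using \<gamma>_root[OF galois_comp[OF t(1) s(1)] Q] by (simp only:)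
      then show "\<gamma> (\<tau> \<circ> \<sigma>) (pp Q) = \<one>\<^bsub>BijGroup (form_roots g)\<^esub> (pp Q)"
        using root_vector(4)[OF Q] by (simp add: BijGroup_def)
    qed
    then have "inv\<^bsub>BijGroup (form_roots g)\<^esub> f = \<gamma> \<tau>"
      using \<gamma>_Bij s t by (intro B.inv_equality) (simp_all add: carrier_BijGroup)
    then show "inv\<^bsub>BijGroup (form_roots g)\<^esub> f \<in> galois_group g" unfolding galois_group_def using t by blast
    fix f' assume "f' \<in> galois_group g"
    then obtain \<sigma>' where s': "\<sigma>' \<in> galois_auts g" "f' = \<gamma> \<sigma>'" unfolding galois_group_def by blast
    show "f \<otimes>\<^bsub>BijGroup (form_roots g)\<^esub> f' \<in> galois_group g"
      unfolding s(2) s'(2) mult[OF s(1) s'(1)] galois_group_def using galois_comp[OF s(1) s'(1)] by blast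
  qed
qed

lemma centraliser_iff:
  "f \<in> centraliser (BijGroup (form_roots g)) (galois_group g) \<longleftrightarrow>
    f \<in> Bij (form_roots g) \<and> (\<forall>\<sigma>\<in>galois_auts g. \<forall>P\<in>form_roots g. f (\<gamma> \<sigma> P) = \<gamma> \<sigma> (f P))"
proof -
  have "f \<otimes>\<^bsub>BijGroup (form_roots g)\<^esub> \<gamma> \<sigma> = \<gamma> \<sigma> \<otimes>\<^bsub>BijGroup (form_roots g)\<^esub> f \<longleftrightarrow>
      (\<forall>P\<in>form_roots g. f (\<gamma> \<sigma> P) = \<gamma> \<sigma> (f P))"
    if f: "f \<in> Bij (form_roots g)" and s: "\<sigma> \<in> galois_auts g" for \<sigma>
    unfolding mult_BijGroup[OF f \<gamma>_Bij[OF s]] mult_BijGroup[OF \<gamma>_Bij[OF s] f]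
  proof
    assume eq: "compose (form_roots g) f (\<gamma> \<sigma>) = compose (form_roots g) (\<gamma> \<sigma>) f"
    show "\<forall>P\<in>form_roots g. f (\<gamma> \<sigma> P) = \<gamma> \<sigma> (f P)"
    proof
      fix P assume "P \<in> form_roots g"
      then show "f (\<gamma> \<sigma> P) = \<gamma> \<sigma> (f P)" using fun_cong[OF eq, of P] by (simp only: compose_eq)
    qed
  next
    assume "\<forall>P\<in>form_roots g. f (\<gamma> \<sigma> P) = \<gamma> \<sigma> (f P)"
    then show "compose (form_roots g) f (\<gamma> \<sigma>) = compose (form_roots g) (\<gamma> \<sigma>) f"
      by (intro extensionalityI[OF compose_extensional compose_extensional]) (simp only: compose_eq)
  qed
  then show ?thesis unfolding centraliser_def galois_group_def carrier_BijGroup by blast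
qed

lemma vact_galois:
  assumes "\<sigma> \<in> galois_auts g" "v \<in> SF \<times> SF"
  shows "vact M v \<in> SF \<times> SF" "map_prod \<sigma> \<sigma> (vact M v) = vact M (map_prod \<sigma> \<sigma> v)"
proof -
  interpret galois_aut g \<sigma> by standard (rule assms)
  show "vact M v \<in> SF \<times> SF" "map_prod \<sigma> \<sigma> (vact M v) = vact M (map_prod \<sigma> \<sigma> v)"
    using assms(2) by (auto simp: vact_def SF_closed to_ac_in_splitting_field add mult)
qed

text \<open>The entries of \<open>M\<close> lie in \<open>K\<close>, so applying \<sigma> to
  coordinates commutes with multiplication by \<open>M\<close>.\<close>

lemma \<Phi>_centralises:
  assumes M: "M \<in> auts g"
  shows "\<Phi> M \<in> centraliser (BijGroup (form_roots g)) (galois_group g)"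
  unfolding centraliser_iff
proof (intro conjI ballI)
  show "\<Phi> M \<in> Bij (form_roots g)" by (rule \<Phi>_Bij[OF M])
  fix \<sigma> P assume s: "\<sigma> \<in> galois_auts g" and P: "P \<in> form_roots g"
  obtain Q where Q: "Q \<in> {Q1, Q2, Q3}" "P = pp Q" "Q \<noteq> (0, 0)" "gval Q = 0" using root_vector_cases[OF P] by blast
  obtain N where N: "N \<in> auts g" "\<And>v. vact M (vact N v) = v" using vact_inverse[OF M] by blast
  \<comment> \<open>The vector that \<open>M\<close> carries to \<open>Q\<close>. It is in general
    not normal, which is why the Galois action was computed for arbitrary root vectors over
    \<open>SF\<close>.\<close>
  define w where "w = vact N Q"
  have w: "Q = vact M w" "w \<in> SF \<times> SF" "w \<noteq> (0, 0)" "gval w = 0"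
    using N(2) vact_galois(1)[OF s roots_in_SF[OF Q(1)]] vact_eq_0_iff[OF N(1)] Q auts_gval[OF N(1)]
    by (simp_all add: w_def)
  define w' where "w' = map_prod \<sigma> \<sigma> w"
  have Q': "map_prod \<sigma> \<sigma> Q = vact M w'" using vact_galois(2)[OF s w(2)] w(1) by (simp add: w'_def)
  have rQ': "map_prod \<sigma> \<sigma> Q \<in> {Q1, Q2, Q3}" by (rule galois_maps_roots[OF s Q(1)])
  have w': "w' \<noteq> (0, 0)" "gval w' = 0"
  proof -
    show "w' \<noteq> (0, 0)" using Q' root_vector(2)[OF rQ'] by auto
    have "to_ac (det M) * gval w' = 0" using auts_gval[OF M, of w'] root_vector(3)[OF rQ'] Q' by simp
    then show "gval w' = 0" using auts_det[OF M] by simp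
  qed
  have "\<Phi> M (\<gamma> \<sigma> P) = \<Phi> M (pp (vact M w'))" using \<gamma>_root[OF s Q(1)] Q(2) Q' by (simp only:)
  also have "\<dots> = pp w'" by (rule \<Phi>_pp(1)[OF M w'])
  also have "\<dots> = \<gamma> \<sigma> (pp w)" using \<gamma>_pp[OF s w(2-4)] by (simp only: w'_def)
  also have "pp w = \<Phi> M P" using \<Phi>_pp(1)[OF M w(3,4)] w(1) Q(2) by simp
  finally show "\<Phi> M (\<gamma> \<sigma> P) = \<gamma> \<sigma> (\<Phi> M P)" .
qed

end

section \<open>Automorphisms from permutations commuting with the Galois group\<close>

lemma pp_scal: "k \<noteq> 0 \<Longrightarrow> pp (scal k v) = pp v"
  by (simp add: scal_def proj_point_scale)

context cubic_roots
begin

lemma gval_scal: "gval (scal k v) = k ^ 3 * gval v"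
  using gval_scale[of k "fst v" "snd v"] by (simp add: scal_def)

text \<open>The three factors are the coefficients in \<open>pv\<close>. Their product depends only
  on \<open>D^4\<close>, so it is the same for every ordering of the roots.\<close>

lemma pv_prod:
  "(dt Q1 Q2 * dt Q1 Q3 * (dt Q2 Q3)\<^sup>2) * (dt Q2 Q3 * dt Q2 Q1 * (dt Q3 Q1)\<^sup>2) *
   (dt Q3 Q1 * dt Q3 Q2 * (dt Q1 Q2)\<^sup>2) = - (D\<^sup>2 * D\<^sup>2)"
  unfolding D_def using dt_swap[of Q1 Q3] dt_swap[of Q3 Q2] dt_swap[of Q2 Q1]
  by (simp add: algebra_simps power2_eq_square)

text \<open>Brackets of the \<open>pv\<close> vectors show that the determinant m has square 1.
  Factoring \<open>g\<close> through the \<open>Q\<close> triple at vM and through the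
  \<open>R\<close> triple at v gives g(vM) = m^3 g(v), because the coefficient products agree; so
  the factor is m. \<open>M\<close> carries the \<open>R\<close> points to the \<open>Q\<close>
  points, hence \<open>\<Phi> M\<close>, a preimage map, goes the other way.\<close>

lemma aut_of_rows:
  assumes R: "{R1, R2, R3} = {Q1, Q2, Q3}"
    and V: "vact M (pv R1 R2 R3) = pv Q1 Q2 Q3" "vact M (pv R2 R3 R1) = pv Q2 Q3 Q1"
      "vact M (pv R3 R1 R2) = pv Q3 Q1 Q2"
  shows "M \<in> auts g" "\<Phi> M (pp Q1) = pp R1" "\<Phi> M (pp Q2) = pp R2" "\<Phi> M (pp Q3) = pp R3"
proof -
  interpret R: cubic_roots a b c d \<kappa> R1 R2 R3 by (rule enum_perm[OF R])
  define m where "m = to_ac (det M)"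
  have RD2: "R.D\<^sup>2 = D\<^sup>2" using enum_D(2)[OF R] by (simp add: R.D_def)
  have "D ^ 3 = m * R.D ^ 3"
    using dt_vact[of M "pv R1 R2 R3" "pv R2 R3 R1"] unfolding V dt_pv m_def by (simp add: D_def R.D_def)
  then have "D\<^sup>2 * D = D\<^sup>2 * (m * R.D)"
    using RD2 by (simp add: power3_eq_cube power2_eq_square)
  then have DR: "D = m * R.D" using D_nz by simp
  then have m0: "m \<noteq> 0" using D_nz by auto
  have "m\<^sup>2 * D\<^sup>2 = D\<^sup>2" using DR RD2 by (metis power_mult_distrib)
  then have m2: "m * m = 1" using D_nz by (simp add: power2_eq_square)
  define c1 c2 c3 where "c1 = dt Q1 Q2 * dt Q1 Q3 * (dt Q2 Q3)\<^sup>2" and "c2 = dt Q2 Q3 * dt Q2 Q1 * (dt Q3 Q1)\<^sup>2"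
    and "c3 = dt Q3 Q1 * dt Q3 Q2 * (dt Q1 Q2)\<^sup>2"
  define e1 e2 e3 where "e1 = dt R1 R2 * dt R1 R3 * (dt R2 R3)\<^sup>2" and "e2 = dt R2 R3 * dt R2 R1 * (dt R3 R1)\<^sup>2"
    and "e3 = dt R3 R1 * dt R3 R2 * (dt R1 R2)\<^sup>2"
  have c: "c1 * c2 * c3 = - (D\<^sup>2 * D\<^sup>2)" unfolding c1_def c2_def c3_def by (rule pv_prod)
  have e: "e1 * e2 * e3 = - (D\<^sup>2 * D\<^sup>2)" unfolding e1_def e2_def e3_def R.pv_prod RD2 ..
  have nz: "c1 * c2 * c3 \<noteq> 0" "e1 * e2 * e3 \<noteq> 0" unfolding c e using D_nz by simp_all
  have pvQ: "pv Q1 Q2 Q3 = scal c1 Q1" "pv Q2 Q3 Q1 = scal c2 Q2" "pv Q3 Q1 Q2 = scal c3 Q3"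
    by (simp_all add: pv_def c1_def c2_def c3_def)
  have pvR: "pv R1 R2 R3 = scal e1 R1" "pv R2 R3 R1 = scal e2 R2" "pv R3 R1 R2 = scal e3 R3"
    by (simp_all add: pv_def e1_def e2_def e3_def)
  note V' = V[unfolded pvQ pvR]
  have "gval (vact M v) = m * gval v" for v
  proof -
    have f: "c1 * dt Q1 (vact M v) = m * (e1 * dt R1 v)" "c2 * dt Q2 (vact M v) = m * (e2 * dt R2 v)"
      "c3 * dt Q3 (vact M v) = m * (e3 * dt R3 v)"
      using dt_vact[of M "scal e1 R1" v] dt_vact[of M "scal e2 R2" v] dt_vact[of M "scal e3 R3" v]
      unfolding V' m_def by simp_all
    have "(c1 * c2 * c3) * gval (vact M v) =
       to_ac \<kappa> * (c1 * dt Q1 (vact M v)) * (c2 * dt Q2 (vact M v)) * (c3 * dt Q3 (vact M v))"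
      unfolding gval_factor by (simp add: algebra_simps)
    also have "\<dots> = (e1 * e2 * e3) * ((m * m) * m) * gval v"
      unfolding f R.gval_factor by (simp add: algebra_simps)
    also have "\<dots> = (c1 * c2 * c3) * (m * gval v)" unfolding m2 c e by simp
    finally show ?thesis using nz(1) by (metis mult_left_cancel)
  qed
  then show M: "M \<in> auts g" unfolding auts_iff m_def using m0 by (auto simp: m_def)
  have key: "\<Phi> M (pp Q) = pp S"
    if QS: "Q \<in> {Q1, Q2, Q3}" "S \<in> {Q1, Q2, Q3}" "x \<noteq> 0" "y \<noteq> 0" "vact M (scal x S) = scal y Q" for x y Q S
  proof -
    have "scal x S \<noteq> (0, 0)" using root_vector(2)[OF QS(2)] QS(3) by (auto simp: scal_def prod_eq_iff)
    moreover have "gval (scal x S) = 0" using root_vector(3)[OF QS(2)] by (simp add: gval_scal)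
    ultimately have "\<Phi> M (pp (vact M (scal x S))) = pp (scal x S)" by (rule \<Phi>_pp(1)[OF M])
    then show ?thesis unfolding QS(5) using pp_scal QS(3,4) by metis
  qed
  have mem: "R1 \<in> {Q1, Q2, Q3}" "R2 \<in> {Q1, Q2, Q3}" "R3 \<in> {Q1, Q2, Q3}" using R by blast+
  show "\<Phi> M (pp Q1) = pp R1" by (rule key[OF _ mem(1) _ _ V'(1)]) (use nz in auto)
  show "\<Phi> M (pp Q2) = pp R2" by (rule key[OF _ mem(2) _ _ V'(2)]) (use nz in auto)
  show "\<Phi> M (pp Q3) = pp R3" by (rule key[OF _ mem(3) _ _ V'(3)]) (use nz in auto)
qed

text \<open>With \<open>R1\<close>, \<open>R2\<close>, \<open>R3\<close> the images of the roots
  under \<open>f\<close>, linear algebra gives a matrix over \<open>SF\<close> carrying the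
  \<open>pv\<close> vectors of the \<open>R\<close> triple to those of the \<open>Q\<close> triple.
  As \<open>f\<close> commutes with \<sigma>, conjugating the matrix only permutes its defining
  equations, so by uniqueness its entries are fixed.\<close>

lemma \<Phi>_surj:
  assumes f: "f \<in> centraliser (BijGroup (form_roots g)) (galois_group g)"
  shows "\<exists>M\<in>auts g. \<Phi> M = f"
proof -
  have fB: "f \<in> Bij (form_roots g)" and comm: "\<And>\<sigma> P. \<sigma> \<in> galois_auts g \<Longrightarrow> P \<in> form_roots g \<Longrightarrow> f (\<gamma> \<sigma> P) = \<gamma> \<sigma> (f P)"
    using f unfolding centraliser_iff by blast+
  have fr: "f P \<in> form_roots g" if "P \<in> form_roots g" for P using fB that Bij_imp_funcset by blast
  have "\<forall>Q\<in>{Q1, Q2, Q3}. \<exists>R. R \<in> {Q1, Q2, Q3} \<and> pp R = f (pp Q)"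
  proof
    fix Q assume "Q \<in> {Q1, Q2, Q3}"
    then have "f (pp Q) \<in> form_roots g" by (intro fr root_vector(4))
    then obtain R where "R \<in> {Q1, Q2, Q3}" "f (pp Q) = pp R" by (rule root_vector_cases)
    then show "\<exists>R. R \<in> {Q1, Q2, Q3} \<and> pp R = f (pp Q)" by (intro exI[of _ R]) (rule conjI, assumption, rule sym)
  qed
  from bchoice[OF this] obtain r where
    r0: "\<forall>Q\<in>{Q1, Q2, Q3}. r Q \<in> {Q1, Q2, Q3} \<and> pp (r Q) = f (pp Q)" ..
  have r: "r Q \<in> {Q1, Q2, Q3}" "pp (r Q) = f (pp Q)" if "Q \<in> {Q1, Q2, Q3}" for Q
    using bspec[OF r0 that] by (rule conjunct1, rule conjunct2)
  have Q: "Q1 \<in> {Q1, Q2, Q3}" "Q2 \<in> {Q1, Q2, Q3}" "Q3 \<in> {Q1, Q2, Q3}" by auto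
  have rinj: "Q = Q'" if "r Q = r Q'" "Q \<in> {Q1, Q2, Q3}" "Q' \<in> {Q1, Q2, Q3}" for Q Q'
  proof -
    have "f (pp Q) = f (pp Q')" using r(2)[OF that(2)] r(2)[OF that(3)] that(1) by simp
    then have "pp Q = pp Q'" using fB root_vector(4)[OF that(2)] root_vector(4)[OF that(3)]
      by (auto simp: Bij_def bij_betw_def inj_on_def)
    then show ?thesis using pp_eq_iff_roots that by blast
  qed
  define R1 R2 R3 where "R1 = r Q1" and "R2 = r Q2" and "R3 = r Q3"
  have Rm: "R1 \<in> {Q1, Q2, Q3}" "R2 \<in> {Q1, Q2, Q3}" "R3 \<in> {Q1, Q2, Q3}"
    unfolding R1_def R2_def R3_def by (intro r(1) Q)+
  have "R1 \<noteq> R2" "R2 \<noteq> R3" "R3 \<noteq> R1"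
    using rinj[OF _ Q(1) Q(2)] rinj[OF _ Q(2) Q(3)] rinj[OF _ Q(3) Q(1)] distinct by (auto simp: R1_def R2_def R3_def)
  then have R: "{R1, R2, R3} = {Q1, Q2, Q3}" using Rm distinct by auto
  interpret R: cubic_roots a b c d \<kappa> R1 R2 R3 by (rule enum_perm[OF R])
  note inSF = roots_in_SF
  have pvSF: "pv A B C \<in> SF \<times> SF" if "A \<in> {Q1, Q2, Q3}" "B \<in> {Q1, Q2, Q3}" "C \<in> {Q1, Q2, Q3}" for A B C
    by (rule pv_closed[OF splitting_field_subfield]) (rule inSF, rule that)+
  have "dt (pv R1 R2 R3) (pv R2 R3 R1) \<noteq> 0" unfolding dt_pv using R.D_nz by (simp add: R.D_def)
  then obtain n1 n2 where n: "n1 \<in> SF \<times> SF" "n2 \<in> SF \<times> SF"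
    "rowmult (pv R1 R2 R3) n1 n2 = pv Q1 Q2 Q3" "rowmult (pv R2 R3 R1) n1 n2 = pv Q2 Q3 Q1"
    by (rule rowmult_exists[OF splitting_field_subfield _ pvSF[OF Rm(1,2,3)] pvSF[OF Rm(2,3,1)]
        pvSF[OF Q(1,2,3)] pvSF[OF Q(2,3,1)]])
  have n3: "rowmult (pv R3 R1 R2) n1 n2 = pv Q3 Q1 Q2" by (rule rowmult_pv_third[OF n(3,4)])
  \<comment> \<open>\<sigma> may permute the roots oddly, so the equation is needed for all six
    orderings. The odd ones follow from the symmetry of \<open>pv\<close> in its last two
    arguments.\<close>
  have enum: "rowmult (pv (r A) (r B) (r C)) n1 n2 = pv A B C" if "{A, B, C} = {Q1, Q2, Q3}" for A B C
    using enum_set_cases[OF that] n(3,4) n3 pv_swap[of R1 R2 R3] pv_swap[of Q1 Q2 Q3]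
      pv_swap[of R2 R3 R1] pv_swap[of Q2 Q3 Q1] pv_swap[of R3 R1 R2] pv_swap[of Q3 Q1 Q2]
    by (auto simp: R1_def R2_def R3_def)
  have fixed: "map_prod \<sigma> \<sigma> n1 = n1 \<and> map_prod \<sigma> \<sigma> n2 = n2" if s: "\<sigma> \<in> galois_auts g" for \<sigma>
  proof -
    interpret galois_aut g \<sigma> by standard (rule s)
    let ?s = "map_prod \<sigma> \<sigma>"
    have sQ: "?s Q \<in> {Q1, Q2, Q3}" if "Q \<in> {Q1, Q2, Q3}" for Q by (rule galois_maps_roots[OF s that])
    have sr: "?s (r Q) = r (?s Q)" if Qm: "Q \<in> {Q1, Q2, Q3}" for Q
    proof -
      have "pp (?s (r Q)) = \<gamma> \<sigma> (pp (r Q))" by (rule \<gamma>_root[OF s r(1)[OF Qm], symmetric])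
      also have "\<dots> = \<gamma> \<sigma> (f (pp Q))" by (simp only: r(2)[OF Qm])
      also have "\<dots> = f (\<gamma> \<sigma> (pp Q))" by (rule comm[OF s root_vector(4)[OF Qm], symmetric])
      also have "\<dots> = f (pp (?s Q))" by (simp only: \<gamma>_root[OF s Qm])
      also have "\<dots> = pp (r (?s Q))" by (rule r(2)[OF sQ[OF Qm], symmetric])
      finally show ?thesis using pp_eq_iff_roots[OF sQ[OF r(1)[OF Qm]] r(1)[OF sQ[OF Qm]]] by blast
    qed
    have app: "rowmult (pv (r (?s A)) (r (?s B)) (r (?s C))) (?s n1) (?s n2) = pv (?s A) (?s B) (?s C)"
      if ABC: "A \<in> {Q1, Q2, Q3}" "B \<in> {Q1, Q2, Q3}" "C \<in> {Q1, Q2, Q3}"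
        and eq: "rowmult (pv (r A) (r B) (r C)) n1 n2 = pv A B C" for A B C
    proof -
      have "?s (rowmult (pv (r A) (r B) (r C)) n1 n2) = ?s (pv A B C)" by (simp only: eq)
      then show ?thesis
        unfolding rowmult[OF pvSF[OF r(1)[OF ABC(1)] r(1)[OF ABC(2)] r(1)[OF ABC(3)]] n(1,2)]
          pv[OF inSF[OF ABC(1)] inSF[OF ABC(2)] inSF[OF ABC(3)]]
          pv[OF inSF[OF r(1)[OF ABC(1)]] inSF[OF r(1)[OF ABC(2)]] inSF[OF r(1)[OF ABC(3)]]]
          sr[OF ABC(1)] sr[OF ABC(2)] sr[OF ABC(3)] .
    qed
    have e: "{?s Q1, ?s Q2, ?s Q3} = {Q1, Q2, Q3}" by (rule galois_enum[OF s])
    then have e': "{?s Q2, ?s Q3, ?s Q1} = {Q1, Q2, Q3}" by (simp only: insert_commute)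
    have "dt (pv (r (?s Q1)) (r (?s Q2)) (r (?s Q3))) (pv (r (?s Q2)) (r (?s Q3)) (r (?s Q1))) =
      \<sigma> (dt (pv R1 R2 R3) (pv R2 R3 R1))"
      unfolding dt[OF pvSF[OF Rm(1,2,3)] pvSF[OF Rm(2,3,1)]]
        pv[OF inSF[OF Rm(1)] inSF[OF Rm(2)] inSF[OF Rm(3)]] pv[OF inSF[OF Rm(2)] inSF[OF Rm(3)] inSF[OF Rm(1)]]
      unfolding R1_def R2_def R3_def sr[OF Q(1)] sr[OF Q(2)] sr[OF Q(3)] ..
    moreover have "\<sigma> (dt (pv R1 R2 R3) (pv R2 R3 R1)) \<noteq> 0"
      using eq_iff[of "dt (pv R1 R2 R3) (pv R2 R3 R1)" 0] \<open>dt (pv R1 R2 R3) (pv R2 R3 R1) \<noteq> 0\<close>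
        pvSF[OF Rm(1,2,3)] pvSF[OF Rm(2,3,1)] by (simp add: SF_closed)
    ultimately have "dt (pv (r (?s Q1)) (r (?s Q2)) (r (?s Q3))) (pv (r (?s Q2)) (r (?s Q3)) (r (?s Q1))) \<noteq> 0"
      by simp
    \<comment> \<open>The rows and their conjugates solve one linear system, that of the permuted
      triple: the conjugates by applying \<sigma> to the original equations, the rows themselves by
      \<open>enum\<close>.\<close>
    then show ?thesis
    proof (rule rowmult_unique)
      show "rowmult (pv (r (?s Q1)) (r (?s Q2)) (r (?s Q3))) (?s n1) (?s n2) =
        rowmult (pv (r (?s Q1)) (r (?s Q2)) (r (?s Q3))) n1 n2"
        unfolding enum[OF e] by (rule app[OF Q(1,2,3) n(3)[unfolded R1_def R2_def R3_def]])
      show "rowmult (pv (r (?s Q2)) (r (?s Q3)) (r (?s Q1))) (?s n1) (?s n2) =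
        rowmult (pv (r (?s Q2)) (r (?s Q3)) (r (?s Q1))) n1 n2"
        unfolding enum[OF e'] by (rule app[OF Q(2,3,1) n(4)[unfolded R1_def R2_def R3_def]])
    qed
  qed
  have rational: "x \<in> range to_ac" if x: "x \<in> SF" "\<And>\<sigma>. \<sigma> \<in> galois_auts g \<Longrightarrow> \<sigma> x = x" for x
    using fixed_field x by blast
  have "fst n1 \<in> range to_ac" by (rule rational) (use n(1) fixed in \<open>auto simp: prod_eq_iff\<close>)
  moreover have "snd n1 \<in> range to_ac" by (rule rational) (use n(1) fixed in \<open>auto simp: prod_eq_iff\<close>)
  moreover have "fst n2 \<in> range to_ac" by (rule rational) (use n(2) fixed in \<open>auto simp: prod_eq_iff\<close>)
  moreover have "snd n2 \<in> range to_ac" by (rule rational) (use n(2) fixed in \<open>auto simp: prod_eq_iff\<close>)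
  ultimately obtain e11 e12 e21 e22 where ent: "fst n1 = to_ac e11" "snd n1 = to_ac e12" "fst n2 = to_ac e21" "snd n2 = to_ac e22"
    by blast
  define M :: "'k^2^2" where
    "M = (\<chi> i j. if i = 1 then (if j = 1 then e11 else e12) else (if j = 1 then e21 else e22))"
  have vM: "vact M v = rowmult v n1 n2" for v by (simp add: vact_def rowmult_def ent M_def)
  note aut = aut_of_rows[OF R, of M, unfolded vM, OF n(3,4) n3]
  have "\<Phi> M = f"
  proof (rule Bij_ext[OF \<Phi>_Bij[OF aut(1)] fB])
    fix Q assume "Q \<in> {Q1, Q2, Q3}"
    then show "\<Phi> M (pp Q) = f (pp Q)"
      using aut(2-4) r(2)[OF Q(1)] r(2)[OF Q(2)] r(2)[OF Q(3)] by (auto simp: R1_def R2_def R3_def)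
  qed
  then show ?thesis using aut(1) by blast
qed

section \<open>Parity: the square class of the discriminant, rational roots and SL(2)\<close>

definition even_perms :: "(('k alg_closure \<times> 'k alg_closure) set \<Rightarrow> ('k alg_closure \<times> 'k alg_closure) set) set" where
  "even_perms = {f \<in> Bij (form_roots g).
     (f (pp Q1), f (pp Q2), f (pp Q3)) \<in> {(pp Q1, pp Q2, pp Q3), (pp Q2, pp Q3, pp Q1), (pp Q3, pp Q1, pp Q2)}}"

lemma galois_delta:
  assumes s: "\<sigma> \<in> galois_auts g"
  shows "\<sigma> \<delta> = \<delta> \<longleftrightarrow> \<gamma> \<sigma> \<in> even_perms"
proof -
  interpret galois_aut g \<sigma> by standard (rule s)
  let ?s = "map_prod \<sigma> \<sigma>"
  have Q: "Q1 \<in> {Q1, Q2, Q3}" "Q2 \<in> {Q1, Q2, Q3}" "Q3 \<in> {Q1, Q2, Q3}" by auto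
  have "\<sigma> \<delta> = (to_ac \<kappa>)\<^sup>2 * (dt (?s Q1) (?s Q2) * dt (?s Q2) (?s Q3) * dt (?s Q3) (?s Q1))"
    unfolding \<delta>_def using roots_in_SF[OF Q(1)] roots_in_SF[OF Q(2)] roots_in_SF[OF Q(3)]
    by (simp add: mult power dt SF_closed to_ac_in_splitting_field mult.assoc)
  then have "\<sigma> \<delta> = \<delta> \<longleftrightarrow> dt (?s Q1) (?s Q2) * dt (?s Q2) (?s Q3) * dt (?s Q3) (?s Q1) = D"
    unfolding delta_D using kappa_nz by simp
  also have "\<dots> \<longleftrightarrow> (?s Q1, ?s Q2, ?s Q3) \<in> {(Q1, Q2, Q3), (Q2, Q3, Q1), (Q3, Q1, Q2)}"
    by (rule enum_D(1)[OF galois_enum[OF s]])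
  also have "\<dots> \<longleftrightarrow> (pp (?s Q1), pp (?s Q2), pp (?s Q3)) \<in> {(pp Q1, pp Q2, pp Q3), (pp Q2, pp Q3, pp Q1), (pp Q3, pp Q1, pp Q2)}"
    using pp_eq_iff_roots[OF galois_maps_roots[OF s Q(1)]] pp_eq_iff_roots[OF galois_maps_roots[OF s Q(2)]]
      pp_eq_iff_roots[OF galois_maps_roots[OF s Q(3)]] Q by simp
  also have "\<dots> \<longleftrightarrow> \<gamma> \<sigma> \<in> even_perms"
    unfolding even_perms_def using \<gamma>_Bij[OF s] \<gamma>_root[OF s Q(1)] \<gamma>_root[OF s Q(2)] \<gamma>_root[OF s Q(3)]
    by (simp del: restrict_apply)
  finally show ?thesis .
qed

lemma is_square_iff_even: "is_square (cubic_disc a b c d) \<longleftrightarrow> galois_group g \<subseteq> even_perms"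
proof
  assume "is_square (cubic_disc a b c d)"
  then have d: "\<delta> \<in> range to_ac" by (simp add: is_square_disc_iff)
  have "\<gamma> \<sigma> \<in> even_perms" if s: "\<sigma> \<in> galois_auts g" for \<sigma>
    using d galois_delta[OF s] galois_aut.const[OF galois_aut.intro[OF s]] by auto
  then show "galois_group g \<subseteq> even_perms" unfolding galois_group_def by (intro image_subsetI)
next
  assume e: "galois_group g \<subseteq> even_perms"
  have "\<sigma> \<delta> = \<delta>" if s: "\<sigma> \<in> galois_auts g" for \<sigma>
  proof -
    have "\<gamma> \<sigma> \<in> even_perms" using e s unfolding galois_group_def by blast
    then show ?thesis using galois_delta[OF s] by blast
  qed
  then show "is_square (cubic_disc a b c d)" unfolding is_square_disc_iff by (rule fixed_field[OF delta_in_SF])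
qed

lemma rational_root_iff_fixed:
  assumes Q: "Q \<in> {Q1, Q2, Q3}"
  shows "pp Q \<in> rational_roots g \<longleftrightarrow> (\<forall>f\<in>galois_group g. f (pp Q) = pp Q)"
proof -
  have "(\<forall>f\<in>galois_group g. f (pp Q) = pp Q) \<longleftrightarrow> (\<forall>\<sigma>\<in>galois_auts g. \<gamma> \<sigma> (pp Q) = pp Q)"
    unfolding galois_group_def by blast
  also have "\<dots> \<longleftrightarrow> (\<forall>\<sigma>\<in>galois_auts g. map_prod \<sigma> \<sigma> Q = Q)"
    using \<gamma>_root[OF _ Q] pp_eq_iff_roots[OF galois_maps_roots[OF _ Q] Q] by (simp del: restrict_apply)
  also have "\<dots> \<longleftrightarrow> (\<forall>\<sigma>\<in>galois_auts g. \<sigma> (fst Q) = fst Q) \<and> (\<forall>\<sigma>\<in>galois_auts g. \<sigma> (snd Q) = snd Q)"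
    by (cases Q) auto
  also have "\<dots> \<longleftrightarrow> fst Q \<in> range to_ac \<and> snd Q \<in> range to_ac"
  proof -
    have "(\<forall>\<sigma>\<in>galois_auts g. \<sigma> x = x) \<longleftrightarrow> x \<in> range to_ac" if x: "x \<in> SF" for x
      using fixed_field[OF x] galois_aut.const[OF galois_aut.intro] by blast
    then show ?thesis using roots_in_SF[OF Q] by (cases Q) auto
  qed
  also have "\<dots> \<longleftrightarrow> Q \<in> range to_ac \<times> range to_ac" by (cases Q) auto
  finally show ?thesis using rational_roots_iff[OF Q] by blast
qed

text \<open>The determinant compares the orientation of the triple of preimages with that of
  \<open>Q1\<close>, \<open>Q2\<close>, \<open>Q3\<close>. The preimages describe the inverse of
  \<open>\<Phi> M\<close>, which has the same parity.\<close>

lemma SL2_iff_even: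
  assumes M: "M \<in> auts g"
  shows "M \<in> SL2 \<longleftrightarrow> \<Phi> M \<in> even_perms"
proof -
  obtain R1 R2 R3 where R: "{R1, R2, R3} = {Q1, Q2, Q3}" "\<Phi> M (pp R1) = pp Q1" "\<Phi> M (pp R2) = pp Q2"
    "\<Phi> M (pp R3) = pp Q3" "to_ac (det M) * (dt R1 R2 * dt R2 R3 * dt R3 R1) = D" using \<Phi>_enum[OF M] by metis
  have "M \<in> SL2 \<longleftrightarrow> to_ac (det M) = 1" unfolding SL2_def using to_ac_eq_iff[of "det M" 1] by simp
  also have "\<dots> \<longleftrightarrow> dt R1 R2 * dt R2 R3 * dt R3 R1 = D" using R(5) D_nz by auto
  also have "\<dots> \<longleftrightarrow> (R1, R2, R3) \<in> {(Q1, Q2, Q3), (Q2, Q3, Q1), (Q3, Q1, Q2)}" by (rule enum_D(1)[OF R(1)])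
  also have "\<dots> \<longleftrightarrow> \<Phi> M \<in> even_perms"
    using enum_set_cases[OF R(1)] R(2-4) \<Phi>_Bij[OF M] pp_distinct distinct unfolding even_perms_def by auto
  finally show ?thesis .
qed

end

section \<open>Groups of prime order and permutations of three points\<close>

lemma (in group) prime_order_cyclic:
  assumes "prime (card (carrier G))"
  obtains x where "x \<in> carrier G" "carrier G = range (\<lambda>n::int. x [^] n)"
proof -
  have fin: "finite (carrier G)" using assms prime_gt_0_nat card_ge_0_finite by blast
  have "card (carrier G) > 1" using assms prime_gt_1_nat by blast
  then have "carrier G \<noteq> {\<one>}" by auto
  then obtain x where x: "x \<in> carrier G" "x \<noteq> \<one>" using one_closed by blast
  have "ord x dvd card (carrier G)" using ord_dvd_group_order[OF x(1)] by (simp add: Coset.order_def)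
  moreover have "ord x \<noteq> 1" using ord_eq_1[OF x(1)] x(2) by blast
  ultimately have "ord x = card (carrier G)" using assms by (metis prime_nat_iff)
  then have "card (generate G {x}) = card (carrier G)" using generate_pow_card[OF x(1)] by simp
  moreover have "generate G {x} \<subseteq> carrier G" using generate_incl[of "{x}"] x(1) by simp
  ultimately have "generate G {x} = carrier G" using fin card_subset_eq by blast
  then have "carrier G = range (\<lambda>n::int. x [^] n)" using generate_pow[OF x(1)] by (simp add: full_SetCompr_eq)
  then show ?thesis using that x(1) by blast
qed

lemma (in group) prime_order_iso:
  assumes p: "prime (card (carrier G))"
  shows "G \<cong> integer_mod_group (card (carrier G))"
proof -
  let ?p = "card (carrier G)"
  have p0: "?p > 0" using p prime_gt_0_nat by blast
  obtain x where x: "x \<in> carrier G" "carrier G = range (\<lambda>n::int. x [^] n)" by (rule prime_order_cyclic[OF p])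
  have xp: "x [^] int ?p = \<one>" using pow_order_eq_1[OF x(1)] by (simp add: int_pow_int Coset.order_def)
  have md: "x [^] (n mod int ?p) = x [^] n" for n :: int
  proof -
    have "x [^] n = x [^] (int ?p * (n div int ?p) + n mod int ?p)" by simp
    also have "\<dots> = (x [^] int ?p) [^] (n div int ?p) \<otimes> x [^] (n mod int ?p)"
      unfolding int_pow_mult[OF x(1)] int_pow_pow[OF x(1)] by (simp only: mult.commute)
    also have "\<dots> = x [^] (n mod int ?p)" unfolding xp using x(1) by simp
    finally show ?thesis by simp
  qed
  define h where "h = (\<lambda>n::int. x [^] n)"
  have car: "carrier (integer_mod_group ?p) = {0..<int ?p}" using p0 by (simp add: carrier_integer_mod_group)
  have im: "h ` {0..<int ?p} = carrier G"
  proof (intro subset_antisym subsetI)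
    fix y assume "y \<in> carrier G"
    then obtain n :: int where "y = x [^] n" using x(2) by auto
    then have "y = h (n mod int ?p)" using md by (simp add: h_def)
    moreover have "n mod int ?p \<in> {0..<int ?p}" using p0 by simp
    ultimately show "y \<in> h ` {0..<int ?p}" by blast
  qed (use x(1) in \<open>auto simp: h_def\<close>)
  then have "inj_on h {0..<int ?p}" by (intro eq_card_imp_inj_on) simp_all
  moreover have "h \<in> hom (integer_mod_group ?p) G"
    using x(1) by (intro homI) (simp_all add: h_def md int_pow_mult)
  ultimately have "h \<in> iso (integer_mod_group ?p) G"
    unfolding iso_def bij_betw_def car using im by simp
  then have "integer_mod_group ?p \<cong> G" by (rule is_isoI)
  then show ?thesis by (rule group.iso_sym[OF group_integer_mod_group])
qed

lemma BijGroup_iso_sym_group: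
  assumes "finite S"
  shows "BijGroup S \<cong> sym_group (card S)"
proof -
  let ?I = "{1..card S}"
  obtain e where e: "bij_betw e ?I S" using assms by (metis ex_bij_betw_nat_finite_1)
  define e' where "e' = inv_into ?I e"
  have e': "bij_betw e' S ?I" unfolding e'_def by (rule bij_betw_inv_into[OF e])
  have ee: "e (e' P) = P" if "P \<in> S" for P using that e by (simp add: e'_def bij_betw_def f_inv_into_f)
  have e'e: "e' (e i) = i" if "i \<in> ?I" for i using that e by (simp add: e'_def bij_betw_def)
  have eS: "e i \<in> S" if "i \<in> ?I" for i using that e by (auto simp: bij_betw_def)
  have e'I: "e' P \<in> ?I" if "P \<in> S" for P using that e' by (auto simp: bij_betw_def)
  \<comment> \<open>Transport along the enumeration \<open>e\<close>. The conventions off the set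
    differ: \<open>permutes\<close> wants the identity there, \<open>Bij\<close> wants
    \<open>undefined\<close>.\<close>
  define h where "h f = (\<lambda>i. if i \<in> ?I then e' (f (e i)) else i)" for f
  define k where "k p = (\<lambda>P\<in>S. e (p (e' P)))" for p
  have fS: "f P \<in> S" if "f \<in> Bij S" "P \<in> S" for f P using that Bij_imp_funcset by blast
  have h: "h f permutes ?I" if f: "f \<in> Bij S" for f
  proof (rule bij_imp_permutes)
    have "bij_betw (e' \<circ> (f \<circ> e)) ?I ?I"
      using f e e' by (intro bij_betw_trans[OF bij_betw_trans]) (auto simp: Bij_def)
    then show "bij_betw (h f) ?I ?I" by (rule bij_betw_cong[THEN iffD1, rotated]) (simp add: h_def)
  qed (auto simp: h_def)
  have k: "k p \<in> Bij S" if p: "p permutes ?I" for p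
  proof -
    have "bij_betw (e \<circ> (p \<circ> e')) S S"
      using permutes_imp_bij[OF p] e e' by (intro bij_betw_trans[OF bij_betw_trans]) auto
    then have "bij_betw (k p) S S" by (rule bij_betw_cong[THEN iffD1, rotated]) (simp add: k_def)
    then show ?thesis by (simp add: Bij_def k_def)
  qed
  have "k (h f) = f" if f: "f \<in> Bij S" for f
  proof (rule extensionalityI[of _ S])
    show "f \<in> extensional S" using f by (rule Bij_imp_extensional)
    show "k (h f) P = f P" if "P \<in> S" for P
      using that e'I[OF that] fS[OF f that] by (simp add: k_def h_def ee)
  qed (simp add: k_def)
  moreover have "h (k p) = p" if p: "p permutes ?I" for p
  proof
    fix i show "h (k p) i = p i"
      using permutes_in_image[OF p, of i] permutes_not_in[OF p, of i] eS e'e by (auto simp: h_def k_def)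
  qed
  ultimately have "bij_betw h (Bij S) {p. p permutes ?I}"
    using h k by (intro bij_betw_byWitness[where f' = k]) auto
  moreover have "h (compose S f f') = h f \<circ> h f'" if "f \<in> Bij S" "f' \<in> Bij S" for f f'
    using fS[OF that(2)] eS e'I ee by (auto simp: fun_eq_iff h_def compose_eq)
  ultimately have "h \<in> iso (BijGroup S) (sym_group (card S))"
    unfolding iso_def hom_def BijGroup_def sym_group_def using h compose_Bij by auto
  then show ?thesis by (rule is_isoI)
qed

section \<open>Centralisers in the symmetric group of three points\<close>

locale three_points =
  fixes A B C :: 'a and H :: "('a \<Rightarrow> 'a) set"
  assumes dist: "A \<noteq> B" "B \<noteq> C" "C \<noteq> A" and H: "H \<subseteq> Bij {A, B, C}"
begin

text \<open>Lists a map by its values at \<open>A\<close>, \<open>B\<close>, \<open>C\<close>. The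
  symmetric group becomes an explicit six-element set, and centralisers are found by cases.\<close>

definition tri :: "'a \<Rightarrow> 'a \<Rightarrow> 'a \<Rightarrow> 'a \<Rightarrow> 'a" where
  "tri x y z = (\<lambda>P\<in>{A, B, C}. if P = A then x else if P = B then y else z)"

lemma tri_simps [simp]: "tri x y z A = x" "tri x y z B = y" "tri x y z C = z"
  using dist by (auto simp: tri_def)

lemma tri_eq_iff [simp]: "tri x y z = tri x' y' z' \<longleftrightarrow> x = x' \<and> y = y' \<and> z = z'"
  by (metis tri_simps)

lemma tri_Bij: "{x, y, z} = {A, B, C} \<Longrightarrow> tri x y z \<in> Bij {A, B, C}"
proof -
  assume eq: "{x, y, z} = {A, B, C}"
  have "tri x y z ` {A, B, C} = {A, B, C}" using eq by simp
  moreover have "inj_on (tri x y z) {A, B, C}" by (rule eq_card_imp_inj_on) (use calculation in simp_all)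
  moreover have "tri x y z \<in> extensional {A, B, C}" by (simp add: tri_def)
  ultimately show ?thesis unfolding Bij_def bij_betw_def by blast
qed

lemma Bij_cases:
  assumes f: "f \<in> Bij {A, B, C}"
  shows "f \<in> {tri A B C, tri B C A, tri C A B, tri A C B, tri C B A, tri B A C}"
proof -
  have "f = tri (f A) (f B) (f C)"
  proof (rule extensionalityI[of _ "{A, B, C}"])
    show "f \<in> extensional {A, B, C}" using f by (rule Bij_imp_extensional)
  qed (auto simp: tri_def)
  moreover have "f A \<in> {A, B, C}" "f B \<in> {A, B, C}" "f C \<in> {A, B, C}" using f Bij_imp_funcset by blast+
  moreover have "f A \<noteq> f B" "f B \<noteq> f C" "f C \<noteq> f A"
    using f dist by (auto simp: Bij_def bij_betw_def inj_on_def)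
  ultimately show ?thesis using dist by (metis insertE insertI1 insertI2 emptyE)
qed

lemma Bij_eq: "Bij {A, B, C} = {tri A B C, tri B C A, tri C A B, tri A C B, tri C B A, tri B A C}"
  using Bij_cases tri_Bij by (auto simp: insert_commute)

definition Z where "Z = {f \<in> Bij {A, B, C}. \<forall>h\<in>H. \<forall>P\<in>{A, B, C}. f (h P) = h (f P)}"

definition Ev where
  "Ev = {f \<in> Bij {A, B, C}. (f A, f B, f C) \<in> {(A, B, C), (B, C, A), (C, A, B)}}"

lemma Ev_eq: "Ev = {tri A B C, tri B C A, tri C A B}"
proof (rule Set.set_eqI)
  fix f
  have "f \<in> Bij {A, B, C} \<longleftrightarrow> f \<in> {tri A B C, tri B C A, tri C A B, tri A C B, tri C B A, tri B A C}"
    by (simp only: Bij_eq)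
  then show "f \<in> Ev \<longleftrightarrow> f \<in> {tri A B C, tri B C A, tri C A B}"
    by (cases "f = tri A B C"; cases "f = tri B C A"; cases "f = tri C A B"; cases "f = tri A C B";
        cases "f = tri C B A"; cases "f = tri B A C") (simp_all add: Ev_def dist dist[symmetric])
qed

text \<open>A three-cycle of S_3 has the cyclic group it generates as its centraliser.\<close>

lemma commute_cycle:
  assumes "h \<in> Bij {A, B, C}"
  shows "(\<forall>P\<in>{A, B, C}. tri B C A (h P) = h (tri B C A P)) \<longleftrightarrow> h \<in> Ev"
    and "(\<forall>P\<in>{A, B, C}. tri C A B (h P) = h (tri C A B P)) \<longleftrightarrow> h \<in> Ev"
  using Bij_cases[OF assms] unfolding Ev_eq
  by (elim insertE emptyE; simp add: dist dist[symmetric])+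

text \<open>Conjugating a transposition by \<open>h\<close> moves its fixed point by
  \<open>h\<close>, and a transposition of three points is determined by its fixed point.\<close>

lemma commute_transposition:
  assumes "h \<in> Bij {A, B, C}"
  shows "(\<forall>P\<in>{A, B, C}. tri A C B (h P) = h (tri A C B P)) \<longleftrightarrow> h A = A"
    and "(\<forall>P\<in>{A, B, C}. tri C B A (h P) = h (tri C B A P)) \<longleftrightarrow> h B = B"
    and "(\<forall>P\<in>{A, B, C}. tri B A C (h P) = h (tri B A C P)) \<longleftrightarrow> h C = C"
  using Bij_cases[OF assms] by (elim insertE emptyE; simp add: dist dist[symmetric])+

lemma commute_id:
  assumes "h \<in> Bij {A, B, C}"
  shows "\<forall>P\<in>{A, B, C}. tri A B C (h P) = h (tri A B C P)"
  using Bij_cases[OF assms] by (elim insertE emptyE; simp)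

text \<open>The dictionary between centraliser and arithmetic: with the Galois group for
  \<open>H\<close>, evenness of \<open>H\<close> becomes a square discriminant, and a point fixed by
  \<open>H\<close> becomes a rational root.\<close>

lemma mem_Z:
  "tri A B C \<in> Z" "tri B C A \<in> Z \<longleftrightarrow> H \<subseteq> Ev" "tri C A B \<in> Z \<longleftrightarrow> H \<subseteq> Ev"
  "tri A C B \<in> Z \<longleftrightarrow> (\<forall>h\<in>H. h A = A)" "tri C B A \<in> Z \<longleftrightarrow> (\<forall>h\<in>H. h B = B)"
  "tri B A C \<in> Z \<longleftrightarrow> (\<forall>h\<in>H. h C = C)"
proof -
  have B: "h \<in> Bij {A, B, C}" if "h \<in> H" for h using H that by blast
  have T: "tri A B C \<in> Bij {A, B, C}" "tri B C A \<in> Bij {A, B, C}" "tri C A B \<in> Bij {A, B, C}"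
    "tri A C B \<in> Bij {A, B, C}" "tri C B A \<in> Bij {A, B, C}" "tri B A C \<in> Bij {A, B, C}"
    unfolding Bij_eq by simp_all
  show "tri A B C \<in> Z" unfolding Z_def using T commute_id[OF B] by blast
  show "tri B C A \<in> Z \<longleftrightarrow> H \<subseteq> Ev" unfolding Z_def using T commute_cycle(1)[OF B] by blast
  show "tri C A B \<in> Z \<longleftrightarrow> H \<subseteq> Ev" unfolding Z_def using T commute_cycle(2)[OF B] by blast
  show "tri A C B \<in> Z \<longleftrightarrow> (\<forall>h\<in>H. h A = A)" unfolding Z_def using T commute_transposition(1)[OF B] by blast
  show "tri C B A \<in> Z \<longleftrightarrow> (\<forall>h\<in>H. h B = B)" unfolding Z_def using T commute_transposition(2)[OF B] by blast
  show "tri B A C \<in> Z \<longleftrightarrow> (\<forall>h\<in>H. h C = C)" unfolding Z_def using T commute_transposition(3)[OF B] by blast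
qed

lemma Z_subset: "Z \<subseteq> {tri A B C, tri B C A, tri C A B, tri A C B, tri C B A, tri B A C}"
  unfolding Z_def Bij_eq by blast

definition Fx where "Fx = {P \<in> {A, B, C}. \<forall>h\<in>H. h P = P}"

lemma two_fixed:
  assumes "h \<in> H" "P \<in> {A, B, C}" "Q \<in> {A, B, C}" "P \<noteq> Q" "h P = P" "h Q = Q"
  shows "h = tri A B C"
proof -
  have "h \<in> Bij {A, B, C}" using assms(1) H by blast
  then show ?thesis using Bij_cases[of h] assms dist by auto
qed

lemma even_fixed:
  assumes "h \<in> H" "h \<in> Ev" "P \<in> {A, B, C}" "h P = P"
  shows "h = tri A B C"
  using assms dist unfolding Ev_eq by auto

lemma Z_Ev: "Z \<inter> Ev = (if H \<subseteq> Ev then Ev else {tri A B C})"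
  using mem_Z(1-3) dist unfolding Ev_eq by auto

lemma card_Ev: "card Ev = 3"
  unfolding Ev_eq using dist by (simp add: card_insert_if)

lemma Z_no_fixed:
  assumes "Fx = {}"
  shows "Z = (if H \<subseteq> Ev then Ev else {tri A B C})"
proof -
  have "\<not> (\<forall>h\<in>H. h A = A)" "\<not> (\<forall>h\<in>H. h B = B)" "\<not> (\<forall>h\<in>H. h C = C)" using assms unfolding Fx_def by blast+
  then have "tri A C B \<notin> Z" "tri C B A \<notin> Z" "tri B A C \<notin> Z" using mem_Z by simp_all
  then have "Z \<subseteq> Ev" using Z_subset unfolding Ev_eq by auto
  then show ?thesis using Z_Ev by blast
qed

text \<open>An even permutation of three points with a fixed point is the identity, so
  \<open>H\<close> acts trivially and everything commutes with it.\<close>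

lemma even_fixed_all:
  assumes "Fx \<noteq> {}" "H \<subseteq> Ev"
  shows "Fx = {A, B, C}" "Z = Bij {A, B, C}" "card Z = 6"
proof -
  obtain P where P: "P \<in> {A, B, C}" "\<And>h. h \<in> H \<Longrightarrow> h P = P" using assms(1) unfolding Fx_def by blast
  have "h = tri A B C" if "h \<in> H" for h using even_fixed[OF that _ P(1) P(2)[OF that]] assms(2) that by blast
  then have id: "\<forall>h\<in>H. h A = A" "\<forall>h\<in>H. h B = B" "\<forall>h\<in>H. h C = C" by (metis tri_simps)+
  show "Fx = {A, B, C}" unfolding Fx_def using id by auto
  have "Bij {A, B, C} \<subseteq> Z" unfolding Bij_eq using mem_Z id assms(2) by simp
  then show Z: "Z = Bij {A, B, C}" unfolding Z_def by blast
  show "card Z = 6" unfolding Z Bij_eq using dist by (simp add: card_insert_if)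
qed

text \<open>Some element of \<open>H\<close> is not the identity and so fixes at most one point.
  Besides the identity, only the transposition fixing the common fixed point lies in
  \<open>Z\<close>.\<close>

lemma odd_fixed:
  assumes "Fx \<noteq> {}" "\<not> H \<subseteq> Ev"
  shows "card Fx = 1" "card Z = 2"
proof -
  obtain h where h: "h \<in> H" "h \<notin> Ev" using assms(2) by blast
  then have hn: "h \<noteq> tri A B C" by (auto simp: Ev_eq)
  have one: "P = Q" if "P \<in> Fx" "Q \<in> Fx" for P Q
    using two_fixed[OF h(1), of P Q] hn that h(1) unfolding Fx_def by blast
  then obtain P where "Fx = {P}" using assms(1) by blast
  then show "card Fx = 1" by simp
  have "(A \<in> Fx \<and> B \<notin> Fx \<and> C \<notin> Fx) \<or> (A \<notin> Fx \<and> B \<in> Fx \<and> C \<notin> Fx) \<or> (A \<notin> Fx \<and> B \<notin> Fx \<and> C \<in> Fx)"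
    using \<open>Fx = {P}\<close> dist unfolding Fx_def by auto
  moreover have m: "tri A C B \<in> Z \<longleftrightarrow> A \<in> Fx" "tri C B A \<in> Z \<longleftrightarrow> B \<in> Fx" "tri B A C \<in> Z \<longleftrightarrow> C \<in> Fx"
    "tri A B C \<in> Z" "tri B C A \<notin> Z" "tri C A B \<notin> Z"
    using mem_Z assms(2) by (simp_all add: Fx_def)
  ultimately consider "tri A C B \<in> Z" "tri C B A \<notin> Z" "tri B A C \<notin> Z"
    | "tri A C B \<notin> Z" "tri C B A \<in> Z" "tri B A C \<notin> Z" | "tri A C B \<notin> Z" "tri C B A \<notin> Z" "tri B A C \<in> Z" by argo
  then have "Z = {tri A B C, tri A C B} \<or> Z = {tri A B C, tri C B A} \<or> Z = {tri A B C, tri B A C}"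
  proof cases
    case 1
    then have "Z = {tri A B C, tri A C B}" using Z_subset m(4-6) by blast
    then show ?thesis by blast
  next
    case 2
    then have "Z = {tri A B C, tri C B A}" using Z_subset m(4-6) by blast
    then show ?thesis by blast
  next
    case 3
    then have "Z = {tri A B C, tri B A C}" using Z_subset m(4-6) by blast
    then show ?thesis by blast
  qed
  then show "card Z = 2" by (elim disjE) (simp_all add: card_insert_if dist dist[symmetric])
qed

end

section \<open>The automorphism group\<close>

lemma (in group) subgroup_centraliser:
  assumes "H \<subseteq> carrier G"
  shows "subgroup (centraliser G H) G"
proof (rule subgroupI)
  show "centraliser G H \<noteq> {}" using assms one_closed by (force simp: centraliser_def)
  fix x assume x: "x \<in> centraliser G H"
  show "inv x \<in> centraliser G H" unfolding centraliser_def
  proof (intro CollectI conjI ballI)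
    show "inv x \<in> carrier G" using x by (simp add: centraliser_def)
    fix h assume h: "h \<in> H"
    have xh: "x \<in> carrier G" "h \<in> carrier G" "x \<otimes> h = h \<otimes> x" using x h assms by (auto simp: centraliser_def)
    have "inv x \<otimes> h = inv x \<otimes> (h \<otimes> x) \<otimes> inv x" using xh(1,2) by (simp add: m_assoc)
    also have "\<dots> = inv x \<otimes> x \<otimes> h \<otimes> inv x" unfolding xh(3)[symmetric] using xh(1,2) by (simp add: m_assoc[symmetric])
    also have "\<dots> = h \<otimes> inv x" using xh(1,2) by simp
    finally show "inv x \<otimes> h = h \<otimes> inv x" .
  qed
  fix y assume y: "y \<in> centraliser G H"
  show "x \<otimes> y \<in> centraliser G H" unfolding centraliser_def
  proof (intro CollectI conjI ballI)
    show "x \<otimes> y \<in> carrier G" using x y by (simp add: centraliser_def)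
    fix h assume h: "h \<in> H"
    have c: "x \<in> carrier G" "y \<in> carrier G" "h \<in> carrier G" "x \<otimes> h = h \<otimes> x" "y \<otimes> h = h \<otimes> y"
      using x y h assms by (auto simp: centraliser_def)
    have "x \<otimes> y \<otimes> h = x \<otimes> h \<otimes> y" using c(1-3,5) by (simp add: m_assoc)
    also have "\<dots> = h \<otimes> (x \<otimes> y)" unfolding c(4) using c(1-3) by (simp add: m_assoc)
    finally show "x \<otimes> y \<otimes> h = h \<otimes> (x \<otimes> y)" .
  qed
qed (auto simp: centraliser_def)

lemma subgroup_SL2: "subgroup SL2 (GL2 :: ('k::field^2^2) monoid)"
proof -
  interpret GL2: group "GL2 :: ('k^2^2) monoid" by (rule group_GL2)
  show ?thesis
  proof (rule GL2.subgroupI)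
    show "SL2 \<subseteq> carrier (GL2 :: ('k^2^2) monoid)" by (auto simp: SL2_def carrier_GL2 invertible_det_nz)
    have "(mat 1 :: 'k^2^2) \<in> SL2" by (simp add: SL2_def)
    then show "SL2 \<noteq> ({} :: ('k^2^2) set)" by blast
    fix M :: "'k^2^2" assume M: "M \<in> SL2"
    then have "M \<in> carrier GL2" by (simp add: SL2_def carrier_GL2 invertible_det_nz)
    then have "inv\<^bsub>GL2\<^esub> M ** M = mat 1" using GL2.l_inv by (simp add: mult_GL2 one_GL2)
    then have "det (inv\<^bsub>GL2\<^esub> M) * det M = 1" using det_mul[of "inv\<^bsub>GL2\<^esub> M" M] by simp
    then show "inv\<^bsub>GL2\<^esub> M \<in> SL2" using M by (simp add: SL2_def)
  qed (simp add: SL2_def mult_GL2 det_mul)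
qed

context cubic_roots
begin

abbreviation cent where "cent \<equiv> centraliser (BijGroup (form_roots g)) (galois_group g)"

lemma \<Phi>_hom:
  assumes "M \<in> auts g" "N \<in> auts g"
  shows "\<Phi> (M ** N) = \<Phi> M \<otimes>\<^bsub>BijGroup (form_roots g)\<^esub> \<Phi> N"
proof (rule Bij_ext)
  have MN: "M ** N \<in> auts g"
    using subgroup.m_closed[OF subgroup_auts assms] by (simp add: mult_GL2)
  show "\<Phi> (M ** N) \<in> Bij (form_roots g)" by (rule \<Phi>_Bij[OF MN])
  show "\<Phi> M \<otimes>\<^bsub>BijGroup (form_roots g)\<^esub> \<Phi> N \<in> Bij (form_roots g)"
    using \<Phi>_Bij assms by (simp add: mult_BijGroup compose_Bij)
  fix Q assume "Q \<in> {Q1, Q2, Q3}"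
  then have P: "pp Q \<in> form_roots g" by (rule root_vector(4))
  show "\<Phi> (M ** N) (pp Q) = (\<Phi> M \<otimes>\<^bsub>BijGroup (form_roots g)\<^esub> \<Phi> N) (pp Q)"
    using \<Phi>_mult[OF assms P] mult_BijGroup[OF \<Phi>_Bij[OF assms(1)] \<Phi>_Bij[OF assms(2)]] P
    by (simp add: compose_eq)
qed

lemma \<Phi>_inj_on: "inj_on \<Phi> (auts g)"
proof (rule inj_onI)
  fix M N assume M: "M \<in> auts g" and N: "N \<in> auts g" and eq: "\<Phi> M = \<Phi> N"
  obtain N' where N': "N' \<in> auts g" "\<And>v. vact N (vact N' v) = v" "\<And>v. vact N' (vact N v) = v"
    using vact_inverse[OF N] by blast
  have id: "N ** N' = mat 1" "N' ** N = mat 1" by (rule vact_eqI; simp add: vact_mult N')+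
  have MN: "N' ** M \<in> auts g" using subgroup.m_closed[OF subgroup_auts N'(1) M] by (simp add: mult_GL2)
  have "\<Phi> (N' ** M) P = P" if P: "P \<in> form_roots g" for P
  proof -
    have "\<Phi> (N' ** M) P = \<Phi> N' (\<Phi> N P)" using \<Phi>_mult[OF N'(1) M P] by (simp add: eq)
    also have "\<dots> = \<Phi> (N' ** N) P" using \<Phi>_mult[OF N'(1) N P] by simp
    also have "\<dots> = P" using \<Phi>_one[OF P] by (simp add: id)
    finally show ?thesis .
  qed
  then have "N' ** M = mat 1" by (rule \<Phi>_inj[OF MN])
  then have "N ** (N' ** M) = N" by simp
  then show "M = N" by (simp add: matrix_mul_assoc id)
qed

lemma \<Phi>_image: "\<Phi> ` auts g = cent"
proof (intro subset_antisym subsetI)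
  fix f assume "f \<in> cent"
  then obtain M where "M \<in> auts g" "\<Phi> M = f" using \<Phi>_surj by blast
  then show "f \<in> \<Phi> ` auts g" by blast
qed (use \<Phi>_centralises in blast)

lemma aut_group_iso: "aut_group g \<cong> (BijGroup (form_roots g))\<lparr>carrier := cent\<rparr>"
proof -
  have "\<Phi> \<in> iso (aut_group g) ((BijGroup (form_roots g))\<lparr>carrier := cent\<rparr>)"
    unfolding iso_def hom_def bij_betw_def aut_group_def
    using \<Phi>_hom \<Phi>_inj_on \<Phi>_image \<Phi>_centralises by (auto simp: mult_GL2)
  then show ?thesis by (rule is_isoI)
qed

lemma card_auts: "card (auts g) = card cent"
  using card_image[OF \<Phi>_inj_on] \<Phi>_image by simp

lemma card_auts_SL2: "card (auts g \<inter> SL2) = card (cent \<inter> even_perms)"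
proof -
  have "\<Phi> ` (auts g \<inter> SL2) = cent \<inter> even_perms"
  proof (intro subset_antisym subsetI)
    fix f assume "f \<in> \<Phi> ` (auts g \<inter> SL2)"
    then obtain M where M: "f = \<Phi> M" "M \<in> auts g" "M \<in> SL2" by (elim imageE IntE)
    then show "f \<in> cent \<inter> even_perms" using SL2_iff_even \<Phi>_centralises by simp
  next
    fix f assume f: "f \<in> cent \<inter> even_perms"
    then obtain M where M: "M \<in> auts g" "\<Phi> M = f" using \<Phi>_surj by auto
    then have "M \<in> SL2" using f SL2_iff_even by simp
    then show "f \<in> \<Phi> ` (auts g \<inter> SL2)" using M by (intro image_eqI[of _ _ M]) simp_all
  qed
  moreover have "inj_on \<Phi> (auts g \<inter> SL2)" using \<Phi>_inj_on by (rule inj_on_subset) blast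
  ultimately show ?thesis using card_image[of \<Phi> "auts g \<inter> SL2"] by simp
qed

section \<open>Orders and isomorphism types of the automorphism groups\<close>

interpretation T: three_points "pp Q1" "pp Q2" "pp Q3" "galois_group g"
  using pp_distinct galois_group_Bij by unfold_locales (simp_all add: form_roots_eq)

lemma cent_eq: "cent = T.Z"
proof -
  have "f \<in> cent \<longleftrightarrow> f \<in> Bij (form_roots g) \<and> (\<forall>h\<in>galois_group g. \<forall>P\<in>form_roots g. f (h P) = h (f P))" for f
    using centraliser_iff[of f] unfolding galois_group_def ball_simps(9) .
  then show ?thesis unfolding T.Z_def form_roots_eq by blast
qed

lemma even_perms_eq: "even_perms = T.Ev"
  unfolding even_perms_def T.Ev_def form_roots_eq ..

lemma rational_roots_eq: "rational_roots g = T.Fx"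
proof (rule Set.set_eqI)
  fix P
  have "rational_roots g \<subseteq> form_roots g" by (auto simp: rational_roots_def)
  moreover have "P \<in> rational_roots g \<longleftrightarrow> P \<in> T.Fx" if "P \<in> form_roots g"
  proof -
    obtain Q where Q: "Q \<in> {Q1, Q2, Q3}" "P = pp Q" using root_vector_cases[OF \<open>P \<in> form_roots g\<close>] by metis
    have "P \<in> {pp Q1, pp Q2, pp Q3}" using that form_roots_eq by simp
    then show ?thesis using rational_root_iff_fixed[OF Q(1)] unfolding T.Fx_def Q(2) by blast
  qed
  moreover have "T.Fx \<subseteq> form_roots g" unfolding T.Fx_def form_roots_eq by blast
  ultimately show "P \<in> rational_roots g \<longleftrightarrow> P \<in> T.Fx" by blast
qed

abbreviation sq where "sq \<equiv> is_square (cubic_disc a b c d)"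

lemma sq_iff: "sq \<longleftrightarrow> galois_group g \<subseteq> T.Ev"
  using is_square_iff_even even_perms_eq by simp

lemma irr_iff: "irreducible g \<longleftrightarrow> T.Fx = {}"
  using irreducible_iff rational_roots_eq by simp

lemma card_A1: "card (auts g \<inter> SL2) = (if sq then 3 else 1)"
  unfolding card_auts_SL2 cent_eq even_perms_eq T.Z_Ev sq_iff by (simp add: T.card_Ev)

lemma card_A:
  "card (auts g) = (if irreducible g then if sq then 3 else 1 else if sq then 6 else 2)"
proof (cases "irreducible g")
  case True
  then have "T.Fx = {}" by (simp add: irr_iff)
  then show ?thesis using True T.Z_no_fixed T.card_Ev unfolding card_auts cent_eq sq_iff by simp
next
  case False
  then have "T.Fx \<noteq> {}" by (simp add: irr_iff)
  then show ?thesis using False T.even_fixed_all(3) T.odd_fixed(2) unfolding card_auts cent_eq sq_iff by simp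
qed

lemma card_rational_roots: "\<not> irreducible g \<Longrightarrow> \<not> sq \<Longrightarrow> card (rational_roots g) = 1"
  unfolding rational_roots_eq irr_iff sq_iff by (rule T.odd_fixed(1))

lemma iso_sym_group:
  assumes "\<not> irreducible g" "sq"
  shows "aut_group g \<cong> sym_group 3"
proof -
  have "T.Z = Bij {pp Q1, pp Q2, pp Q3}" by (rule T.even_fixed_all(2)[OF assms[unfolded irr_iff sq_iff]])
  then have "cent = Bij (form_roots g)" unfolding cent_eq by (simp only: form_roots_eq)
  then have "(BijGroup (form_roots g))\<lparr>carrier := cent\<rparr> = BijGroup (form_roots g)" by (simp add: BijGroup_def)
  moreover have "finite (form_roots g)" unfolding form_roots_eq by simp
  ultimately show ?thesis
    using iso_trans[OF aut_group_iso] BijGroup_iso_sym_group[of "form_roots g"] card_form_roots by simp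
qed

lemma splits:
  assumes "\<not> irreducible g" "sq"
  shows "\<exists>p1 q1 p2 q2 p3 q3. g = linear_form p1 q1 * linear_form p2 q2 * linear_form p3 q3"
proof -
  have "T.Fx = {pp Q1, pp Q2, pp Q3}" by (rule T.even_fixed_all(1)[OF assms[unfolded irr_iff sq_iff]])
  then have R: "Q \<in> range to_ac \<times> range to_ac" if "Q \<in> {Q1, Q2, Q3}" for Q
    using rational_roots_iff[OF that] that unfolding rational_roots_eq by auto
  have "\<exists>x y. Q = (to_ac x, to_ac y)" if "Q \<in> {Q1, Q2, Q3}" for Q using R[OF that] by blast
  from this[of Q1] this[of Q2] this[of Q3] obtain x1 y1 x2 y2 x3 y3 where
    Q: "Q1 = (to_ac x1, to_ac y1)" "Q2 = (to_ac x2, to_ac y2)" "Q3 = (to_ac x3, to_ac y3)" by auto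
  have "to_ac a = to_ac (- \<kappa> * (y1 * y2 * y3))"
    "to_ac b = to_ac (\<kappa> * (x1 * y2 * y3 + y1 * x2 * y3 + y1 * y2 * x3))"
    "to_ac c = to_ac (- \<kappa> * (x1 * x2 * y3 + x1 * y2 * x3 + y1 * x2 * x3))"
    "to_ac d = to_ac (\<kappa> * (x1 * x2 * x3))"
    using coeffs unfolding Q by simp_all
  then have "a = - \<kappa> * (y1 * y2 * y3)" "b = \<kappa> * (x1 * y2 * y3 + y1 * x2 * y3 + y1 * y2 * x3)"
    "c = - \<kappa> * (x1 * x2 * y3 + x1 * y2 * x3 + y1 * x2 * x3)" "d = \<kappa> * (x1 * x2 * x3)"
    unfolding to_ac_eq_iff by blast+
  \<comment> \<open>The bracket of \<open>(x, y)\<close> with (X, Y) is \<open>x Y - y X\<close>,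
    that is \<open>linear_form (- y) x\<close>; \<kappa> is absorbed into the first factor.\<close>
  then have "g = linear_form (- \<kappa> * y1) (\<kappa> * x1) * linear_form (- y2) x2 * linear_form (- y3) x3"
    unfolding linear_form_mult3 by (simp add: algebra_simps)
  then show ?thesis by blast
qed

lemma group_aut1_group: "group (aut1_group g)"
  unfolding aut1_group_def
  by (intro group.subgroup_imp_group[OF group_GL2] group.subgroups_Inter_pair[OF group_GL2] subgroup_auts subgroup_SL2)

lemma A1_trivial: "\<not> sq \<Longrightarrow> trivial_group (aut1_group g)"
proof -
  assume "\<not> sq"
  then have "card (carrier (aut1_group g)) = 1" using card_A1 by (simp add: aut1_group_def)
  then show ?thesis using group.trivial_group[OF group_aut1_group] by (metis card_1_singletonE)
qed

lemma A1_cyclic: "sq \<Longrightarrow> cyclic_group (aut1_group g) \<and> Coset.order (aut1_group g) = 3"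
proof -
  assume sq
  then have c: "card (carrier (aut1_group g)) = 3" using card_A1 by (simp add: aut1_group_def)
  interpret A1: group "aut1_group g" by (rule group_aut1_group)
  have "prime (card (carrier (aut1_group g)))" unfolding c by simp
  then have "cyclic_group (aut1_group g)" unfolding A1.cyclic_group using A1.prime_order_cyclic by metis
  then show ?thesis using c by (simp add: Coset.order_def)
qed

text \<open>By \<open>auts_scalars\<close> the subgroup divided out is trivial.\<close>

lemma quotient_iso:
  "(aut_group g) Mod (auts g \<inter> scalars2) \<cong> (BijGroup (form_roots g))\<lparr>carrier := cent\<rparr>"
proof -
  interpret A: group "aut_group g" by (rule group_aut_group)
  have "\<one>\<^bsub>aut_group g\<^esub> = mat 1" by (simp add: aut_group_def one_GL2)
  then have "aut_group g Mod (auts g \<inter> scalars2) \<cong> aut_group g"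
    using A.trivial_factor_iso unfolding auts_scalars by (metis is_isoI)
  then show ?thesis using aut_group_iso by (rule iso_trans)
qed

text \<open>\<open>card_A\<close> yields the orders 1, 3, 2 and 6 in the four cases, so each
  isomorphism type determines its case. Conversely a group of prime order is cyclic, and in the case
  of order 6 the centraliser is the whole symmetric group.\<close>

lemma aut_group_structure:
  "trivial_group (aut_group g) \<longleftrightarrow> irreducible g \<and> \<not> sq"
  "aut_group g \<cong> integer_mod_group 3 \<longleftrightarrow> irreducible g \<and> sq"
  "aut_group g \<cong> integer_mod_group 2 \<longleftrightarrow> \<not> irreducible g \<and> \<not> sq"
  "aut_group g \<cong> sym_group 3 \<longleftrightarrow> \<not> irreducible g \<and> sq"
proof -
  interpret A: group "aut_group g" by (rule group_aut_group)
  have car: "carrier (aut_group g) = auts g" by (simp add: aut_group_def)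
  have "trivial_group (aut_group g) \<longleftrightarrow> card (auts g) = 1"
    unfolding A.trivial_group car by (metis card_1_singletonE card_1_singleton_iff One_nat_def)
  then show "trivial_group (aut_group g) \<longleftrightarrow> irreducible g \<and> \<not> sq" using card_A by simp
  have p: "aut_group g \<cong> integer_mod_group n \<longleftrightarrow> card (auts g) = n" if n: "prime n" for n :: nat
  proof
    assume "aut_group g \<cong> integer_mod_group n"
    then have "card (auts g) = card (carrier (integer_mod_group n))" using iso_same_card car by metis
    also have "\<dots> = n" using prime_gt_0_nat[OF n] by (simp add: carrier_integer_mod_group)
    finally show "card (auts g) = n" .
  next
    assume "card (auts g) = n"
    then show "aut_group g \<cong> integer_mod_group n" using A.prime_order_iso n car by simp
  qed
  have "aut_group g \<cong> integer_mod_group 3 \<longleftrightarrow> card (auts g) = 3" by (rule p) simp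
  then show "aut_group g \<cong> integer_mod_group 3 \<longleftrightarrow> irreducible g \<and> sq" using card_A by simp
  have "aut_group g \<cong> integer_mod_group 2 \<longleftrightarrow> card (auts g) = 2" by (rule p) simp
  then show "aut_group g \<cong> integer_mod_group 2 \<longleftrightarrow> \<not> irreducible g \<and> \<not> sq" using card_A by simp
  show "aut_group g \<cong> sym_group 3 \<longleftrightarrow> \<not> irreducible g \<and> sq"
  proof
    assume "aut_group g \<cong> sym_group 3"
    then have "card (auts g) = 6"
      using iso_same_card[of "aut_group g" "sym_group 3"] by (simp add: car sym_group_card_carrier fact_numeral)
    then show "\<not> irreducible g \<and> sq" using card_A by (auto split: if_splits)
  qed (use iso_sym_group in blast)
qed

end

theorem theorem5p3:
  fixes a b c d \<Delta> :: "'k::field" and g :: "'k poly poly"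
  assumes "CHAR('k) \<noteq> 2" and "CHAR('k) \<noteq> 3"
    and "g = cubic_form a b c d"
    and "\<Delta> = cubic_disc a b c d"
    and "\<Delta> \<noteq> 0"
  shows
    "(\<not> is_square \<Delta> \<longrightarrow> trivial_group (aut1_group g)) \<and>
     (is_square \<Delta> \<longrightarrow> cyclic_group (aut1_group g) \<and> Coset.order (aut1_group g) = 3) \<and>
     card (form_roots g) = 3 \<and>
     subgroup (galois_group g) (BijGroup (form_roots g)) \<and>
     subgroup (centraliser (BijGroup (form_roots g)) (galois_group g)) (BijGroup (form_roots g)) \<and>
     (aut_group g) Mod (auts g \<inter> scalars2) \<cong>
       (BijGroup (form_roots g))
         \<lparr>carrier := centraliser (BijGroup (form_roots g)) (galois_group g)\<rparr> \<and>
     (trivial_group (aut_group g) \<longleftrightarrow> irreducible g \<and> \<not> is_square \<Delta>) \<and>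
     (aut_group g \<cong> integer_mod_group 3 \<longleftrightarrow> irreducible g \<and> is_square \<Delta>) \<and>
     (aut_group g \<cong> integer_mod_group 2 \<longleftrightarrow> \<not> irreducible g \<and> \<not> is_square \<Delta>) \<and>
     (aut_group g \<cong> sym_group 3 \<longleftrightarrow> \<not> irreducible g \<and> is_square \<Delta>) \<and>
     (\<not> irreducible g \<and> \<not> is_square \<Delta> \<longrightarrow> card (rational_roots g) = 1) \<and>
     (\<not> irreducible g \<and> is_square \<Delta> \<longrightarrow>
        (\<exists>p\<^sub>1 q\<^sub>1 p\<^sub>2 q\<^sub>2 p\<^sub>3 q\<^sub>3.
           g = linear_form p\<^sub>1 q\<^sub>1 * linear_form p\<^sub>2 q\<^sub>2 * linear_form p\<^sub>3 q\<^sub>3))"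
proof -
  have nz: "(of_nat p :: 'k) \<noteq> 0" if "prime p" "CHAR('k) \<noteq> p" for p
  proof
    assume "(of_nat p :: 'k) = 0"
    then have "CHAR('k) dvd p" by (simp add: of_nat_eq_0_iff_char_dvd)
    then have "CHAR('k) = 1 \<or> CHAR('k) = p" using that(1) unfolding prime_nat_iff by blast
    then show False using that(2) CHAR_not_1'[where 'a = 'k] by simp
  qed
  interpret cubic a b c d
  proof
    show "(2::'k) \<noteq> 0" using nz[of 2] assms(1) by simp
    show "(3::'k) \<noteq> 0" using nz[of 3] assms(2) by simp
    show "cubic_disc a b c d \<noteq> 0" using assms(4,5) by simp
  qed
  obtain \<kappa> Q1 Q2 Q3 where "cubic_roots a b c d \<kappa> Q1 Q2 Q3" using cubic_roots_exist by blast
  then interpret cubic_roots a b c d \<kappa> Q1 Q2 Q3 .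
  have "subgroup (centraliser (BijGroup (form_roots g)) (galois_group g)) (BijGroup (form_roots g))"
    unfolding assms(3) using galois_group_Bij
    by (intro group.subgroup_centraliser[OF group_BijGroup]) (simp add: carrier_BijGroup)
  then show ?thesis
    unfolding assms(3,4)
    using A1_trivial A1_cyclic card_form_roots subgroup_galois_group quotient_iso aut_group_structure
      card_rational_roots splits by simp
qed

end
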